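(* Consider the random-design linear regression setting of the context and the maximal $p$-value criterion $M_M^n$ maximized over all subsets of $f=\{1,\ldots,M_n\}$ (i.e. $\mathcal M=2^{f}$), with $a_n\to\infty$. Assume: (1) $\mathbf E(\mathbf x_{1t}\mathbf x_{1t}')$ is a positive definite matrix; (2) $M_n/a_n\to 0$ as $n\to\infty$; (3) $\lim_{n\to\infty}M_n\ge \max_{i\in t} i$; (4) there is $\kappa>0$ such that for every $n\in\mathbf N$ the minimal eigenvalue $\kappa_n$ of $\mathbf E[\mathbf x_1^{(n)}\mathbf x_1^{(n)\prime}]$ satisfies $\kappa_n>\kappa$; (5) for some $\eta>0$, $n^{-1}M_n^{1+\eta}\to 0$ and $$\sup_n\ \sup_{\|\mathbf d\|=1}\mathbf E\,|\mathbf d'\mathbf z^{(n)}|^{4\lceil 2/\eta\rceil}<\infty,\qquad \mathbf z^{(n)}=\big(\mathbf E[\mathbf x_1^{(n)}\mathbf x_1^{(n)\prime}]\big)^{-1/2}\mathbf x_1^{(n)};$$ (6) $a_n/n\to 0$ as $n\to\infty$. Then $P(M_M^n=t)\to 1$ as $n\to\infty$.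
   Context: Setting. For each $n$ one observes $\mathbf Y=\mathbf X\boldsymbol\beta+\boldsymbol\varepsilon$, where $\mathbf Y$ is $n\times 1$, $\mathbf X$ is an $n\times M_n$ random matrix and $\boldsymbol\varepsilon\sim N(0,\sigma^2\mathbf I)$ is independent of $\mathbf X$, $\sigma^2>0$. The integer sequence $(M_n)$ is nondecreasing (possibly bounded). The rows $\mathbf x_l^{(n)\prime}$, $\mathbf x_l^{(n)}=(x^{(n)}_{l,1},\ldots,x^{(n)}_{l,M_n})'$, $l=1,\ldots,n$, of $\mathbf X$ are i.i.d. with finite second moments of all coordinates, and the law of the first $M_n$ coordinates of $\mathbf x_1^{(n+1)}$ coincides with the law of $\mathbf x_1^{(n)}$. The parameter is $\boldsymbol\beta=(\beta_1,\ldots,\beta_{M_n})'$, where the $\beta_i$ do not depend on $n$ and only finitely many are nonzero. The minimal true model is $t=\{i:\beta_i\ne 0\}$ (a fixed finite set, possibly empty); $p_t=|t|$. By convention $\max_{i\in\emptyset}i=0$. $\mathbf x_{lt}$ denotes the subvector of $\mathbf x_l^{(n)}$ with indices in $t$. A model is a set $j\subseteq f=\{1,\ldots,M_n\}$, $p_j=|j|$; $f$ is the full model ($p_f=M_n$), $0$ denotes the empty model ($\mathbf Y=\boldsymbol\varepsilon$). $RSS(j)$ is the sum of squared residuals of the least squares fit of $\mathbf Y$ on the columns of $\mathbf X$ with indices in $j$ (no intercept; $RSS(0)=\|\mathbf Y\|^2$). For $j\subseteq k$, $$R^n_{jk}=\frac{RSS(j)-RSS(k)}{RSS(j)}.$$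 For $j\subsetneq k$, $p(R^n_{jk}|p_k,p_j)=1-F(R^n_{jk})$ where $F$ is the cumulative distribution function of the Beta distribution with shape parameters $\frac{p_k-p_j}{2}$ and $\frac{n-p_k}{2}$ (defined for $n>p_k$). Maximal $p$-value criterion (MPVC): for a sequence $(a_n)$ of nonnegative numbers with $a_n\to\infty$, $$M_M^n=\operatorname{argmax}_{j\in\mathcal M}\, e^{-p_ja_n}\,p(R^n_{jf}|M_n,p_j),$$ with the convention $p(R^n_{ff}|M_n,M_n)=1$. If the maximizer is not unique, one with the smallest number of elements is chosen; remaining ties are broken arbitrarily. *)

theory Defs
  imports "HOL-Probability.Probability" "Jordan_Normal_Form.Char_Poly"
begin

section \<open>Matrices\<close>

text \<open>Vectors and matrices of varying dimension are those of \<open>Jordan_Normal_Form\<close>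
  (entries indexed from 0).\<close>

definition pos_def_mat :: "real mat \<Rightarrow> bool" where
  "pos_def_mat A \<longleftrightarrow> square_mat A \<and> transpose_mat A = A \<and>
     (\<forall>v \<in> carrier_vec (dim_row A). v \<noteq> 0\<^sub>v (dim_row A) \<longrightarrow>
        scalar_prod v (mult_mat_vec A v) > 0)"

text \<open>Only meaningful for non-empty matrices with at least one real eigenvalue, such as
  symmetric ones of positive dimension.\<close>

definition min_eigenvalue :: "real mat \<Rightarrow> real" where
  "min_eigenvalue A = Min {k. eigenvalue A k}"

text \<open>$A^{-1/2}$ for positive definite \<open>A\<close>: the unique positive definite \<open>B\<close> with
  $B^2 = A^{-1}$.\<close>

definition inv_sqrt_mat :: "real mat \<Rightarrow> real mat" where
  "inv_sqrt_mat A = (THE B. B \<in> carrier_mat (dim_row A) (dim_row A) \<and> pos_def_mat B \<and>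
     B * B * A = 1\<^sub>m (dim_row A))"

text \<open>The subvector of $(u_1, u_2, \ldots)$ with indices in the finite set \<open>J\<close>.\<close>

definition subvec :: "nat set \<Rightarrow> (nat \<Rightarrow> real) \<Rightarrow> real Matrix.vec" where
  "subvec J u = vec_of_list (map u (sorted_list_of_set J))"

text \<open>$E(V V')$ for an \<open>m\<close>-dimensional random vector \<open>V\<close>.\<close>

definition second_moment_mat ::
  "'a measure \<Rightarrow> nat \<Rightarrow> ('a \<Rightarrow> real Matrix.vec) \<Rightarrow> real mat" where
  "second_moment_mat P m V =
     Matrix.mat m m (\<lambda>(i, j). \<integral>\<omega>. vec_index (V \<omega>) i * vec_index (V \<omega>) j \<partial>P)"

section \<open>Least squares\<close>

text \<open>\<open>xs l i\<close> is the entry of the design matrix in row \<open>l\<close> and column \<open>i\<close>, both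
  counted from 1, \<open>ys l\<close> the \<open>l\<close>-th response.\<close>

definition sq_resid ::
  "nat \<Rightarrow> (nat \<Rightarrow> nat \<Rightarrow> real) \<Rightarrow> (nat \<Rightarrow> real) \<Rightarrow> nat set \<Rightarrow> (nat \<Rightarrow> real) \<Rightarrow> real" where
  "sq_resid n xs ys j b = (\<Sum>l\<in>{1..n}. (ys l - (\<Sum>i\<in>j. b i * xs l i))\<^sup>2)"

text \<open>The least squares coefficients need not be unique, but the residuals are.\<close>

definition ls_coef ::
  "nat \<Rightarrow> (nat \<Rightarrow> nat \<Rightarrow> real) \<Rightarrow> (nat \<Rightarrow> real) \<Rightarrow> nat set \<Rightarrow> (nat \<Rightarrow> real)" where
  "ls_coef n xs ys j = (ARG_MIN (sq_resid n xs ys j) b. True)"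

definition RSS ::
  "nat \<Rightarrow> (nat \<Rightarrow> nat \<Rightarrow> real) \<Rightarrow> (nat \<Rightarrow> real) \<Rightarrow> nat set \<Rightarrow> real" where
  "RSS n xs ys j = sq_resid n xs ys j (ls_coef n xs ys j)"

definition R_stat ::
  "nat \<Rightarrow> (nat \<Rightarrow> nat \<Rightarrow> real) \<Rightarrow> (nat \<Rightarrow> real) \<Rightarrow> nat set \<Rightarrow> nat set \<Rightarrow> real" where
  "R_stat n xs ys j k = (RSS n xs ys j - RSS n xs ys k) / RSS n xs ys j"

section \<open>The maximal p-value criterion\<close>

definition beta_distribution :: "real \<Rightarrow> real \<Rightarrow> real measure" where
  "beta_distribution a b = density lborel (\<lambda>u. ennreal
     (if 0 < u \<and> u < 1 then u powr (a - 1) * (1 - u) powr (b - 1) / Beta a b else 0))"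

text \<open>The p-value of the value \<open>r\<close> of the statistic for a model of size \<open>pj\<close> nested in a
  model of size \<open>pk\<close>, meaningful for \<open>pj < pk < n\<close>.\<close>

definition p_value :: "nat \<Rightarrow> real \<Rightarrow> nat \<Rightarrow> nat \<Rightarrow> real" where
  "p_value n r pk pj =
     1 - cdf (beta_distribution ((real pk - real pj) / 2) ((real n - real pk) / 2)) r"

definition mpvc_score ::
  "nat \<Rightarrow> nat \<Rightarrow> real \<Rightarrow> (nat \<Rightarrow> nat \<Rightarrow> real) \<Rightarrow> (nat \<Rightarrow> real) \<Rightarrow> nat set \<Rightarrow> real" where
  "mpvc_score n m a xs ys j = exp (- real (card j) * a) *
     (if j = {1..m} then 1 else p_value n (R_stat n xs ys j {1..m}) m (card j))"

text \<open>\<open>j\<close> is an admissible outcome of the criterion over all subsets of \<open>{1..m}\<close>: a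
  maximizer of the score with the fewest elements among all maximizers.\<close>

definition is_mpvc_choice ::
  "nat \<Rightarrow> nat \<Rightarrow> real \<Rightarrow> (nat \<Rightarrow> nat \<Rightarrow> real) \<Rightarrow> (nat \<Rightarrow> real) \<Rightarrow> nat set \<Rightarrow> bool" where
  "is_mpvc_choice n m a xs ys j \<longleftrightarrow>
     is_arg_min card (is_arg_max (mpvc_score n m a xs ys) (\<lambda>k. k \<subseteq> {1..m})) j"

section \<open>The regression model\<close>

definition response ::
  "nat \<Rightarrow> (nat \<Rightarrow> real) \<Rightarrow> (nat \<Rightarrow> nat \<Rightarrow> real) \<Rightarrow> (nat \<Rightarrow> real) \<Rightarrow> nat \<Rightarrow> real" where
  "response m \<beta> xs es l = (\<Sum>i\<in>{1..m}. \<beta> i * xs l i) + es l"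

text \<open>Coefficients are indexed from 1; \<open>\<beta> 0\<close> is irrelevant.\<close>

definition true_model :: "(nat \<Rightarrow> real) \<Rightarrow> nat set" where
  "true_model \<beta> = {i. 1 \<le> i \<and> \<beta> i \<noteq> 0}"

text \<open>Experiment \<open>n\<close> may live on its own probability space \<open>P n\<close>. \<open>x n l i\<close> is the entry
  of the design matrix in row \<open>l\<close> and column \<open>i\<close>, \<open>eps n l\<close> the \<open>l\<close>-th error. All
  indices, \<open>n\<close> included, start at 1. In \<open>normal_eps\<close>, $N(0, \sigma^2 I)$ is written as the
  product of \<open>n\<close> copies of $N(0, \sigma^2)$. In \<open>eps_indep_x\<close>, the
  generated sigma-algebras are used because \<open>indep_var\<close> needs both variables to have the
  same value type; \<open>indep_set\<close> includes the measurability of \<open>eps\<close>.\<close>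

locale random_design_regression =
  fixes P :: "nat \<Rightarrow> 'a measure"
    and M :: "nat \<Rightarrow> nat"
    and x :: "nat \<Rightarrow> nat \<Rightarrow> nat \<Rightarrow> 'a \<Rightarrow> real"
    and eps :: "nat \<Rightarrow> nat \<Rightarrow> 'a \<Rightarrow> real"
    and \<beta> :: "nat \<Rightarrow> real"
    and \<sigma> :: real
  assumes prob_space: "\<And>n. n \<ge> 1 \<Longrightarrow> prob_space (P n)"
    and mono_M: "mono_on {1..} M"
    and rows_indep: "\<And>n. n \<ge> 1 \<Longrightarrow>
      prob_space.indep_vars (P n) (\<lambda>l. PiM {1..M n} (\<lambda>i. borel))
        (\<lambda>l \<omega>. \<lambda>i\<in>{1..M n}. x n l i \<omega>) {1..n}"
    and rows_ident: "\<And>n l. n \<ge> 1 \<Longrightarrow> l \<in> {1..n} \<Longrightarrow>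
      distr (P n) (PiM {1..M n} (\<lambda>i. borel)) (\<lambda>\<omega>. \<lambda>i\<in>{1..M n}. x n l i \<omega>) =
      distr (P n) (PiM {1..M n} (\<lambda>i. borel)) (\<lambda>\<omega>. \<lambda>i\<in>{1..M n}. x n 1 i \<omega>)"
    and second_moments: "\<And>n l i. n \<ge> 1 \<Longrightarrow> l \<in> {1..n} \<Longrightarrow> i \<in> {1..M n} \<Longrightarrow>
      integrable (P n) (\<lambda>\<omega>. (x n l i \<omega>)\<^sup>2)"
    and rows_consistent: "\<And>n. n \<ge> 1 \<Longrightarrow>
      distr (P (Suc n)) (PiM {1..M n} (\<lambda>i. borel)) (\<lambda>\<omega>. \<lambda>i\<in>{1..M n}. x (Suc n) 1 i \<omega>) =
      distr (P n) (PiM {1..M n} (\<lambda>i. borel)) (\<lambda>\<omega>. \<lambda>i\<in>{1..M n}. x n 1 i \<omega>)"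
    and sigma_pos: "\<sigma> > 0"
    and normal_eps: "\<And>n. n \<ge> 1 \<Longrightarrow>
      distr (P n) (PiM {1..n} (\<lambda>l. borel)) (\<lambda>\<omega>. \<lambda>l\<in>{1..n}. eps n l \<omega>) =
      PiM {1..n} (\<lambda>l. density lborel (\<lambda>u. ennreal (normal_density 0 \<sigma> u)))"
    and eps_indep_x: "\<And>n. n \<ge> 1 \<Longrightarrow>
      prob_space.indep_set (P n)
        (sets (vimage_algebra (space (P n))
          (\<lambda>\<omega>. \<lambda>l\<in>{1..n}. \<lambda>i\<in>{1..M n}. x n l i \<omega>)
          (PiM {1..n} (\<lambda>l. PiM {1..M n} (\<lambda>i. borel)))))
        (sets (vimage_algebra (space (P n))
          (\<lambda>\<omega>. \<lambda>l\<in>{1..n}. eps n l \<omega>) (PiM {1..n} (\<lambda>l. borel))))"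
    and finite_true_model: "finite (true_model \<beta>)"

definition gram :: "'a measure \<Rightarrow> nat set \<Rightarrow> (nat \<Rightarrow> 'a \<Rightarrow> real) \<Rightarrow> real mat" where
  "gram P J u = second_moment_mat P (card J) (\<lambda>\<omega>. subvec J (\<lambda>i. u i \<omega>))"

definition standardized_row ::
  "'a measure \<Rightarrow> nat \<Rightarrow> (nat \<Rightarrow> 'a \<Rightarrow> real) \<Rightarrow> 'a \<Rightarrow> real Matrix.vec" where
  "standardized_row P m u \<omega> =
     mult_mat_vec (inv_sqrt_mat (gram P {1..m} u)) (subvec {1..m} (\<lambda>i. u i \<omega>))"

end

theory Submission
  imports Defs "HOL-Real_Asymp.Real_Asymp"
begin

text \<open>Why the criterion finds the true model \<open>t\<close>. Write \<open>R k\<close> for the statistic of the model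
  \<open>k\<close> against the full model and \<open>p(k)\<close> for its p-value. A model with more elements than \<open>t\<close> has
  score at most \<open>exp (- (|t| + 1) a\<^sub>n)\<close>, because p-values are at most 1. It loses as soon as
  \<open>p(t) > exp (- a\<^sub>n)\<close>, and this holds because \<open>R t\<close> is of smaller order than \<open>a\<^sub>n / n\<close>. Any other
  competitor fails to contain \<open>t\<close>; then its residuals keep a fixed positive proportion of the
  signal, \<open>R k\<close> stays above a constant, and \<open>p(k)\<close> is exponentially small in \<open>n\<close>, which beats the
  penalty because \<open>a\<^sub>n = o(n)\<close> (\<open>mpvc_score_less\<close>). Both p-values are controlled by comparing
  integrals of the Beta density over two intervals, so that the normalising constant cancels
  (\<open>p_value_lower\<close>, \<open>p_value_upper\<close>).

  The size of the residual sums of squares is deterministic once three inequalities are known, which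
  form the locale \<open>regression_good_event\<close>. With \<open>q(b) = E (b'x)\<^sup>2\<close> they say that
  \<open>\<parallel>Xb\<parallel>\<^sup>2\<close> is at least a constant times \<open>n q(b)\<close>, that \<open>(\<epsilon>'Xb)\<^sup>2\<close> is at most \<open>n s q(b)\<close>, and that
  \<open>\<parallel>\<epsilon>\<parallel>\<^sup>2\<close> lies between two constant multiples of \<open>n\<close>. Completing the square gives
  \<open>RSS f \<ge> \<parallel>\<epsilon>\<parallel>\<^sup>2 - O(s)\<close>, while \<open>RSS t \<le> \<parallel>\<epsilon>\<parallel>\<^sup>2\<close>, and \<open>RSS k \<ge> \<parallel>\<epsilon>\<parallel>\<^sup>2 + const * n\<close> whenever \<open>k\<close>
  misses an element of \<open>t\<close>; here the lower bound on the eigenvalues turns a missing coefficient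
  into a lower bound on \<open>q\<close>. The choice \<open>s = sqrt (a\<^sub>n M\<^sub>n)\<close> is between \<open>M\<^sub>n\<close> and \<open>a\<^sub>n\<close> in order.

  That these inequalities hold with probability tending to 1 is shown in coordinates in which
  the second moment matrix of a row is the identity; an orthonormal eigenbasis of
  \<open>E (xx')\<close> provides them, and the moment condition carries over since it is invariant under
  rotations (\<open>whitened_sample_rows\<close>). In these coordinates the squared cross terms are bounded by
  \<open>\<Sum>\<^sub>i (\<Sum>\<^sub>l z\<^sub>l\<^sub>i \<epsilon>\<^sub>l)\<^sup>2\<close>, whose mean is \<open>n M\<^sub>n \<sigma>\<^sup>2\<close>, and Markov's inequality applies. For the
  quadratic form \<open>\<parallel>Xb\<parallel>\<^sup>2\<close>, a sum of independent nonnegative variables with bounded second moments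
  has an exponentially small lower tail (\<open>chernoff_lower_tail\<close>). This is strong enough for a union
  bound over a grid of \<open>(2 n\<^sup>2 + 1) ^ M\<^sub>n\<close> directions, because \<open>M\<^sub>n\<^bsup>1 + \<eta>\<^esup> = o(n)\<close> makes
  \<open>M\<^sub>n log n = o(n)\<close>. A crude bound on the trace then passes from the grid to all directions
  (\<open>quadratic_form_lower_from_grid\<close>).\<close>

section \<open>Orthonormal bases and symmetric matrices\<close>

definition dot :: "nat set \<Rightarrow> (nat \<Rightarrow> real) \<Rightarrow> (nat \<Rightarrow> real) \<Rightarrow> real" where
  "dot K v w = (\<Sum>k\<in>K. v k * w k)"

definition mat_app :: "nat \<Rightarrow> (nat \<Rightarrow> nat \<Rightarrow> real) \<Rightarrow> (nat \<Rightarrow> real) \<Rightarrow> nat \<Rightarrow> real" where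
  "mat_app m A v k = (\<Sum>l<m. A k l * v l)"

lemma dot_commute: "dot K v w = dot K w v"
  by (simp add: dot_def mult.commute)

lemma dot_add_left: "dot K (\<lambda>k. v k + w k) z = dot K v z + dot K w z"
  by (simp add: dot_def algebra_simps sum.distrib)

lemma dot_diff_left: "dot K (\<lambda>k. v k - w k) z = dot K v z - dot K w z"
  by (simp add: dot_def algebra_simps sum_subtractf)

lemma dot_scale_left: "dot K (\<lambda>k. c * v k) z = c * dot K v z"
  by (simp add: dot_def algebra_simps sum_distrib_left)

lemma dot_sum_left: "dot K (\<lambda>k. \<Sum>i\<in>I. f i k) z = (\<Sum>i\<in>I. dot K (f i) z)"
  unfolding dot_def sum_distrib_right by (rule sum.swap)

lemma dot_add_right: "dot K z (\<lambda>k. v k + w k) = dot K z v + dot K z w"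
  by (simp add: dot_commute[of K z] dot_add_left)

lemma dot_diff_right: "dot K z (\<lambda>k. v k - w k) = dot K z v - dot K z w"
  by (simp add: dot_commute[of K z] dot_diff_left)

lemma dot_scale_right: "dot K z (\<lambda>k. c * v k) = c * dot K z v"
  by (simp add: dot_commute[of K z] dot_scale_left)

lemma dot_sum_right: "dot K z (\<lambda>k. \<Sum>i\<in>I. f i k) = (\<Sum>i\<in>I. dot K z (f i))"
  by (simp add: dot_commute[of K z] dot_sum_left)

lemmas dot_linear = dot_add_left dot_diff_left dot_scale_left dot_sum_left
  dot_add_right dot_diff_right dot_scale_right dot_sum_right

lemma dot_cong: "(\<And>k. k \<in> K \<Longrightarrow> v k = v' k) \<Longrightarrow> (\<And>k. k \<in> K \<Longrightarrow> w k = w' k) \<Longrightarrow> dot K v w = dot K v' w'"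
  by (simp add: dot_def)

lemma dot_self_nonneg: "dot K v v \<ge> 0"
  by (simp add: dot_def sum_nonneg)

lemma dot_self_eq_0_iff: "finite K \<Longrightarrow> dot K v v = 0 \<longleftrightarrow> (\<forall>k\<in>K. v k = 0)"
  by (auto simp: dot_def sum_nonneg_eq_0_iff)

lemma dot_mat_app_symmetric:
  assumes "\<And>k l. k < m \<Longrightarrow> l < m \<Longrightarrow> A k l = A l k"
  shows "dot {..<m} (mat_app m A v) w = dot {..<m} v (mat_app m A w)"
proof -
  have "dot {..<m} (mat_app m A v) w = (\<Sum>k<m. \<Sum>l<m. A k l * v l * w k)"
    by (simp add: dot_def mat_app_def sum_distrib_right)
  also have "\<dots> = (\<Sum>l<m. \<Sum>k<m. A k l * v l * w k)" by (rule sum.swap)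
  also have "\<dots> = dot {..<m} v (mat_app m A w)"
    using assms by (auto simp: dot_def mat_app_def sum_distrib_left intro!: sum.cong)
  finally show ?thesis .
qed

definition orthonormal :: "nat \<Rightarrow> nat \<Rightarrow> (nat \<Rightarrow> nat \<Rightarrow> real) \<Rightarrow> bool" where
  "orthonormal m r u \<longleftrightarrow> (\<forall>i<r. \<forall>j<r. dot {..<m} (u i) (u j) = (if i = j then 1 else 0))"

definition residual :: "nat \<Rightarrow> nat \<Rightarrow> (nat \<Rightarrow> nat \<Rightarrow> real) \<Rightarrow> (nat \<Rightarrow> real) \<Rightarrow> nat \<Rightarrow> real" where
  "residual m r u v k = v k - (\<Sum>i<r. dot {..<m} v (u i) * u i k)"

lemma residual_orthogonal:
  assumes "orthonormal m r u" "j < r"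
  shows "dot {..<m} (residual m r u v) (u j) = 0"
proof -
  have "dot {..<m} (residual m r u v) (u j) = dot {..<m} v (u j) - (\<Sum>i<r. dot {..<m} v (u i) * dot {..<m} (u i) (u j))"
    unfolding residual_def by (simp add: dot_linear)
  also have "(\<Sum>i<r. dot {..<m} v (u i) * dot {..<m} (u i) (u j)) = (\<Sum>i<r. if i = j then dot {..<m} v (u i) else 0)"
    using assms by (intro sum.cong) (auto simp: orthonormal_def)
  finally show ?thesis using assms(2) by simp
qed

lemma residual_norm:
  assumes "orthonormal m r u"
  shows "dot {..<m} (residual m r u v) (residual m r u v) = dot {..<m} v v - (\<Sum>i<r. (dot {..<m} v (u i))\<^sup>2)"
proof -
  have "dot {..<m} (residual m r u v) (residual m r u v)
      = dot {..<m} (residual m r u v) v - (\<Sum>i<r. dot {..<m} v (u i) * dot {..<m} (residual m r u v) (u i))"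
    by (subst (2) residual_def[abs_def]) (simp add: dot_linear)
  also have "\<dots> = dot {..<m} (residual m r u v) v"
    using residual_orthogonal[OF assms] by simp
  also have "\<dots> = dot {..<m} v v - (\<Sum>i<r. (dot {..<m} v (u i))\<^sup>2)"
    unfolding residual_def by (simp add: dot_linear power2_eq_square dot_commute[of "{..<m}" v "u _"])
  finally show ?thesis .
qed

lemma dot_unit: "k < m \<Longrightarrow> dot {..<m} (\<lambda>l. if l = k then 1 else 0) v = v k"
proof -
  assume "k < m"
  have "dot {..<m} (\<lambda>l. if l = k then 1 else 0) v = (\<Sum>l<m. if l = k then v l else 0)"
    unfolding dot_def by (intro sum.cong) auto
  then show ?thesis using \<open>k < m\<close> by simp
qed

lemma dot_normalize:
  assumes "dot {..<m} v v > 0"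
  shows "dot {..<m} (\<lambda>k. 1 / sqrt (dot {..<m} v v) * v k) (\<lambda>k. 1 / sqrt (dot {..<m} v v) * v k) = 1"
proof -
  have "dot {..<m} (\<lambda>k. c * v k) (\<lambda>k. c * v k) = c\<^sup>2 * dot {..<m} v v" for c
    unfolding dot_scale_left dot_scale_right by (simp add: power2_eq_square)
  from this[of "1 / sqrt (dot {..<m} v v)"] show ?thesis
    using assms by (simp add: power_divide)
qed

text \<open>Summing \<open>\<parallel>e\<^sub>k\<parallel>\<^sup>2 - \<Sum>\<^sub>i u\<^sub>i(k)\<^sup>2\<close> over the unit vectors counts dimensions: fewer than \<open>m\<close> orthonormal
  vectors leave a nonzero residual, and \<open>m\<close> of them leave none. Both facts below rest on this.\<close>

lemma sum_residual_norm_units: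
  assumes "orthonormal m r u"
  shows "(\<Sum>k<m. dot {..<m} (residual m r u (\<lambda>l. if l = k then 1 else 0))
              (residual m r u (\<lambda>l. if l = k then 1 else 0))) = real m - real r"
proof -
  have "(\<Sum>k<m. dot {..<m} (residual m r u (\<lambda>l. if l = k then 1 else 0))
              (residual m r u (\<lambda>l. if l = k then 1 else 0))) = (\<Sum>k<m. 1 - (\<Sum>i<r. u i k * u i k))"
    by (intro sum.cong) (auto simp: residual_norm[OF assms] dot_unit power2_eq_square)
  also have "\<dots> = real m - (\<Sum>k<m. \<Sum>i<r. u i k * u i k)" by (simp add: sum_subtractf)
  also have "(\<Sum>k<m. \<Sum>i<r. u i k * u i k) = (\<Sum>i<r. dot {..<m} (u i) (u i))"
    unfolding dot_def by (rule sum.swap)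
  also have "\<dots> = real r" using assms by (simp add: orthonormal_def)
  finally show ?thesis .
qed

lemma orthonormal_complement_nonzero:
  assumes "orthonormal m r u" "r < m"
  shows "\<exists>w. dot {..<m} w w = 1 \<and> (\<forall>i<r. dot {..<m} w (u i) = 0)"
proof -
  let ?R = "\<lambda>k. residual m r u (\<lambda>l. if l = k then 1 else 0)"
  have "(\<Sum>k<m. dot {..<m} (?R k) (?R k)) \<noteq> 0"
    unfolding sum_residual_norm_units[OF assms(1)] using assms(2) by simp
  then obtain k where k: "dot {..<m} (?R k) (?R k) \<noteq> 0" by (rule sum.not_neutral_contains_not_neutral)
  define N where "N = dot {..<m} (?R k) (?R k)"
  have N: "N > 0" using k dot_self_nonneg[of "{..<m}" "?R k"] unfolding N_def by linarith
  let ?w = "\<lambda>l. 1 / sqrt N * ?R k l"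
  have "dot {..<m} ?w ?w = 1" using N unfolding N_def by (rule dot_normalize)
  moreover have "dot {..<m} ?w (u i) = 0" if "i < r" for i
    using residual_orthogonal[OF assms(1) that] unfolding dot_scale_left by simp
  ultimately show ?thesis by (intro exI[of _ ?w]) simp
qed

lemma orthonormal_basis_columns:
  assumes "orthonormal m m u" "k < m" "l < m"
  shows "(\<Sum>i<m. u i k * u i l) = (if k = l then 1 else 0)"
proof -
  let ?R = "\<lambda>k. residual m m u (\<lambda>l. if l = k then 1 else 0)"
  have "(\<Sum>k<m. dot {..<m} (?R k) (?R k)) = 0"
    unfolding sum_residual_norm_units[OF assms(1)] by simp
  then have "dot {..<m} (?R k) (?R k) = 0" using assms(2)
    by (subst (asm) sum_nonneg_eq_0_iff) (auto simp: dot_self_nonneg)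
  then have "?R k l = 0" using assms(3) by (simp add: dot_self_eq_0_iff del: not_less)
  then show ?thesis using assms by (simp add: residual_def dot_unit split: if_splits)
qed

lemma orthonormal_basis_expansion:
  assumes "orthonormal m m u" "l < m"
  shows "(\<Sum>i<m. dot {..<m} v (u i) * u i l) = v l"
proof -
  have "(\<Sum>i<m. dot {..<m} v (u i) * u i l) = (\<Sum>i<m. \<Sum>k<m. v k * (u i k * u i l))"
    unfolding dot_def sum_distrib_right mult.assoc ..
  also have "\<dots> = (\<Sum>k<m. v k * (\<Sum>i<m. u i k * u i l))"
    unfolding sum_distrib_left by (rule sum.swap)
  also have "\<dots> = (\<Sum>k<m. if k = l then v k else 0)"
    using assms by (intro sum.cong) (auto simp: orthonormal_basis_columns)
  finally show ?thesis using assms(2) by simp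
qed

lemma orthonormal_basis_parseval:
  assumes "orthonormal m m u"
  shows "dot {..<m} v w = (\<Sum>i<m. dot {..<m} v (u i) * dot {..<m} w (u i))"
proof -
  have "dot {..<m} v w = dot {..<m} (\<lambda>l. \<Sum>i<m. dot {..<m} v (u i) * u i l) w"
    by (rule dot_cong) (simp_all add: orthonormal_basis_expansion[OF assms])
  also have "\<dots> = (\<Sum>i<m. dot {..<m} v (u i) * dot {..<m} w (u i))"
    by (simp add: dot_sum_left dot_scale_left dot_commute[of "{..<m}" w "u _"])
  finally show ?thesis .
qed

text \<open>First order condition at an interior minimum: for small \<open>s\<close> of the sign opposite to \<open>p\<close>, the linear
  term dominates.\<close>

lemma linear_coefficient_zero_if_nonneg:
  fixes p q :: real
  assumes "\<And>s. 0 \<le> s * p + s\<^sup>2 * q"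
  shows "p = 0"
proof (rule ccontr)
  assume p: "p \<noteq> 0"
  define K where "K = \<bar>q\<bar> + 1"
  have K: "K > 0" "\<bar>q\<bar> - K < 0" by (auto simp: K_def)
  have "- p / K * p + (- p / K)\<^sup>2 * q \<le> - p / K * p + (- p / K)\<^sup>2 * \<bar>q\<bar>"
    by (intro add_left_mono mult_left_mono) auto
  also have "\<dots> = p\<^sup>2 / K\<^sup>2 * (\<bar>q\<bar> - K)"
    using K(1) by (simp add: field_simps power2_eq_square)
  also have "\<dots> < 0" using p K by (intro mult_pos_neg divide_pos_pos) auto
  finally show False using assms[of "- p / K"] by linarith
qed

text \<open>Vectors of dimension \<open>m\<close> are represented as functions on all of \<open>nat\<close>; setting the remaining
  coordinates to 0 makes Tychonoff's theorem available.\<close>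

lemma compact_box: "compact {w :: nat \<Rightarrow> real. \<forall>k. w k \<in> (if k < m then {-1..1} else {0})}"
proof -
  have "compactin (product_topology (\<lambda>i. euclidean) UNIV) (PiE UNIV (\<lambda>k::nat. if k < m then {-1..1::real} else {0}))"
    unfolding compactin_PiE by (intro disjI2 ballI) (simp add: compactin_euclidean_iff)
  then show ?thesis
    by (simp only: compactin_euclidean_iff euclidean_product_topology PiE_UNIV_domain Pi_def UNIV_I simp_thms)
qed

lemma rayleigh_minimizer:
  assumes "dot {..<m} w0 w0 = 1" "\<forall>i<r. dot {..<m} w0 (u i) = 0"
  shows "\<exists>w. dot {..<m} w w = 1 \<and> (\<forall>i<r. dot {..<m} w (u i) = 0) \<and>
    (\<forall>v. dot {..<m} v v = 1 \<longrightarrow> (\<forall>i<r. dot {..<m} v (u i) = 0) \<longrightarrow>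
       dot {..<m} (mat_app m A w) w \<le> dot {..<m} (mat_app m A v) v)"
proof -
  let ?box = "{w :: nat \<Rightarrow> real. \<forall>k. w k \<in> (if k < m then {-1..1} else {0})}"
  let ?C = "{w. dot {..<m} w w = 1} \<inter> (\<Inter>i\<in>{..<r}. {w. dot {..<m} w (u i) = 0})"
  let ?t = "\<lambda>v k. if k < m then v k else (0::real)"
  have "continuous_on UNIV (\<lambda>w::nat \<Rightarrow> real. w k)" for k
    by (rule continuous_on_product_coordinates)
  then have c: "continuous_on X (\<lambda>w::nat \<Rightarrow> real. w k)" for k X
    using continuous_on_subset by blast
  have "closed ?C"
    unfolding dot_def
    by (intro closed_Int closed_INT ballI closed_Collect_eq continuous_intros c)
  then have cpt: "compact (?box \<inter> ?C)" using compact_box by (rule compact_Int_closed[rotated])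
  have tmem: "?t v \<in> ?box \<inter> ?C"
    if "dot {..<m} v v = 1" "\<forall>i<r. dot {..<m} v (u i) = 0" for v
  proof -
    have "(v k)\<^sup>2 \<le> 1" if "k < m" for k
    proof -
      have "v k * v k \<le> dot {..<m} v v" unfolding dot_def
        using that by (intro member_le_sum) auto
      then show ?thesis using \<open>dot {..<m} v v = 1\<close> by (simp add: power2_eq_square)
    qed
    then have "\<bar>v k\<bar> \<le> 1" if "k < m" for k using that by (simp add: abs_square_le_1)
    then have "- 1 \<le> v k" "v k \<le> 1" if "k < m" for k using that by (auto simp: abs_le_iff minus_le_iff)
    moreover have "dot {..<m} (?t v) (?t v) = dot {..<m} v v" by (rule dot_cong) auto
    moreover have "dot {..<m} (?t v) (u i) = dot {..<m} v (u i)" for i by (rule dot_cong) auto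
    ultimately show ?thesis using that by auto
  qed
  have "?t w0 \<in> ?box \<inter> ?C" by (rule tmem[OF assms])
  then have ne: "?box \<inter> ?C \<noteq> {}" by (metis empty_iff)
  have "continuous_on (?box \<inter> ?C) (\<lambda>w. dot {..<m} (mat_app m A w) w)"
    unfolding dot_def mat_app_def by (intro continuous_intros c)
  from continuous_attains_inf[OF cpt ne this] obtain w where
    w: "w \<in> ?box \<inter> ?C" "\<forall>v \<in> ?box \<inter> ?C. dot {..<m} (mat_app m A w) w \<le> dot {..<m} (mat_app m A v) v"
    by (elim bexE)
  have "dot {..<m} (mat_app m A w) w \<le> dot {..<m} (mat_app m A v) v"
    if v: "dot {..<m} v v = 1" "\<forall>i<r. dot {..<m} v (u i) = 0" for v
  proof -
    have "dot {..<m} (mat_app m A (?t v)) (?t v) = dot {..<m} (mat_app m A v) v"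
      by (auto simp: dot_def mat_app_def intro!: sum.cong)
    then show ?thesis using bspec[OF w(2) tmem[OF v]] by simp
  qed
  moreover have "dot {..<m} w w = 1" "\<forall>i<r. dot {..<m} w (u i) = 0" using w(1) by auto
  ultimately show ?thesis by (intro exI[of _ w]) simp
qed

text \<open>Eigenvectors are found one at a time: minimise the quadratic form on the unit sphere of the
  orthogonal complement of those already found. By symmetry this complement is invariant, so
  \<open>z = A w - l w\<close> belongs to it for a minimiser \<open>w\<close> with value \<open>l\<close>, and the first order condition in the
  direction \<open>z\<close> reads \<open>\<parallel>z\<parallel>\<^sup>2 = 0\<close>.\<close>

theorem symmetric_eigenbasis:
  assumes sym: "\<And>k l. k < m \<Longrightarrow> l < m \<Longrightarrow> A k l = A l k"
  shows "\<exists>u lam. orthonormal m m u \<and> (\<forall>i<m. \<forall>k<m. mat_app m A (u i) k = lam i * u i k)"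
proof -
  have "\<exists>u lam. orthonormal m r u \<and> (\<forall>i<r. \<forall>k<m. mat_app m A (u i) k = lam i * u i k)" if "r \<le> m" for r
    using that
  proof (induction r)
    case 0
    then show ?case by (simp add: orthonormal_def)
  next
    case (Suc r)
    then obtain u lam where on: "orthonormal m r u"
      and ev: "\<And>i k. i < r \<Longrightarrow> k < m \<Longrightarrow> mat_app m A (u i) k = lam i * u i k" by auto
    from Suc.prems have "r < m" by simp
    obtain w0 where w0: "dot {..<m} w0 w0 = 1" "\<forall>i<r. dot {..<m} w0 (u i) = 0"
      using orthonormal_complement_nonzero[OF on \<open>r < m\<close>] by (elim exE conjE)
    obtain w where
      w: "dot {..<m} w w = 1" "\<forall>i<r. dot {..<m} w (u i) = 0"
      and mini: "\<forall>v. dot {..<m} v v = 1 \<longrightarrow> (\<forall>i<r. dot {..<m} v (u i) = 0) \<longrightarrow>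
         dot {..<m} (mat_app m A w) w \<le> dot {..<m} (mat_app m A v) v"
      using rayleigh_minimizer[OF w0, where A = A] by (elim exE conjE)
    define l where "l = dot {..<m} (mat_app m A w) w"
    have mat_app_scale: "mat_app m A (\<lambda>k. c * v k) = (\<lambda>k. c * mat_app m A v k)" for c v
      by (rule ext) (simp add: mat_app_def sum_distrib_left algebra_simps)
    have mat_app_add: "mat_app m A (\<lambda>k. v k + z k) = (\<lambda>k. mat_app m A v k + mat_app m A z k)" for v z
      by (rule ext) (simp add: mat_app_def sum.distrib algebra_simps)
    have app0: "mat_app m A v = (\<lambda>k. 0)" if "\<forall>k<m. v k = 0" for v
      using that by (auto simp: mat_app_def)
    have hom: "l * dot {..<m} v v \<le> dot {..<m} (mat_app m A v) v" if v: "\<And>i. i < r \<Longrightarrow> dot {..<m} v (u i) = 0" for v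
    proof (cases "dot {..<m} v v = 0")
      case True
      then show ?thesis using app0[of v] by (simp add: dot_self_eq_0_iff) (simp add: dot_def)
    next
      case False
      define N where "N = dot {..<m} v v"
      have N: "N > 0" using False dot_self_nonneg[of "{..<m}" v] unfolding N_def by linarith
      let ?v = "\<lambda>k. 1 / sqrt N * v k"
      have "dot {..<m} ?v ?v = 1" using N unfolding N_def by (rule dot_normalize)
      moreover have "dot {..<m} ?v (u i) = 0" if "i < r" for i using v[OF that] unfolding dot_scale_left by simp
      ultimately have "l \<le> dot {..<m} (mat_app m A ?v) ?v" unfolding l_def using mini by (metis (lifting))
      also have "\<dots> = dot {..<m} (mat_app m A v) v / N"
        using N unfolding mat_app_scale dot_scale_left dot_scale_right by (simp add: field_simps)
      finally show ?thesis using N by (simp add: N_def[symmetric] field_simps)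
    qed
    define z where "z k = mat_app m A w k - l * w k" for k
    have z: "dot {..<m} z (u i) = 0" if "i < r" for i
    proof -
      have "dot {..<m} (mat_app m A w) (u i) = dot {..<m} w (mat_app m A (u i))" by (rule dot_mat_app_symmetric[OF sym])
      also have "\<dots> = dot {..<m} w (\<lambda>k. lam i * u i k)" by (rule dot_cong) (auto simp: ev that)
      also have "\<dots> = 0" using w(2)[rule_format, OF that] by (simp add: dot_linear)
      finally show ?thesis unfolding z_def using w(2)[rule_format, OF that] by (simp add: dot_linear)
    qed
    have "0 \<le> s * (2 * dot {..<m} z z) + s\<^sup>2 * (dot {..<m} (mat_app m A z) z - l * dot {..<m} z z)" for s
    proof -
      let ?v = "\<lambda>k. w k + s * z k"
      have "dot {..<m} ?v (u i) = 0" if "i < r" for i using w(2)[rule_format, OF that] z[OF that] by (simp add: dot_linear)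
      from hom[OF this] have "0 \<le> dot {..<m} (mat_app m A ?v) ?v - l * dot {..<m} ?v ?v" by simp
      also have "dot {..<m} (mat_app m A ?v) ?v = l + 2 * s * dot {..<m} (mat_app m A w) z + s\<^sup>2 * dot {..<m} (mat_app m A z) z"
        using dot_mat_app_symmetric[OF sym, where v = w and w = z]
        by (simp add: mat_app_add mat_app_scale dot_linear l_def power2_eq_square algebra_simps dot_commute[of "{..<m}" z "mat_app m A w"] dot_commute[of "{..<m}" "mat_app m A z" w])
      also have "dot {..<m} ?v ?v = 1 + 2 * s * dot {..<m} w z + s\<^sup>2 * dot {..<m} z z"
        using w(1) by (simp add: dot_linear power2_eq_square algebra_simps dot_commute[of "{..<m}" z w])
      also have "dot {..<m} (mat_app m A w) z = dot {..<m} z z + l * dot {..<m} w z"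
        unfolding dot_def z_def sum_distrib_left sum.distrib[symmetric] by (rule sum.cong) (simp_all add: algebra_simps)
      finally show ?thesis by (simp add: algebra_simps)
    qed
    then have "2 * dot {..<m} z z = 0" by (rule linear_coefficient_zero_if_nonneg)
    then have z0: "z k = 0" if "k < m" for k using that by (simp add: dot_self_eq_0_iff)
    have "orthonormal m (Suc r) (u(r := w))"
      using on w w(2)[rule_format, unfolded dot_commute[of "{..<m}" w]] by (auto simp: orthonormal_def less_Suc_eq)
    moreover have "\<forall>i<Suc r. \<forall>k<m. mat_app m A ((u(r := w)) i) k = (lam(r := l)) i * (u(r := w)) i k"
      using ev z0 by (auto simp: less_Suc_eq z_def)
    ultimately show ?case by blast
  qed
  from this[of m] show ?thesis by simp
qed

section \<open>Inverse square roots of positive definite matrices\<close>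

lemma scalar_prod_vec_dot:
  "scalar_prod (Matrix.vec m v) (Matrix.vec m w) = dot {..<m} v w"
  by (simp add: scalar_prod_def dot_def atLeast0LessThan)

lemma mult_mat_vec_mat_app:
  "A \<in> carrier_mat m m \<Longrightarrow> mult_mat_vec A (Matrix.vec m v) = Matrix.vec m (mat_app m (\<lambda>k l. A $$ (k, l)) v)"
  by (intro eq_vecI) (auto simp: scalar_prod_def mat_app_def atLeast0LessThan)

lemma pos_def_mat_dot:
  assumes "pos_def_mat B" "B \<in> carrier_mat m m"
  shows "0 \<le> dot {..<m} v (mat_app m (\<lambda>k l. B $$ (k, l)) v)"
    and "dot {..<m} v (mat_app m (\<lambda>k l. B $$ (k, l)) v) = 0 \<Longrightarrow> \<forall>k<m. v k = 0"
proof -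
  have *: "dot {..<m} v (mat_app m (\<lambda>k l. B $$ (k, l)) v) > 0" if "\<not> (\<forall>k<m. v k = 0)"
  proof -
    from that obtain k where k: "k < m" "v k \<noteq> 0" by blast
    have "Matrix.vec m v \<noteq> 0\<^sub>v m"
    proof
      assume "Matrix.vec m v = 0\<^sub>v m"
      then have "vec_index (Matrix.vec m v) k = vec_index (0\<^sub>v m) k" by simp
      then show False using k by simp
    qed
    moreover have "dim_row B = m" using assms(2) by simp
    ultimately have "scalar_prod (Matrix.vec m v) (mult_mat_vec B (Matrix.vec m v)) > 0"
      using assms(1) unfolding pos_def_mat_def by (metis vec_carrier)
    then show ?thesis by (simp add: mult_mat_vec_mat_app[OF assms(2)] scalar_prod_vec_dot)
  qed
  show "dot {..<m} v (mat_app m (\<lambda>k l. B $$ (k, l)) v) = 0 \<Longrightarrow> \<forall>k<m. v k = 0" using * by fastforce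
  show "0 \<le> dot {..<m} v (mat_app m (\<lambda>k l. B $$ (k, l)) v)"
  proof (cases "\<forall>k<m. v k = 0")
    case True
    then show ?thesis by (simp add: dot_def)
  next
    case False
    then show ?thesis using * by simp
  qed
qed

text \<open>For \<open>D = B - C\<close>, the equation \<open>B\<^sup>2 = C\<^sup>2\<close> gives \<open>B D + D C = 0\<close>. Multiplying by \<open>D\<close> and taking the
  trace yields a sum of values of the quadratic forms of \<open>B\<close> and \<open>C\<close> at the columns and rows of \<open>D\<close>,
  all of which must vanish.\<close>

lemma pos_def_square_root_unique:
  assumes B: "B \<in> carrier_mat m m" "pos_def_mat B" and C: "C \<in> carrier_mat m m" "pos_def_mat C"
    and eq: "B * B = C * C"
  shows "B = C"
proof -
  define D where "D k l = B $$ (k, l) - C $$ (k, l)" for k l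
  have Csym: "C $$ (k, l) = C $$ (l, k)" if "k < m" "l < m" for k l
    using C that unfolding pos_def_mat_def by (metis carrier_matD index_transpose_mat(1))
  have ent: "(\<Sum>k<m. B $$ (i, k) * D k j) + (\<Sum>k<m. D i k * C $$ (k, j)) = 0" if "i < m" "j < m" for i j
  proof -
    have "(B * B) $$ (i, j) = (C * C) $$ (i, j)" using eq by simp
    then have "(\<Sum>k<m. B $$ (i, k) * B $$ (k, j)) = (\<Sum>k<m. C $$ (i, k) * C $$ (k, j))"
      using that B(1) C(1) by (simp add: scalar_prod_def atLeast0LessThan)
    then show ?thesis
      by (simp add: D_def algebra_simps sum_subtractf)
  qed
  let ?B = "\<lambda>k l. B $$ (k, l)" and ?C = "\<lambda>k l. C $$ (k, l)"
  have "0 = (\<Sum>j<m. \<Sum>i<m. D i j * ((\<Sum>k<m. B $$ (i, k) * D k j) + (\<Sum>k<m. D i k * C $$ (k, j))))"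
    using ent by simp
  also have "\<dots> = (\<Sum>j<m. \<Sum>i<m. D i j * (\<Sum>k<m. B $$ (i, k) * D k j))
     + (\<Sum>j<m. \<Sum>i<m. D i j * (\<Sum>k<m. D i k * C $$ (k, j)))"
    by (simp add: distrib_left sum.distrib)
  also have "(\<Sum>j<m. \<Sum>i<m. D i j * (\<Sum>k<m. B $$ (i, k) * D k j))
      = (\<Sum>j<m. dot {..<m} (\<lambda>i. D i j) (mat_app m ?B (\<lambda>i. D i j)))"
    by (simp add: dot_def mat_app_def)
  also have "(\<Sum>j<m. \<Sum>i<m. D i j * (\<Sum>k<m. D i k * C $$ (k, j)))
      = (\<Sum>i<m. \<Sum>j<m. D i j * (\<Sum>k<m. D i k * C $$ (k, j)))" by (rule sum.swap)
  also have "\<dots> = (\<Sum>i<m. dot {..<m} (D i) (mat_app m ?C (D i)))"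
  proof -
    have "(\<Sum>k<m. D i k * C $$ (k, j)) = mat_app m ?C (D i) j" if "j < m" for i j
      unfolding mat_app_def using that by (intro sum.cong) (auto simp: Csym mult.commute)
    then show ?thesis by (simp add: dot_def)
  qed
  finally have sum0: "(\<Sum>j<m. dot {..<m} (\<lambda>i. D i j) (mat_app m ?B (\<lambda>i. D i j)))
     + (\<Sum>i<m. dot {..<m} (D i) (mat_app m ?C (D i))) = 0" by simp
  moreover have nn: "0 \<le> dot {..<m} (\<lambda>i. D i j) (mat_app m ?B (\<lambda>i. D i j))" for j
    by (rule pos_def_mat_dot(1)[OF B(2,1)])
  moreover have "0 \<le> (\<Sum>i<m. dot {..<m} (D i) (mat_app m ?C (D i)))"
    by (intro sum_nonneg pos_def_mat_dot(1)[OF C(2,1)])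
  moreover have "0 \<le> (\<Sum>j<m. dot {..<m} (\<lambda>i. D i j) (mat_app m ?B (\<lambda>i. D i j)))"
    by (intro sum_nonneg nn)
  ultimately have "(\<Sum>j<m. dot {..<m} (\<lambda>i. D i j) (mat_app m ?B (\<lambda>i. D i j))) = 0" by linarith
  then have "\<forall>j\<in>{..<m}. dot {..<m} (\<lambda>i. D i j) (mat_app m ?B (\<lambda>i. D i j)) = 0"
    by (subst (asm) sum_nonneg_eq_0_iff) (use nn in auto)
  then have "D i j = 0" if "i < m" "j < m" for i j
    using pos_def_mat_dot(2)[OF B(2,1), of "\<lambda>i. D i j"] that by auto
  then show ?thesis using B(1) C(1) by (intro eq_matI) (auto simp: D_def)
qed

text \<open>The function \<open>f\<close> of a matrix with eigenvectors \<open>u\<close>; products of such matrices multiply the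
  eigenvalues, which gives the inverse square root.\<close>

definition spectral_mat :: "nat \<Rightarrow> (nat \<Rightarrow> nat \<Rightarrow> real) \<Rightarrow> (nat \<Rightarrow> real) \<Rightarrow> real mat" where
  "spectral_mat m u f = Matrix.mat m m (\<lambda>(k, l). \<Sum>i<m. f i * (u i k * u i l))"

lemma spectral_mat_carrier [simp]: "spectral_mat m u f \<in> carrier_mat m m"
  by (simp add: spectral_mat_def)

lemma mat_app_spectral_mat:
  assumes "k < m"
  shows "mat_app m (\<lambda>k l. spectral_mat m u f $$ (k, l)) v k = (\<Sum>i<m. f i * dot {..<m} v (u i) * u i k)"
proof -
  have "mat_app m (\<lambda>k l. spectral_mat m u f $$ (k, l)) v k = (\<Sum>l<m. \<Sum>i<m. f i * (u i k * u i l) * v l)"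
    using assms by (simp add: mat_app_def spectral_mat_def sum_distrib_right)
  also have "\<dots> = (\<Sum>i<m. \<Sum>l<m. f i * (u i k * u i l) * v l)" by (rule sum.swap)
  also have "\<dots> = (\<Sum>i<m. f i * dot {..<m} v (u i) * u i k)"
    by (simp add: dot_def sum_distrib_left sum_distrib_right mult_ac)
  finally show ?thesis .
qed

lemma spectral_mat_mult:
  assumes "orthonormal m m u"
  shows "spectral_mat m u f * spectral_mat m u g = spectral_mat m u (\<lambda>i. f i * g i)"
proof (rule eq_matI)
  fix k l assume "k < dim_row (spectral_mat m u (\<lambda>i. f i * g i))" "l < dim_col (spectral_mat m u (\<lambda>i. f i * g i))"
  then have kl: "k < m" "l < m" by (auto simp: spectral_mat_def)
  let ?v = "\<lambda>p. \<Sum>j<m. (g j * u j l) * u j p"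
  have "(spectral_mat m u f * spectral_mat m u g) $$ (k, l)
      = mat_app m (\<lambda>k l. spectral_mat m u f $$ (k, l)) ?v k"
    using kl by (simp add: scalar_prod_def mat_app_def atLeast0LessThan spectral_mat_def mult_ac)
  also have "\<dots> = (\<Sum>i<m. f i * dot {..<m} ?v (u i) * u i k)" by (rule mat_app_spectral_mat[OF kl(1)])
  also have "\<dots> = (\<Sum>i<m. f i * (g i * u i l) * u i k)"
  proof (intro sum.cong refl)
    fix i assume i: "i \<in> {..<m}"
    have "dot {..<m} ?v (u i) = (\<Sum>j<m. (g j * u j l) * dot {..<m} (u j) (u i))"
      by (simp only: dot_sum_left dot_scale_left)
    also have "\<dots> = (\<Sum>j<m. if j = i then g j * u j l else 0)"
      using assms i by (intro sum.cong) (auto simp: orthonormal_def)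
    finally show "f i * dot {..<m} ?v (u i) * u i k = f i * (g i * u i l) * u i k" using i by simp
  qed
  also have "\<dots> = spectral_mat m u (\<lambda>i. f i * g i) $$ (k, l)"
    using kl by (simp add: spectral_mat_def mult_ac)
  finally show "(spectral_mat m u f * spectral_mat m u g) $$ (k, l) = spectral_mat m u (\<lambda>i. f i * g i) $$ (k, l)" .
qed (simp_all add: spectral_mat_def)

lemma spectral_mat_one:
  assumes "orthonormal m m u"
  shows "spectral_mat m u (\<lambda>i. 1) = 1\<^sub>m m"
  using orthonormal_basis_columns[OF assms] by (intro eq_matI) (auto simp: spectral_mat_def)

lemma spectral_mat_cong: "(\<And>i. i < m \<Longrightarrow> f i = g i) \<Longrightarrow> spectral_mat m u f = spectral_mat m u g"
  by (intro eq_matI) (auto simp: spectral_mat_def)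

lemma pos_def_spectral_mat:
  assumes on: "orthonormal m m u" and f: "\<And>i. i < m \<Longrightarrow> f i > 0"
  shows "pos_def_mat (spectral_mat m u f)"
  unfolding pos_def_mat_def
proof (intro conjI ballI impI)
  have dim: "dim_row (spectral_mat m u f) = m" by (simp add: spectral_mat_def)
  show "square_mat (spectral_mat m u f)" by (simp add: spectral_mat_def)
  show "transpose_mat (spectral_mat m u f) = spectral_mat m u f"
    by (intro eq_matI) (auto simp: spectral_mat_def mult_ac)
  fix v :: "real Matrix.vec" assume v: "v \<in> carrier_vec (dim_row (spectral_mat m u f))"
    "v \<noteq> 0\<^sub>v (dim_row (spectral_mat m u f))"
  define w where "w = vec_index v"
  have vw: "v = Matrix.vec m w" using v dim by (intro eq_vecI) (auto simp: w_def)
  have "scalar_prod v (mult_mat_vec (spectral_mat m u f) v)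
     = dot {..<m} w (mat_app m (\<lambda>k l. spectral_mat m u f $$ (k, l)) w)"
    by (simp add: vw mult_mat_vec_mat_app scalar_prod_vec_dot)
  also have "\<dots> = dot {..<m} w (\<lambda>k. \<Sum>i<m. f i * dot {..<m} w (u i) * u i k)"
    by (intro dot_cong) (simp_all add: mat_app_spectral_mat)
  also have "\<dots> = (\<Sum>i<m. f i * (dot {..<m} w (u i))\<^sup>2)"
    by (simp only: dot_sum_right dot_scale_right) (simp add: power2_eq_square mult_ac)
  also have "\<dots> > 0"
  proof -
    have "\<exists>i<m. dot {..<m} w (u i) \<noteq> 0"
    proof (rule ccontr)
      assume "\<not> ?thesis"
      then have "w k = 0" if "k < m" for k
        using orthonormal_basis_expansion[OF on that, of w] by simp
      then have "v = 0\<^sub>v m" unfolding vw by (intro eq_vecI) auto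
      then show False using v dim by simp
    qed
    then obtain i where i: "i < m" "dot {..<m} w (u i) \<noteq> 0" by blast
    show ?thesis
      by (rule sum_pos2[of _ i]) (use i f in \<open>auto simp: less_imp_le\<close>)
  qed
  finally show "0 < scalar_prod v (mult_mat_vec (spectral_mat m u f) v)" .
qed

theorem inv_sqrt_mat_spectral:
  assumes on: "orthonormal m m u" and lam: "\<And>i. i < m \<Longrightarrow> lam i > 0"
  shows "inv_sqrt_mat (spectral_mat m u lam) = spectral_mat m u (\<lambda>i. 1 / sqrt (lam i))"
proof -
  let ?A = "spectral_mat m u lam" and ?B = "spectral_mat m u (\<lambda>i. 1 / sqrt (lam i))"
  have dim: "dim_row ?A = m" by (simp add: spectral_mat_def)
  have pB: "pos_def_mat ?B" using lam by (intro pos_def_spectral_mat on) auto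
  have BB: "?B * ?B = spectral_mat m u (\<lambda>i. 1 / lam i)"
    unfolding spectral_mat_mult[OF on] using lam by (intro spectral_mat_cong) (simp add: less_imp_le)
  have inv: "spectral_mat m u (\<lambda>i. 1 / lam i) * ?A = 1\<^sub>m m"
    unfolding spectral_mat_mult[OF on] spectral_mat_one[OF on, symmetric]
    by (intro spectral_mat_cong) (use lam in force)
  have inv': "?A * spectral_mat m u (\<lambda>i. 1 / lam i) = 1\<^sub>m m"
    unfolding spectral_mat_mult[OF on] spectral_mat_one[OF on, symmetric]
    by (intro spectral_mat_cong) (use lam in force)
  show ?thesis unfolding inv_sqrt_mat_def dim
  proof (rule the_equality)
    show "?B \<in> carrier_mat m m \<and> pos_def_mat ?B \<and> ?B * ?B * ?A = 1\<^sub>m m"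
      using pB BB inv by simp
    fix C assume C: "C \<in> carrier_mat m m \<and> pos_def_mat C \<and> C * C * ?A = 1\<^sub>m m"
    then have CC: "C * C \<in> carrier_mat m m" by auto
    have "C * C = C * C * (?A * spectral_mat m u (\<lambda>i. 1 / lam i))"
      unfolding inv' using right_mult_one_mat[OF CC] by simp
    also have "\<dots> = C * C * ?A * spectral_mat m u (\<lambda>i. 1 / lam i)"
      using CC by (subst assoc_mult_mat[of _ m m _ m _ m]) auto
    also have "\<dots> = ?B * ?B" 
      using C BB left_mult_one_mat[OF spectral_mat_carrier] by simp
    finally have eq: "C * C = ?B * ?B" .
    show "C = ?B" using C by (intro pos_def_square_root_unique[OF _ _ spectral_mat_carrier pB eq]) blast+
  qed
qed

lemma min_eigenvalue_le:
  fixes A :: "real mat"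
  assumes A: "A \<in> carrier_mat m m" and "eigenvalue A k"
  shows "min_eigenvalue A \<le> k"
proof -
  have "{k. eigenvalue A k} = {k. poly (char_poly A) k = 0}"
    using eigenvalue_root_char_poly[OF A] by auto
  moreover have "char_poly A \<noteq> 0" using degree_monic_char_poly[OF A] by auto
  ultimately have "finite {k. eigenvalue A k}" by (simp add: poly_roots_finite)
  then show ?thesis using assms(2) by (simp add: min_eigenvalue_def)
qed

theorem symmetric_mat_spectral:
  assumes A: "A \<in> carrier_mat m m" and sym: "\<And>k l. k < m \<Longrightarrow> l < m \<Longrightarrow> A $$ (k, l) = A $$ (l, k)"
  shows "\<exists>u lam. orthonormal m m u \<and> A = spectral_mat m u lam \<and> (\<forall>i<m. min_eigenvalue A \<le> lam i)"
proof -
  obtain u lam where on: "orthonormal m m u"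
    and ev: "\<forall>i<m. \<forall>k<m. mat_app m (\<lambda>k l. A $$ (k, l)) (u i) k = lam i * u i k"
    using symmetric_eigenbasis[of m "\<lambda>k l. A $$ (k, l)"] sym by blast
  have "A $$ (k, l) = spectral_mat m u lam $$ (k, l)" if kl: "k < m" "l < m" for k l
  proof -
    have "A $$ (k, l) = (\<Sum>p<m. if p = l then A $$ (k, p) else 0)"
      using kl by simp
    also have "\<dots> = (\<Sum>p<m. A $$ (k, p) * (\<Sum>i<m. u i p * u i l))"
      using kl by (intro sum.cong) (auto simp: orthonormal_basis_columns[OF on])
    also have "\<dots> = (\<Sum>p<m. \<Sum>i<m. A $$ (k, p) * u i p * u i l)"
      by (simp add: sum_distrib_left mult_ac)
    also have "\<dots> = (\<Sum>i<m. mat_app m (\<lambda>k l. A $$ (k, l)) (u i) k * u i l)"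
      unfolding mat_app_def sum_distrib_right by (rule sum.swap)
    also have "\<dots> = spectral_mat m u lam $$ (k, l)"
      using kl by (simp add: ev spectral_mat_def mult_ac)
    finally show ?thesis .
  qed
  then have "A = spectral_mat m u lam" using A by (intro eq_matI) (auto simp: spectral_mat_def)
  moreover have "min_eigenvalue A \<le> lam i" if i: "i < m" for i
  proof (rule min_eigenvalue_le[OF A])
    have "mult_mat_vec A (Matrix.vec m (u i)) = lam i \<cdot>\<^sub>v Matrix.vec m (u i)"
      unfolding mult_mat_vec_mat_app[OF A] by (intro eq_vecI) (auto simp: ev i)
    moreover have "Matrix.vec m (u i) \<noteq> 0\<^sub>v m"
    proof
      assume "Matrix.vec m (u i) = 0\<^sub>v m"
      then have "dot {..<m} (u i) (u i) = scalar_prod (0\<^sub>v m) (0\<^sub>v m)"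
        using scalar_prod_vec_dot[of m "u i" "u i"] by simp
      then show False using on i by (simp add: orthonormal_def)
    qed
    ultimately show "eigenvalue A (lam i)"
      using A unfolding eigenvalue_def eigenvector_def by (intro exI[of _ "Matrix.vec m (u i)"]) auto
  qed
  ultimately show ?thesis using on by (intro exI[of _ u] exI[of _ lam]) simp
qed

section \<open>Least squares on a favourable event\<close>

text \<open>Gram-Schmidt in disguise: to add a column, subtract from it its own projection on the
  previous columns, then correct the residual along what is left. If nothing is left, division by zero
  returns 0 and the old coefficients remain valid. The columns need not be linearly independent.\<close>

lemma normal_equations:
  assumes "finite j" "finite L"
  shows "\<exists>b. \<forall>k\<in>j. dot L (\<lambda>l. y l - (\<Sum>i\<in>j. b i * X l i)) (\<lambda>l. X l k) = 0"
  using assms(1)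
proof (induction j arbitrary: y)
  case empty
  show ?case by simp
next
  case (insert k j)
  obtain b where b: "\<forall>i\<in>j. dot L (\<lambda>l. y l - (\<Sum>i\<in>j. b i * X l i)) (\<lambda>l. X l i) = 0"
    using insert.IH[of y] by (elim exE)
  obtain c where c: "\<forall>i\<in>j. dot L (\<lambda>l. X l k - (\<Sum>i\<in>j. c i * X l i)) (\<lambda>l. X l i) = 0"
    using insert.IH[of "\<lambda>l. X l k"] by (elim exE)
  define r where "r l = y l - (\<Sum>i\<in>j. b i * X l i)" for l
  define s where "s l = X l k - (\<Sum>i\<in>j. c i * X l i)" for l
  have r0: "dot L r (\<lambda>l. X l i) = 0" if "i \<in> j" for i using b that by (simp add: r_def[abs_def])
  have s0: "dot L s (\<lambda>l. X l i) = 0" if "i \<in> j" for i using c that by (simp add: s_def[abs_def])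
  (* If the new column lies in the span of the old ones, this is 0 / 0 = 0. *)
  define \<alpha> where "\<alpha> = dot L r s / dot L s s"
  have rs: "dot L r s - \<alpha> * dot L s s = 0"
  proof (cases "dot L s s = 0")
    case True
    then have "\<forall>l\<in>L. s l = 0" using dot_self_eq_0_iff[OF assms(2)] by blast
    then have "dot L r s = 0" by (simp add: dot_def)
    then show ?thesis using True by simp
  qed (simp add: \<alpha>_def)
  define e where "e l = r l - \<alpha> * s l" for l
  have e0: "dot L e (\<lambda>l. X l i) = 0" if "i \<in> j" for i
    using r0[OF that] s0[OF that] by (simp add: e_def[abs_def] dot_linear)
  have es: "dot L e s = 0" using rs by (simp add: e_def[abs_def] dot_linear)
  have "dot L e (\<lambda>l. X l k) = dot L e (\<lambda>l. s l + (\<Sum>i\<in>j. c i * X l i))"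
    by (simp add: s_def[abs_def])
  also have "\<dots> = 0" using es e0 by (simp add: dot_linear)
  finally have ek: "dot L e (\<lambda>l. X l k) = 0" .
  let ?b = "\<lambda>i. if i = k then \<alpha> else b i - \<alpha> * c i"
  have "y l - (\<Sum>i\<in>insert k j. ?b i * X l i) = e l" for l
  proof -
    have "(\<Sum>i\<in>j. ?b i * X l i) = (\<Sum>i\<in>j. b i * X l i - \<alpha> * (c i * X l i))"
      using insert.hyps by (intro sum.cong) (auto simp: algebra_simps)
    then show ?thesis using insert.hyps
      by (simp add: e_def r_def s_def sum_subtractf sum_distrib_left[symmetric] algebra_simps)
  qed
  then show ?case using e0 ek by (intro exI[of _ ?b]) simp
qed

lemma sq_resid_eq_dot:
  "sq_resid n xs ys j b = dot {1..n} (\<lambda>l. ys l - (\<Sum>i\<in>j. b i * xs l i)) (\<lambda>l. ys l - (\<Sum>i\<in>j. b i * xs l i))"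
  by (simp add: sq_resid_def dot_def power2_eq_square)

lemma RSS_le_sq_resid:
  assumes "finite j"
  shows "RSS n xs ys j \<le> sq_resid n xs ys j b"
proof -
  obtain b0 where b0: "\<forall>k\<in>j. dot {1..n} (\<lambda>l. ys l - (\<Sum>i\<in>j. b0 i * xs l i)) (\<lambda>l. xs l k) = 0"
    using normal_equations[OF assms, of "{1..n}" ys xs] by auto
  define e where "e l = ys l - (\<Sum>i\<in>j. b0 i * xs l i)" for l
  have e: "dot {1..n} e (\<lambda>l. xs l k) = 0" if "k \<in> j" for k using b0 that by (simp add: e_def[abs_def])
  have "sq_resid n xs ys j b0 \<le> sq_resid n xs ys j b'" for b'
  proof -
    define d where "d l = (\<Sum>i\<in>j. (b0 i - b' i) * xs l i)" for l
    have "ys l - (\<Sum>i\<in>j. b' i * xs l i) = e l + d l" for l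
      by (simp add: e_def d_def algebra_simps sum_subtractf)
    then have "sq_resid n xs ys j b' = dot {1..n} e e + 2 * dot {1..n} e d + dot {1..n} d d"
      by (simp add: sq_resid_eq_dot dot_linear dot_commute[of _ d e])
    also have "dot {1..n} e d = 0"
      using e by (simp add: d_def[abs_def] dot_linear)
    finally show ?thesis using dot_self_nonneg[of "{1..n}" d] by (simp add: sq_resid_eq_dot e_def[abs_def])
  qed
  then have "is_arg_min (sq_resid n xs ys j) (\<lambda>_. True) b0"
    by (simp add: is_arg_min_def not_less)
  then have "is_arg_min (sq_resid n xs ys j) (\<lambda>_. True) (ls_coef n xs ys j)"
    unfolding ls_coef_def arg_min_def by (rule someI[of "is_arg_min (sq_resid n xs ys j) (\<lambda>_. True)"])
  then show ?thesis by (simp add: is_arg_min_def not_less RSS_def)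
qed

lemma RSS_mono:
  assumes "finite k" "j \<subseteq> k"
  shows "RSS n xs ys k \<le> RSS n xs ys j"
proof -
  let ?b = "\<lambda>i. if i \<in> j then ls_coef n xs ys j i else 0"
  have "(\<Sum>i\<in>k. ?b i * xs l i) = (\<Sum>i\<in>j. ls_coef n xs ys j i * xs l i)" for l
    using assms by (intro sum.mono_neutral_cong_right) auto
  then have "sq_resid n xs ys k ?b = RSS n xs ys j" by (simp add: RSS_def sq_resid_def)
  then show ?thesis using RSS_le_sq_resid[OF assms(1), of n xs ys ?b] by simp
qed

lemma young_inequality:
  fixes p u v :: real
  assumes "p\<^sup>2 \<le> u * v" "u \<ge> 0" "v \<ge> 0"
  shows "- (u + v) \<le> 2 * p"
proof -
  have "(2 * p)\<^sup>2 \<le> 4 * (u * v)" using assms(1) by (simp add: power2_eq_square)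
  also have "\<dots> \<le> (u + v)\<^sup>2" using zero_le_power2[of "u - v"] by (simp add: power2_eq_square algebra_simps)
  finally have "\<bar>2 * p\<bar> \<le> \<bar>u + v\<bar>" by (simp only: abs_le_square_iff)
  then show ?thesis using assms by simp
qed

definition fitted :: "nat \<Rightarrow> (nat \<Rightarrow> nat \<Rightarrow> real) \<Rightarrow> (nat \<Rightarrow> real) \<Rightarrow> nat \<Rightarrow> real" where
  "fitted m xs b l = (\<Sum>i\<in>{1..m}. b i * xs l i)"

text \<open>One realisation of the experiment. The form \<open>q\<close> stands for \<open>b \<mapsto> E (b'x)\<^sup>2\<close>; the last two
  assumptions compare the empirical quadratic form and the noise with it.\<close>

locale regression_good_event =
  fixes n m :: nat and xs :: "nat \<Rightarrow> nat \<Rightarrow> real" and es \<beta> :: "nat \<Rightarrow> real"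
    and q :: "(nat \<Rightarrow> real) \<Rightarrow> real" and c W :: real
  assumes n_pos: "n > 0" and c_pos: "c > 0" and W_nonneg: "W \<ge> 0" and q_nonneg: "\<And>b. q b \<ge> 0"
    and true_sub: "true_model \<beta> \<subseteq> {1..m}"
    and gram_lower: "\<And>b. c * n * q b \<le> dot {1..n} (fitted m xs b) (fitted m xs b)"
    and noise_upper: "\<And>b. (dot {1..n} (fitted m xs b) es)\<^sup>2 \<le> W * q b"
begin

abbreviation "ys \<equiv> response m \<beta> xs es"
abbreviation "noise \<equiv> dot {1..n} es es"
abbreviation "loss \<equiv> W / (c * n)"

lemma sq_resid_expand:
  assumes "j \<subseteq> {1..m}"
  defines "d b i \<equiv> \<beta> i - (if i \<in> j then b i else 0)"
  shows "sq_resid n xs ys j b = noise + 2 * dot {1..n} (fitted m xs (d b)) es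
    + dot {1..n} (fitted m xs (d b)) (fitted m xs (d b))"
proof -
  have "(\<Sum>i\<in>j. b i * xs l i) = (\<Sum>i\<in>{1..m}. (if i \<in> j then b i else 0) * xs l i)" for l
    using assms(1) by (intro sum.mono_neutral_cong_left) auto
  then have "ys l - (\<Sum>i\<in>j. b i * xs l i) = es l + fitted m xs (d b) l" for l
    by (simp add: response_def fitted_def d_def algebra_simps sum_subtractf)
  then show ?thesis
    by (simp add: sq_resid_eq_dot dot_linear dot_commute[of _ es "fitted m xs (d b)"])
qed

lemma cross_term_bound: "(dot {1..n} (fitted m xs b) es)\<^sup>2 \<le> (c * n * q b) * loss"
  using noise_upper[of b] c_pos n_pos by (simp add: mult.commute)

lemma loss_nonneg: "loss \<ge> 0" using W_nonneg c_pos by simp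

text \<open>No choice of coefficients can fit away more of the noise than \<open>loss\<close>: the cross term is absorbed
  by the quadratic term through Young's inequality.\<close>

lemma RSS_lower:
  assumes "j \<subseteq> {1..m}"
  shows "noise - loss \<le> RSS n xs ys j"
proof -
  let ?d = "\<lambda>i. \<beta> i - (if i \<in> j then ls_coef n xs ys j i else 0)"
  have "- (c * n * q ?d + loss) \<le> 2 * dot {1..n} (fitted m xs ?d) es"
    using c_pos q_nonneg loss_nonneg by (intro young_inequality cross_term_bound) auto
  then show ?thesis
    unfolding RSS_def sq_resid_expand[OF assms] using gram_lower[of ?d] by linarith
qed

lemma RSS_upper:
  assumes "true_model \<beta> \<subseteq> j" "j \<subseteq> {1..m}"
  shows "RSS n xs ys j \<le> noise"
proof -
  have "finite j" using assms(2) finite_subset by blast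
  then have "RSS n xs ys j \<le> sq_resid n xs ys j \<beta>" by (rule RSS_le_sq_resid)
  also have "\<dots> = noise"
  proof -
    have "\<beta> i - (if i \<in> j then \<beta> i else 0) = 0" if "i \<in> {1..m}" for i
      using assms that by (auto simp: true_model_def)
    then have "fitted m xs (\<lambda>i. \<beta> i - (if i \<in> j then \<beta> i else 0)) = (\<lambda>l. 0)"
      by (simp add: fitted_def fun_eq_iff)
    then show ?thesis unfolding sq_resid_expand[OF assms(2)] by (simp add: dot_def)
  qed
  finally show ?thesis .
qed

text \<open>A model without \<open>i0\<close> leaves an error whose coefficient at \<open>i0\<close> is \<open>\<beta> i0\<close>. Half of its quadratic term
  absorbs the cross term, the other half remains.\<close>

lemma RSS_missing_lower:
  assumes "j \<subseteq> {1..m}" "i0 \<in> true_model \<beta>" "i0 \<notin> j"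
    and q_lower: "\<And>b. b i0 = \<beta> i0 \<Longrightarrow> q b \<ge> q0"
  shows "noise + c * n * q0 / 2 - 2 * loss \<le> RSS n xs ys j"
proof -
  let ?d = "\<lambda>i. \<beta> i - (if i \<in> j then ls_coef n xs ys j i else 0)"
  have "(dot {1..n} (fitted m xs ?d) es)\<^sup>2 \<le> (c * n * q ?d / 2) * (2 * loss)"
    using cross_term_bound[of ?d] by simp
  then have "- (c * n * q ?d / 2 + 2 * loss) \<le> 2 * dot {1..n} (fitted m xs ?d) es"
    using c_pos q_nonneg loss_nonneg by (intro young_inequality) auto
  moreover have "c * n * q0 / 2 \<le> c * n * q ?d / 2"
    using q_lower[of ?d] assms(3) c_pos by (intro divide_right_mono mult_left_mono) auto
  ultimately show ?thesis
    unfolding RSS_def sq_resid_expand[OF assms(1)] using gram_lower[of ?d] by linarith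
qed

lemma R_stat_true_upper:
  assumes "loss < noise"
  shows "R_stat n xs ys (true_model \<beta>) {1..m} \<le> loss / (noise - loss)"
proof -
  have 1: "noise - loss \<le> RSS n xs ys {1..m}" by (rule RSS_lower) simp
  have 2: "RSS n xs ys {1..m} \<le> RSS n xs ys (true_model \<beta>)" by (rule RSS_mono[OF _ true_sub]) simp
  have 3: "RSS n xs ys (true_model \<beta>) \<le> noise" by (rule RSS_upper[OF _ true_sub]) simp
  show ?thesis unfolding R_stat_def using 1 2 3 assms loss_nonneg by (intro frac_le) auto
qed

lemma R_stat_missing_lower:
  fixes V :: real
  assumes "j \<subseteq> {1..m}" "i0 \<in> true_model \<beta>" "i0 \<notin> j" "\<And>b. b i0 = \<beta> i0 \<Longrightarrow> q b \<ge> q0"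
    and "loss < noise" "8 * loss \<le> c * n * q0" "noise \<le> V * n" "q0 > 0"
  shows "c * q0 / (4 * V + c * q0) \<le> R_stat n xs ys j {1..m}"
proof -
  define D where "D = c * n * q0 / 4"
  have D: "D > 0" using assms c_pos n_pos by (simp add: D_def)
  have V: "V > 0" using assms(5,7) loss_nonneg n_pos by (smt (verit) zero_less_mult_pos2 of_nat_0_less_iff)
  have 1: "noise + D \<le> RSS n xs ys j" using RSS_missing_lower[OF assms(1-4)] assms(6) by (simp add: D_def)
  have 2: "RSS n xs ys {1..m} \<le> noise" by (rule RSS_upper[OF true_sub]) simp
  have pos: "noise > 0" using assms(5) loss_nonneg by linarith
  have "RSS n xs ys {1..m} / RSS n xs ys j \<le> noise / (noise + D)"
    using 1 2 D pos by (intro frac_le) auto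
  also have "\<dots> \<le> V * n / (V * n + D)"
    using assms(7) D pos V n_pos by (simp add: field_simps)
  also have "\<dots> = 4 * V / (4 * V + c * q0)"
  proof -
    have "V * n + D = (4 * V + c * q0) * (n / 4)" by (simp add: D_def field_simps)
    moreover have "V * n = (4 * V) * (n / 4)" by simp
    ultimately show ?thesis using n_pos by (metis mult_divide_mult_cancel_right divide_eq_0_iff of_nat_0_eq_iff less_irrefl zero_neq_numeral)
  qed
  finally have "RSS n xs ys {1..m} / RSS n xs ys j \<le> 4 * V / (4 * V + c * q0)" .
  moreover have "R_stat n xs ys j {1..m} = 1 - RSS n xs ys {1..m} / RSS n xs ys j"
    unfolding R_stat_def using 1 D pos by (simp add: diff_divide_distrib)
  moreover have "4 * V / (4 * V + c * q0) + c * q0 / (4 * V + c * q0) = 1"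
    using V assms(8) c_pos by (subst add_divide_distrib[symmetric]) (auto simp: add_pos_pos less_imp_neq[symmetric])
  ultimately show ?thesis by linarith
qed

end

section \<open>Tails of the Beta distribution\<close>

lemma has_integral_powr_interval:
  fixes a c d :: real
  assumes "a > 0" "0 \<le> c" "c \<le> d"
  shows "((\<lambda>u. u powr (a - 1)) has_integral (d powr a - c powr a) / a) {c..d}"
proof -
  have "((\<lambda>u. u powr (a - 1)) has_integral (d powr a / a - c powr a / a)) {c..d}"
  proof (rule fundamental_theorem_of_calculus_interior[OF assms(3)])
    show "continuous_on {c..d} (\<lambda>u. u powr a / a)"
      using assms by (intro continuous_intros continuous_on_powr') auto
    show "((\<lambda>u. u powr a / a) has_vector_derivative x powr (a - 1)) (at x)" if "x \<in> {c<..<d}" for x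
      using that assms unfolding has_real_derivative_iff_has_vector_derivative[symmetric]
      by (auto intro!: derivative_eq_intros)
  qed
  then show ?thesis by (simp add: diff_divide_distrib)
qed

lemma nn_integral_powr_interval:
  fixes a c d K :: real
  assumes "a > 0" "0 \<le> c" "c \<le> d" "0 \<le> K"
  shows "(\<integral>\<^sup>+u. ennreal (K * u powr (a - 1)) * indicator {c..d} u \<partial>lborel) = ennreal (K * ((d powr a - c powr a) / a))"
  using assms by (intro nn_integral_has_integral_lebesgue' has_integral_mult_right has_integral_powr_interval) auto

lemma Beta_real_pos: "a > 0 \<Longrightarrow> b > 0 \<Longrightarrow> Beta a (b::real) > 0"
  by (simp add: Beta_def)

lemma emeasure_beta_distribution:
  assumes "A \<in> sets borel"
  shows "emeasure (beta_distribution a b) A = (\<integral>\<^sup>+u. ennreal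
     (if 0 < u \<and> u < 1 then u powr (a - 1) * (1 - u) powr (b - 1) / Beta a b else 0) * indicator A u \<partial>lborel)"
  unfolding beta_distribution_def using assms by (subst emeasure_density) auto

lemma sets_beta_distribution [simp]: "sets (beta_distribution a b) = sets borel"
  and space_beta_distribution [simp]: "space (beta_distribution a b) = UNIV"
  by (simp_all add: beta_distribution_def)

lemma prob_space_beta_distribution:
  assumes "a > 0" "b > 0"
  shows "prob_space (beta_distribution a b)"
proof
  have "((\<lambda>t. 1 / Beta a b * (t powr (a - 1) * (1 - t) powr (b - 1))) has_integral 1 / Beta a b * Beta a b) {0..1}"
    by (intro has_integral_mult_right has_integral_Beta_real assms)
  then have "(\<integral>\<^sup>+u. ennreal (1 / Beta a b * (u powr (a - 1) * (1 - u) powr (b - 1))) * indicator {0..1} u \<partial>lborel) = ennreal (1 / Beta a b * Beta a b)"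
    using Beta_real_pos[OF assms] by (intro nn_integral_has_integral_lebesgue') auto
  also have "(\<integral>\<^sup>+u. ennreal (1 / Beta a b * (u powr (a - 1) * (1 - u) powr (b - 1))) * indicator {0..1} u \<partial>lborel)
     = emeasure (beta_distribution a b) UNIV"
    by (subst emeasure_beta_distribution) (auto intro!: nn_integral_cong split: split_indicator simp: mult_ac)
  finally show "emeasure (beta_distribution a b) (space (beta_distribution a b)) = 1"
    using Beta_real_pos[OF assms] by simp
qed

lemma beta_interval_lower:
  assumes "a > 0" "b \<ge> 1" "0 \<le> c" "c \<le> d" "d < 1"
  shows "(1 - d) powr (b - 1) * ((d powr a - c powr a) / a) / Beta a b \<le> measure (beta_distribution a b) {c<..d}"
proof -
  interpret prob_space "beta_distribution a b" using assms by (intro prob_space_beta_distribution) auto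
  have B: "Beta a b > 0" using assms by (intro Beta_real_pos) auto
  let ?K = "(1 - d) powr (b - 1) / Beta a b"
  have "ennreal (?K * ((d powr a - c powr a) / a))
      = (\<integral>\<^sup>+u. ennreal (?K * u powr (a - 1)) * indicator {c..d} u \<partial>lborel)"
    using assms B by (intro nn_integral_powr_interval[symmetric]) auto
  also have "\<dots> \<le> emeasure (beta_distribution a b) {c<..d}"
    unfolding emeasure_beta_distribution[OF greaterThanAtMost_borel]
  proof (rule nn_integral_mono_AE)
    have le: "?K * u powr (a - 1) \<le> u powr (a - 1) * (1 - u) powr (b - 1) / Beta a b"
      if "c < u" "u \<le> d" for u
    proof -
      have "(1 - d) powr (b - 1) \<le> (1 - u) powr (b - 1)" using that assms by (intro powr_mono2) auto
      then have "u powr (a - 1) * (1 - d) powr (b - 1) \<le> u powr (a - 1) * (1 - u) powr (b - 1)"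
        by (intro mult_left_mono) auto
      then show ?thesis using B by (simp add: divide_right_mono mult.commute)
    qed
    show "AE u in lborel. ennreal (?K * u powr (a - 1)) * indicator {c..d} u \<le> ennreal
     (if 0 < u \<and> u < 1 then u powr (a - 1) * (1 - u) powr (b - 1) / Beta a b else 0) * indicator {c<..d} u"
      using AE_lborel_singleton[of c]
    proof eventually_elim
      case (elim u)
      with assms le[of u] show ?case
        by (auto split: split_indicator intro!: ennreal_leI)
    qed
  qed
  finally show ?thesis unfolding emeasure_eq_measure
    by (subst (asm) ennreal_le_iff) (simp_all add: mult_ac)
qed

lemma beta_head_upper:
  assumes "a > 0" "b \<ge> 1" "0 \<le> r"
  shows "measure (beta_distribution a b) {..r} \<le> r powr a / a / Beta a b"
proof -
  interpret prob_space "beta_distribution a b" using assms by (intro prob_space_beta_distribution) auto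
  have B: "Beta a b > 0" using assms by (intro Beta_real_pos) auto
  let ?K = "1 / Beta a b"
  have "emeasure (beta_distribution a b) {..r} \<le> (\<integral>\<^sup>+u. ennreal (?K * u powr (a - 1)) * indicator {0..r} u \<partial>lborel)"
    unfolding emeasure_beta_distribution[OF atMost_borel]
  proof (rule nn_integral_mono)
    have "u powr (a - 1) * (1 - u) powr (b - 1) / Beta a b \<le> ?K * u powr (a - 1)"
      if "0 < u" "u < 1" for u
    proof -
      have "(1 - u) powr (b - 1) \<le> 1" using that assms by (intro powr_le1) auto
      then have "u powr (a - 1) * (1 - u) powr (b - 1) \<le> u powr (a - 1) * 1"
        by (intro mult_left_mono) auto
      then show ?thesis using B by (simp add: divide_right_mono)
    qed
    then show "ennreal
     (if 0 < u \<and> u < 1 then u powr (a - 1) * (1 - u) powr (b - 1) / Beta a b else 0) * indicator {..r} u \<le> ennreal (?K * u powr (a - 1)) * indicator {0..r} u" for u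
      by (auto split: split_indicator intro!: ennreal_leI)
  qed
  also have "\<dots> = ennreal (?K * ((r powr a - 0 powr a) / a))"
    using assms B by (intro nn_integral_powr_interval) auto
  finally show ?thesis using assms B unfolding emeasure_eq_measure
    by (subst (asm) ennreal_le_iff) (simp_all add: mult_ac)
qed

lemma beta_tail_upper:
  assumes "a > 0" "b \<ge> 1" "0 < r" "r < 1"
  shows "measure (beta_distribution a b) {r<..} \<le> (1 - r) powr (b - 1) / r / Beta a b"
proof -
  interpret prob_space "beta_distribution a b" using assms by (intro prob_space_beta_distribution) auto
  have B: "Beta a b > 0" using assms by (intro Beta_real_pos) auto
  let ?K = "(1 - r) powr (b - 1) / r / Beta a b"
  have K: "?K \<ge> 0" using B assms by simp
  have "emeasure (beta_distribution a b) {r<..} \<le> (\<integral>\<^sup>+u. ennreal ?K * indicator {0..1::real} u \<partial>lborel)"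
    unfolding emeasure_beta_distribution[OF greaterThan_borel]
  proof (rule nn_integral_mono)
    have "u powr (a - 1) * (1 - u) powr (b - 1) / Beta a b \<le> ?K"
      if "r < u" "u < 1" for u
    proof -
      have "(1 - u) powr (b - 1) \<le> (1 - r) powr (b - 1)" using that assms by (intro powr_mono2) auto
      moreover have "u powr (a - 1) \<le> 1 / r"
      proof -
        have "u powr (a - 1) = u powr a / u" using that assms by (simp add: powr_diff)
        also have "\<dots> \<le> 1 / u" using that assms by (intro divide_right_mono powr_le1) auto
        also have "\<dots> \<le> 1 / r" using that assms by (intro divide_left_mono) auto
        finally show ?thesis .
      qed
      ultimately have "u powr (a - 1) * (1 - u) powr (b - 1) \<le> (1 / r) * (1 - r) powr (b - 1)"
        using assms by (intro mult_mono) auto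
      also have "\<dots> = (1 - r) powr (b - 1) / r" by simp
      finally show ?thesis using B by (intro divide_right_mono) auto
    qed
    then show "ennreal
     (if 0 < u \<and> u < 1 then u powr (a - 1) * (1 - u) powr (b - 1) / Beta a b else 0) * indicator {r<..} u \<le> ennreal ?K * indicator {0..1::real} u" for u
      using assms by (auto split: split_indicator intro!: ennreal_leI)
  qed
  also have "\<dots> = ennreal ?K" by (subst nn_integral_cmult_indicator) auto
  finally show ?thesis using K unfolding emeasure_eq_measure
    by (subst (asm) ennreal_le_iff) (simp_all add: mult_ac)
qed

lemma p_value_eq_tail:
  assumes "pj < pk" "pk < n"
  shows "p_value n r pk pj = measure (beta_distribution ((real pk - real pj) / 2) ((real n - real pk) / 2)) {r<..}"
proof -
  interpret prob_space "beta_distribution ((real pk - real pj) / 2) ((real n - real pk) / 2)"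
    using assms by (intro prob_space_beta_distribution) auto
  have "{r<..} = space (beta_distribution ((real pk - real pj) / 2) ((real n - real pk) / 2)) - {..r}" by auto
  then show ?thesis unfolding p_value_def cdf_def by (simp only: prob_compl sets_beta_distribution atMost_borel)
qed

lemma p_value_le_1:
  assumes "pj < pk" "pk < n"
  shows "p_value n r pk pj \<le> 1"
  unfolding p_value_def cdf_def by (simp add: measure_nonneg)

lemma p_value_antimono:
  assumes "pj < pk" "pk < n" "r \<le> s"
  shows "p_value n s pk pj \<le> p_value n r pk pj"
proof -
  interpret prob_space "beta_distribution ((real pk - real pj) / 2) ((real n - real pk) / 2)"
    using assms by (intro prob_space_beta_distribution) auto
  show ?thesis unfolding p_value_eq_tail[OF assms(1,2)]
    using assms(3) by (intro finite_measure_mono) auto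
qed

text \<open>Let \<open>I\<close> be the integral of \<open>u powr (a - 1)\<close> over \<open>[0, r]\<close>, divided by the Beta function. The mass of
  \<open>[0, r]\<close> is at most \<open>I\<close>, and that of \<open>[r, 2 r]\<close> is at least a multiple of \<open>I\<close> which stays away from 0
  for \<open>a \<ge> 1 / 2\<close> apart from the factor \<open>(1 - 2 r) powr (b - 1)\<close>. As the two tails add up to 1, \<open>I\<close>
  cannot be small unless the p-value is large.\<close>

lemma p_value_lower:
  assumes "pj < pk" "pk + 2 \<le> n" "0 < r" "2 * r < 1"
  shows "(1 - 2 * r) powr ((real n - real pk) / 2 - 1) / 4 \<le> p_value n r pk pj"
proof -
  define a b where "a = (real pk - real pj) / 2" and "b = (real n - real pk) / 2"
  have a: "a \<ge> 1/2" and b: "b \<ge> 1" using assms by (auto simp: a_def b_def field_simps)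
  interpret prob_space "beta_distribution a b" using a b by (intro prob_space_beta_distribution) auto
  have B: "Beta a b > 0" using a b by (intro Beta_real_pos) auto
  let ?p = "measure (beta_distribution a b) {r<..}"
  define y where "y = (1 - 2 * r) powr (b - 1)"
  define I where "I = r powr a / a / Beta a b"
  have y: "0 \<le> y" "y \<le> 1" using assms b by (auto simp: y_def intro!: powr_le1)
  have I: "I > 0" using a B assms by (auto simp: I_def)
  have "1 = measure (beta_distribution a b) ({..r} \<union> {r<..})"
  proof -
    have "{..r} \<union> {r<..} = (UNIV :: real set)" by auto
    then show ?thesis using prob_space by simp
  qed
  also have "\<dots> = measure (beta_distribution a b) {..r} + ?p"
    by (rule finite_measure_Union) auto
  finally have 1: "1 \<le> I + ?p" using beta_head_upper[of a b r] a b assms by (simp add: I_def)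
  (* Any constant above 1 would do; 7/5 yields the factor 1/4 in the statement. *)
  have two: "2 powr a \<ge> 7/5"
  proof -
    have "(7/5 :: real) \<le> sqrt 2" by (rule real_le_rsqrt) (simp add: power2_eq_square)
    also have "\<dots> = 2 powr (1/2)" by (simp add: powr_half_sqrt)
    also have "\<dots> \<le> 2 powr a" using a by (intro powr_mono) auto
    finally show ?thesis .
  qed
  have "y * (2 / 5) * I \<le> y * ((2 powr a - 1) * I)"
    using two y I by (subst mult.assoc, intro mult_left_mono mult_right_mono) auto
  also have "\<dots> = (1 - 2 * r) powr (b - 1) * (((2 * r) powr a - r powr a) / a) / Beta a b"
    using assms by (simp add: y_def I_def powr_mult field_simps)
  also have "\<dots> \<le> measure (beta_distribution a b) {r<..2 * r}"
    using a b assms by (intro beta_interval_lower) auto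
  also have "\<dots> \<le> ?p" by (intro finite_measure_mono) auto
  finally have 2: "y * (2 / 5) * I \<le> ?p" .
  have "y / 4 \<le> ?p"
  proof (cases "?p \<ge> 2 / 7")
    case True
    then show ?thesis using y by simp
  next
    case False
    then have "5 / 7 \<le> I" using 1 by simp
    then have "y * (2 / 5) * (5 / 7) \<le> y * (2 / 5) * I" using y by (intro mult_left_mono) auto
    from order.trans[OF this 2] y show ?thesis by simp
  qed
  then show ?thesis using assms by (simp add: p_value_eq_tail y_def a_def b_def)
qed

text \<open>The total mass 1 is at least the mass of \<open>[0, r / 2]\<close>, which bounds the Beta function from below;
  beyond \<open>r\<close> the density carries the smaller factor \<open>(1 - r) powr (b - 1)\<close>.\<close>

lemma p_value_upper:
  assumes "pj < pk" "pk + 2 \<le> n" "0 < r" "r < 1"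
  defines "a \<equiv> (real pk - real pj) / 2"
  shows "p_value n r pk pj \<le>
    a / r * (2 / r) powr a * ((1 - r) / (1 - r / 2)) powr ((real n - real pk) / 2 - 1)"
proof -
  define b where "b = (real n - real pk) / 2"
  have a: "a \<ge> 1/2" and b: "b \<ge> 1" using assms by (auto simp: a_def b_def field_simps)
  interpret prob_space "beta_distribution a b" using a b by (intro prob_space_beta_distribution) auto
  have B: "Beta a b > 0" using a b by (intro Beta_real_pos) auto
  have "(1 - r / 2) powr (b - 1) * (((r / 2) powr a - 0 powr a) / a) / Beta a b
     \<le> measure (beta_distribution a b) {0<..r / 2}"
    using a b assms by (intro beta_interval_lower) auto
  also have "\<dots> \<le> 1" by simp
  finally have "(1 - r / 2) powr (b - 1) * ((r / 2) powr a / a) \<le> Beta a b"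
    using B a by (simp add: field_simps)
  moreover have pos: "(1 - r / 2) powr (b - 1) * ((r / 2) powr a / a) > 0" using assms a by auto
  ultimately have "(1 - r) powr (b - 1) / r / Beta a b
     \<le> (1 - r) powr (b - 1) / r / ((1 - r / 2) powr (b - 1) * ((r / 2) powr a / a))"
    using assms by (intro divide_left_mono mult_pos_pos B) auto
  also have "\<dots> = a / r * (2 / r) powr a * ((1 - r) / (1 - r / 2)) powr (b - 1)"
  proof -
    have "(2 / r) powr a = 1 / (r / 2) powr a"
      using assms(3) by (simp add: powr_divide)
    moreover have "((1 - r) / (1 - r / 2)) powr (b - 1) = (1 - r) powr (b - 1) / (1 - r / 2) powr (b - 1)"
      by (rule powr_divide)
    ultimately show ?thesis by (simp add: mult_ac)
  qed
  finally have "measure (beta_distribution a b) {r<..} \<le> a / r * (2 / r) powr a * ((1 - r) / (1 - r / 2)) powr (b - 1)"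
    using beta_tail_upper[of a b r] a b assms by simp
  then show ?thesis using assms by (simp add: p_value_eq_tail a_def b_def)
qed

section \<open>Comparison of scores\<close>

lemma mpvc_choice_unique:
  assumes choice: "is_mpvc_choice n m a xs ys j" and t: "t \<subseteq> {1..m}"
    and best: "\<And>k. k \<subseteq> {1..m} \<Longrightarrow> k \<noteq> t \<Longrightarrow> mpvc_score n m a xs ys k < mpvc_score n m a xs ys t"
  shows "j = t"
proof (rule ccontr)
  assume "j \<noteq> t"
  have "is_arg_max (mpvc_score n m a xs ys) (\<lambda>k. k \<subseteq> {1..m}) j"
    using choice by (simp add: is_mpvc_choice_def is_arg_min_def)
  then have "j \<subseteq> {1..m}" "\<not> mpvc_score n m a xs ys j < mpvc_score n m a xs ys t"
    using t by (auto simp: is_arg_max_def)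
  then show False using best[of j] \<open>j \<noteq> t\<close> by blast
qed

text \<open>The value \<open>exp (- (|t| + 1) a)\<close> separates the score of \<open>t\<close> from all others. Supersets fall below it
  by the penalty alone, models missing an element of \<open>t\<close> by their p-value alone.\<close>

lemma mpvc_score_less:
  assumes m: "m < n" and a: "a > 0" and t: "t \<subseteq> {1..m}" and k: "k \<subseteq> {1..m}" "k \<noteq> t"
    and true_p: "t \<noteq> {1..m} \<Longrightarrow> exp (- a) < p_value n (R_stat n xs ys t {1..m}) m (card t)"
    and missing_p: "\<not> t \<subseteq> k \<Longrightarrow> p_value n (R_stat n xs ys k {1..m}) m (card k) \<le> exp (- (real (card t) + 1) * a)"
  shows "mpvc_score n m a xs ys k < mpvc_score n m a xs ys t"
proof -
  have fin: "finite t" "finite k" using t k finite_subset by blast+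
  have card_less: "card j < m" if "j \<subseteq> {1..m}" "j \<noteq> {1..m}" for j
    using psubset_card_mono[of "{1..m}" j] that by auto
  have "exp (- (real (card t) + 1) * a) = exp (- real (card t) * a) * exp (- a)"
    by (simp add: exp_add[symmetric] algebra_simps)
  also have "\<dots> < mpvc_score n m a xs ys t"
    using true_p a unfolding mpvc_score_def by (intro mult_strict_left_mono) auto
  finally have low: "exp (- (real (card t) + 1) * a) < mpvc_score n m a xs ys t" .
  have "mpvc_score n m a xs ys k \<le> exp (- (real (card t) + 1) * a)"
  proof (cases "t \<subseteq> k")
    case True
    then have "card t < card k" using k(2) fin by (intro psubset_card_mono) auto
    then have "real (card t) + 1 \<le> real (card k)" by simp
    then have "(real (card t) + 1) * a \<le> real (card k) * a" using a by (intro mult_right_mono) auto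
    then have "exp (- real (card k) * a) \<le> exp (- (real (card t) + 1) * a)"
      by (simp only: exp_le_cancel_iff mult_minus_left neg_le_iff_le)
    moreover have "mpvc_score n m a xs ys k \<le> exp (- real (card k) * a)"
      unfolding mpvc_score_def using p_value_le_1[OF card_less[OF k(1)] m]
      by (auto intro!: mult_left_le)
    ultimately show ?thesis by linarith
  next
    case False
    then have "k \<noteq> {1..m}" using t by blast
    then have "mpvc_score n m a xs ys k = exp (- real (card k) * a) * p_value n (R_stat n xs ys k {1..m}) m (card k)"
      by (simp add: mpvc_score_def)
    also have "\<dots> \<le> 1 * p_value n (R_stat n xs ys k {1..m}) m (card k)"
      using a p_value_eq_tail[OF card_less[OF k(1) \<open>k \<noteq> {1..m}\<close>] m]
      by (intro mult_right_mono) auto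
    also have "\<dots> \<le> exp (- (real (card t) + 1) * a)" using missing_p[OF False] by simp
    finally show ?thesis .
  qed
  then show ?thesis using low by linarith
qed

lemma exp_lower_bound_one_minus:
  fixes r :: real
  assumes "0 \<le> r" "r \<le> 1 / 4"
  shows "exp (- 4 * r) \<le> 1 - 2 * r"
proof -
  have "exp (- (4 * r)) \<le> 1 - 4 * r + (4 * r)\<^sup>2 / 2"
  proof -
    have "1 + 4 * r + (4 * r)\<^sup>2 / 2 \<le> exp (4 * r)"
      using exp_lower_Taylor_quadratic[of "4 * r"] assms by simp
    moreover have "1 + 4 * r + (4 * r)\<^sup>2 / 2 > 0" using assms by (intro add_pos_nonneg) auto
    ultimately have "exp (- (4 * r)) \<le> 1 / (1 + 4 * r + (4 * r)\<^sup>2 / 2)"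
      by (simp add: exp_minus inverse_eq_divide divide_left_mono)
    also have "\<dots> \<le> 1 - 4 * r + (4 * r)\<^sup>2 / 2"
    proof -
      have "1 \<le> (1 - 4 * r + (4 * r)\<^sup>2 / 2) * (1 + 4 * r + (4 * r)\<^sup>2 / 2)"
        using assms(1) by (simp add: power2_eq_square algebra_simps)
      then show ?thesis using \<open>1 + 4 * r + (4 * r)\<^sup>2 / 2 > 0\<close> by (simp add: pos_divide_le_eq)
    qed
    finally show ?thesis .
  qed
  also have "\<dots> \<le> 1 - 2 * r"
  proof -
    have "r * (4 * r) \<le> r * 1" using assms by (intro mult_left_mono) auto
    then show ?thesis by (simp add: power2_eq_square)
  qed
  finally show ?thesis by simp
qed

lemma p_value_lower_exp:
  assumes "pj < pk" "pk + 2 \<le> n" "0 < r" "r \<le> 1 / 4" "R \<le> r"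
  shows "exp (- 2 * r * n) / 4 \<le> p_value n R pk pj"
proof -
  have "exp (- 2 * r * n) \<le> exp (- 4 * r * ((real n - real pk) / 2 - 1))"
  proof -
    have "(real n - real pk) / 2 - 1 \<le> n / 2" by (simp add: diff_divide_distrib)
    then have "4 * r * ((real n - real pk) / 2 - 1) \<le> 4 * r * (n / 2)"
      using assms(3) by (intro mult_left_mono) auto
    then show ?thesis by simp
  qed
  also have "\<dots> = exp (- 4 * r) powr ((real n - real pk) / 2 - 1)"
    by (simp add: powr_def)
  also have "\<dots> \<le> (1 - 2 * r) powr ((real n - real pk) / 2 - 1)"
    using assms exp_lower_bound_one_minus[of r] by (intro powr_mono2) (auto simp: field_simps)
  finally have "exp (- 2 * r * n) / 4 \<le> (1 - 2 * r) powr ((real n - real pk) / 2 - 1) / 4" by simp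
  also have "\<dots> \<le> p_value n r pk pj" using assms by (intro p_value_lower) auto
  also have "\<dots> \<le> p_value n R pk pj" using assms by (intro p_value_antimono) auto
  finally show ?thesis .
qed

lemma p_value_upper_exp:
  assumes "pj < pk" "pk + 2 \<le> n" "0 < r" "r < 1" "r \<le> R"
  shows "p_value n R pk pj \<le>
    exp (pk / (2 * r) + pk / 2 * ln (2 / r) - ln ((1 - r / 2) / (1 - r)) * ((real n - real pk) / 2 - 1))"
proof -
  define a where "a = (real pk - real pj) / 2"
  have a: "0 < a" "a \<le> pk / 2" using assms by (auto simp: a_def)
  define e where "e = (real n - real pk) / 2 - 1"
  have "p_value n R pk pj \<le> p_value n r pk pj" using assms by (intro p_value_antimono) auto
  also have "\<dots> \<le> a / r * (2 / r) powr a * ((1 - r) / (1 - r / 2)) powr e"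
    unfolding a_def e_def using assms by (intro p_value_upper) auto
  also have "\<dots> \<le> exp (pk / (2 * r)) * exp (pk / 2 * ln (2 / r)) * exp (- ln ((1 - r / 2) / (1 - r)) * e)"
  proof (intro mult_mono)
    have "a / r \<le> exp (a / r)" using exp_ge_add_one_self[of "a / r"] by linarith
    also have "\<dots> \<le> exp (pk / (2 * r))"
      using a assms divide_right_mono[of a "pk / 2" r] by simp
    finally show "a / r \<le> exp (pk / (2 * r))" .
    have "a * ln (2 / r) \<le> pk / 2 * ln (2 / r)" using a assms by (intro mult_right_mono) auto
    then show "(2 / r) powr a \<le> exp (pk / 2 * ln (2 / r))" using assms by (simp add: powr_def)
    have "ln ((1 - r) / (1 - r / 2)) = - ln ((1 - r / 2) / (1 - r))"
      using assms by (simp add: ln_div)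
    then show "((1 - r) / (1 - r / 2)) powr e \<le> exp (- ln ((1 - r / 2) / (1 - r)) * e)"
      using assms by (simp add: powr_def mult.commute)
  qed (use a assms in auto)
  also have "\<dots> = exp (pk / (2 * r) + pk / 2 * ln (2 / r) - ln ((1 - r / 2) / (1 - r)) * e)"
    by (simp add: exp_add[symmetric] exp_diff[symmetric])
  finally show ?thesis by (simp add: e_def)
qed

context regression_good_event
begin

text \<open>Here \<open>v\<close> and \<open>V\<close> bound the noise per observation and \<open>q0\<close> is the signal of the weakest true
  coefficient. The threshold \<open>r\<close> is the proportion of the residual sum of squares that every model
  missing a true coefficient leaves unexplained. The hypothesis \<open>small\<close> makes the p-value of the true
  model beat one unit of penalty, and \<open>large\<close> makes the p-value beyond \<open>r\<close> smaller than all penalties.\<close>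

lemma mpvc_choice_is_true_model:
  fixes V v q0 a r :: real
  defines "r \<equiv> c * q0 / (4 * V + c * q0)"
  assumes choice: "is_mpvc_choice n m a xs ys j"
    and m: "m + 2 \<le> n" and a: "a > 0"
    and q_lower: "\<And>i b. i \<in> true_model \<beta> \<Longrightarrow> b i = \<beta> i \<Longrightarrow> q b \<ge> q0" and q0: "q0 > 0"
    and noise: "v * n \<le> noise" "noise \<le> V * n" and v: "v > 0"
    and W: "W > 0" "2 * loss \<le> v * n" "8 * loss \<le> v * n" "8 * loss \<le> c * n * q0"
    and small: "4 * loss / v + ln 4 < a"
    and large: "m / (2 * r) + m / 2 * ln (2 / r) + (real (card (true_model \<beta>)) + 1) * a
       \<le> ln ((1 - r / 2) / (1 - r)) * ((real n - real m) / 2 - 1)"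
  shows "j = true_model \<beta>"
proof (rule mpvc_choice_unique[OF choice true_sub])
  fix k assume k: "k \<subseteq> {1..m}" "k \<noteq> true_model \<beta>"
  let ?t = "true_model \<beta>"
  have n0: "real n > 0" using n_pos by simp
  have loss: "loss > 0" using W(1) c_pos n0 by simp
  have vn: "v * n > 0" using v n0 by simp
  have V: "V > 0"
  proof -
    have "0 < V * n" using vn noise by linarith
    then show ?thesis using n0 by (simp add: zero_less_mult_iff)
  qed
  have lossn: "loss < noise" using W(2) noise(1) loss by linarith
  have r: "0 < r" "r < 1" using q0 V c_pos by (auto simp: r_def add_pos_pos)
  show "mpvc_score n m a xs ys k < mpvc_score n m a xs ys ?t"
  proof (rule mpvc_score_less[OF _ a true_sub k])
    show "m < n" using m by simp
    assume ne: "?t \<noteq> {1..m}"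
    then have ct: "card ?t < m" using psubset_card_mono[of "{1..m}" ?t] true_sub by auto
    define r0 where "r0 = 2 * loss / (v * n)"
    have r0: "0 < r0" unfolding r0_def by (intro divide_pos_pos vn) (use loss in linarith)
    have r04: "r0 \<le> 1 / 4" unfolding r0_def pos_divide_le_eq[OF vn] using W(3) by linarith
    have "R_stat n xs ys ?t {1..m} \<le> loss / (noise - loss)" by (rule R_stat_true_upper[OF lossn])
    also have "\<dots> \<le> loss / (v * n / 2)" using W(2) noise(1) loss vn by (intro divide_left_mono) auto
    also have "\<dots> = r0" by (simp add: r0_def)
    finally have R: "R_stat n xs ys ?t {1..m} \<le> r0" .
    have "2 * r0 * n = 4 * loss / v" using n0 by (simp add: r0_def)
    then have "exp (- a) < exp (- 2 * r0 * n - ln 4)" using small by simp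
    also have "\<dots> = exp (- 2 * r0 * n) / 4" by (simp add: exp_diff)
    also have "\<dots> \<le> p_value n (R_stat n xs ys ?t {1..m}) m (card ?t)"
      by (rule p_value_lower_exp[OF ct m r0 r04 R])
    finally show "exp (- a) < p_value n (R_stat n xs ys ?t {1..m}) m (card ?t)" .
  next
    assume nt: "\<not> ?t \<subseteq> k"
    then obtain i0 where i0: "i0 \<in> ?t" "i0 \<notin> k" by blast
    have "k \<noteq> {1..m}" using nt true_sub by blast
    then have ck: "card k < m" using psubset_card_mono[of "{1..m}" k] k(1) by auto
    have "r \<le> R_stat n xs ys k {1..m}" unfolding r_def
      by (rule R_stat_missing_lower[OF k(1) i0 q_lower[OF i0(1)] lossn W(4) noise(2) q0])
    from p_value_upper_exp[OF ck m r this]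
    have "p_value n (R_stat n xs ys k {1..m}) m (card k) \<le>
      exp (m / (2 * r) + m / 2 * ln (2 / r) - ln ((1 - r / 2) / (1 - r)) * ((real n - real m) / 2 - 1))" .
    also have "\<dots> \<le> exp (- (real (card ?t) + 1) * a)"
      unfolding exp_le_cancel_iff mult_minus_left using large by linarith
    finally show "p_value n (R_stat n xs ys k {1..m}) m (card k) \<le> exp (- (real (card ?t) + 1) * a)" .
  qed
qed

end

section \<open>Lower tails and quadratic forms on a grid\<close>

lemma exp_minus_le_quadratic:
  fixes x :: real
  assumes "x \<ge> 0"
  shows "exp (- x) \<le> 1 - x + x\<^sup>2 / 2"
proof -
  have "((\<lambda>x. 1 - x + x\<^sup>2 / 2 - exp (- x)) has_real_derivative - 1 + t + exp (- t)) (at t)" for t :: real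
    by (auto intro!: derivative_eq_intros)
  moreover have "- 1 + t + exp (- t) \<ge> 0" for t :: real using exp_ge_add_one_self[of "- t"] by simp
  ultimately have "1 - 0 + 0\<^sup>2 / 2 - exp (- 0) \<le> 1 - x + x\<^sup>2 / 2 - exp (- x)"
    by (intro DERIV_nonneg_imp_nondecreasing[OF assms]) blast
  then show ?thesis by simp
qed

text \<open>For nonnegative variables \<open>exp (- \<lambda> X)\<close> is bounded and at most \<open>1 - \<lambda> X + \<lambda>\<^sup>2 X\<^sup>2 / 2\<close>, so two moments
  suffice for an exponential bound on the lower tail. The choice \<open>\<lambda> = 1 / (2 h)\<close> balances the terms.\<close>

lemma (in prob_space) chernoff_lower_tail:
  fixes X :: "'i \<Rightarrow> 'a \<Rightarrow> real"
  assumes I: "finite I" and ind: "indep_vars (\<lambda>_. borel) X I"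
    and nn: "\<And>i \<omega>. i \<in> I \<Longrightarrow> X i \<omega> \<ge> 0"
    and int: "\<And>i. i \<in> I \<Longrightarrow> integrable M (X i)" "\<And>i. i \<in> I \<Longrightarrow> integrable M (\<lambda>\<omega>. (X i \<omega>)\<^sup>2)"
    and ex: "\<And>i. i \<in> I \<Longrightarrow> expectation (X i) = 1"
    and ex2: "\<And>i. i \<in> I \<Longrightarrow> expectation (\<lambda>\<omega>. (X i \<omega>)\<^sup>2) \<le> h" and h: "h > 0"
  shows "prob {\<omega> \<in> space M. (\<Sum>i\<in>I. X i \<omega>) \<le> card I / 2} \<le> exp (- real (card I) / (8 * h))"
proof -
  define lam where "lam = 1 / (2 * h)"
  have lam: "lam > 0" using h by (simp add: lam_def)
  have rv [measurable]: "X i \<in> borel_measurable M" if "i \<in> I" for i using int(1)[OF that] by simp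
  let ?Y = "\<lambda>i \<omega>. exp (- (lam * X i \<omega>))"
  have indY: "indep_vars (\<lambda>_. borel) ?Y I"
    by (rule indep_vars_compose2[OF ind, where Y = "\<lambda>i x. exp (- (lam * x))"]) measurable
  have intY: "integrable M (?Y i)" if "i \<in> I" for i
    by (rule integrable_const_bound[of _ 1]) (use that nn lam in auto)
  have EY: "expectation (?Y i) \<le> exp (- (1 / (4 * h)) - 1 / (8 * h))" if "i \<in> I" for i
  proof -
    have "expectation (?Y i) \<le> expectation (\<lambda>\<omega>. 1 - lam * X i \<omega> + lam\<^sup>2 / 2 * (X i \<omega>)\<^sup>2)"
    proof (rule integral_mono[OF intY[OF that]])
      show "integrable M (\<lambda>\<omega>. 1 - lam * X i \<omega> + lam\<^sup>2 / 2 * (X i \<omega>)\<^sup>2)"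
        using int that by (intro Bochner_Integration.integrable_add Bochner_Integration.integrable_diff
          integrable_const integrable_mult_right) auto
      show "?Y i \<omega> \<le> 1 - lam * X i \<omega> + lam\<^sup>2 / 2 * (X i \<omega>)\<^sup>2" for \<omega>
        using exp_minus_le_quadratic[of "lam * X i \<omega>"] nn[OF that] lam by (simp add: power_mult_distrib)
    qed
    also have "\<dots> = 1 - lam + lam\<^sup>2 / 2 * expectation (\<lambda>\<omega>. (X i \<omega>)\<^sup>2)"
      using int that ex[OF that] by (simp add: prob_space)
    also have "\<dots> \<le> 1 - lam + lam\<^sup>2 / 2 * h"
      using ex2[OF that] by (intro add_left_mono mult_left_mono) auto
    also have "\<dots> \<le> exp (- lam + lam\<^sup>2 / 2 * h)"
      using exp_ge_add_one_self[of "- lam + lam\<^sup>2 / 2 * h"] by (simp only: diff_conv_add_uminus add.assoc)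
    also have "- lam + lam\<^sup>2 / 2 * h = - (1 / (4 * h)) - 1 / (8 * h)"
      using h by (simp add: lam_def field_simps power2_eq_square)
    finally show ?thesis .
  qed
  let ?N = "real (card I)"
  have "prob {\<omega> \<in> space M. (\<Sum>i\<in>I. X i \<omega>) \<le> ?N / 2} = prob {\<omega> \<in> space M. (\<Prod>i\<in>I. ?Y i \<omega>) \<ge> exp (- (lam * (?N / 2)))}"
    using lam by (intro arg_cong[where f = prob] Collect_cong)
      (simp add: exp_sum[OF I, symmetric] sum_negf sum_distrib_left[symmetric])
  also have "\<dots> \<le> expectation (\<lambda>\<omega>. \<Prod>i\<in>I. ?Y i \<omega>) / exp (- (lam * (?N / 2)))"
    using I indY intY by (intro integral_Markov_inequality_measure[where A = "{}"] indep_vars_integrable)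
      (auto intro!: prod_nonneg)
  also have "expectation (\<lambda>\<omega>. \<Prod>i\<in>I. ?Y i \<omega>) = (\<Prod>i\<in>I. expectation (?Y i))"
    using I indY intY by (rule indep_vars_lebesgue_integral)
  also have "\<dots> \<le> (\<Prod>i\<in>I. exp (- (1 / (4 * h)) - 1 / (8 * h)))"
    using EY by (intro prod_mono) (auto intro!: Bochner_Integration.integral_nonneg)
  also have "\<dots> = exp (?N * (- (1 / (4 * h)) - 1 / (8 * h)))"
    by (simp only: prod_constant exp_of_nat_mult)
  also have "exp (?N * (- (1 / (4 * h)) - 1 / (8 * h))) / exp (- (lam * (?N / 2)))
     = exp (?N * (- (1 / (4 * h)) - 1 / (8 * h)) + lam * (?N / 2))"
    by (simp add: exp_diff[symmetric])
  also have "?N * (- (1 / (4 * h)) - 1 / (8 * h)) + lam * (?N / 2) = - ?N / (8 * h)"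
    using h by (simp add: lam_def field_simps)
  finally show ?thesis by (simp add: divide_right_mono)
qed

lemma dot_cauchy_schwarz:
  assumes "finite K"
  shows "(dot K v w)\<^sup>2 \<le> dot K v v * dot K w w"
  unfolding dot_def using Cauchy_Schwarz_ineq_sum[of v w K] by (simp add: power2_eq_square)

text \<open>The points of the cube \<open>[-1, 1]\<^sup>m\<close> with coordinates in multiples of \<open>1 / N\<close>, as extensional functions, so that
  the set is finite.\<close>

definition grid :: "nat \<Rightarrow> nat \<Rightarrow> (nat \<Rightarrow> real) set" where
  "grid m N = (PiE {..<m} (\<lambda>_. (\<lambda>k::int. k / N) ` {- int N..int N}))"

lemma finite_grid: "finite (grid m N)"
  unfolding grid_def by (intro finite_PiE) auto

lemma card_grid_le: "real (card (grid m N)) \<le> (2 * real N + 1) ^ m"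
proof -
  have "card (grid m N) = card ((\<lambda>k::int. k / real N) ` {- int N..int N}) ^ m"
    unfolding grid_def by (subst card_PiE) auto
  also have "\<dots> \<le> card {- int N..int N} ^ m" by (intro power_mono card_image_le) auto
  also have "card {- int N..int N} = 2 * N + 1" by simp
  finally have "real (card (grid m N)) \<le> real ((2 * N + 1) ^ m)" by (simp only: of_nat_le_iff)
  then show ?thesis by (simp add: add.commute)
qed

text \<open>Round a unit vector \<open>d\<close> down to a grid point \<open>g\<close>. The rounding error \<open>r\<close> satisfies \<open>\<parallel>r\<parallel>\<^sup>2 \<le> m / N\<^sup>2\<close>, so
  \<open>g\<close> is not short, and by Cauchy-Schwarz the form at \<open>r\<close> is at most \<open>\<parallel>r\<parallel>\<^sup>2\<close> times the trace. The
  constant 16 pays for two uses of \<open>(a + b)\<^sup>2 \<le> 2 a\<^sup>2 + 2 b\<^sup>2\<close> and for the error itself.\<close>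

lemma quadratic_form_lower_from_grid:
  fixes z :: "nat \<Rightarrow> nat \<Rightarrow> real"
  assumes L: "finite L" and N: "N > 0" and c: "c > 0"
    and grid: "\<And>g. g \<in> grid m N \<Longrightarrow> dot {..<m} g g > 0 \<Longrightarrow>
        c * dot {..<m} g g \<le> (\<Sum>l\<in>L. (dot {..<m} g (z l))\<^sup>2)"
    and trace: "(\<Sum>l\<in>L. dot {..<m} (z l) (z l)) \<le> T"
    and fine: "real m / real N ^ 2 \<le> 1 / 4" "T * (real m / real N ^ 2) \<le> c / 16"
  shows "c / 16 * dot {..<m} d d \<le> (\<Sum>l\<in>L. (dot {..<m} d (z l))\<^sup>2)"
proof -
  let ?Q = "\<lambda>d. \<Sum>l\<in>L. (dot {..<m} d (z l))\<^sup>2"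
  let ?n = "\<lambda>d. dot {..<m} d d"
  have unit: "c / 16 \<le> ?Q d" if d: "?n d = 1" for d
  proof -
    define g where "g = (\<lambda>i\<in>{..<m}. \<lfloor>real N * d i\<rfloor> / real N)"
    define r where "r i = d i - g i" for i
    have dle: "\<bar>d i\<bar> \<le> 1" if "i < m" for i
    proof -
      have "d i * d i \<le> ?n d" unfolding dot_def using that by (intro member_le_sum) auto
      then show ?thesis using d by (simp add: abs_square_le_1 power2_eq_square[symmetric])
    qed
    have "\<lfloor>real N * d i\<rfloor> \<in> {- int N..int N}" if "i < m" for i
    proof -
      have "\<bar>real N * d i\<bar> \<le> real N" using dle[OF that] N by (simp add: abs_mult)
      then have "- real N \<le> real N * d i" "real N * d i \<le> real N" by linarith+
      then show ?thesis by (auto simp: le_floor_iff floor_le_iff)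
    qed
    then have g_grid: "g \<in> grid m N" unfolding grid_def g_def by (auto simp: PiE_def)
    have r: "(r i)\<^sup>2 \<le> 1 / real N ^ 2" if "i < m" for i
    proof -
      have "r i = (real N * d i - \<lfloor>real N * d i\<rfloor>) / real N"
        using N that by (simp add: r_def g_def field_simps)
      moreover have "0 \<le> real N * d i - \<lfloor>real N * d i\<rfloor>" "real N * d i - \<lfloor>real N * d i\<rfloor> \<le> 1" by linarith+
      ultimately have "0 \<le> r i" "r i \<le> 1 / real N" using N by (auto simp: divide_right_mono)
      then have "(r i)\<^sup>2 \<le> (1 / real N)\<^sup>2" by (intro power_mono) auto
      then show ?thesis by (simp add: power_divide)
    qed
    have rn: "?n r \<le> real m / real N ^ 2"
    proof -
      have "?n r \<le> (\<Sum>i<m. 1 / real N ^ 2)"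
        unfolding dot_def using r by (intro sum_mono) (auto simp: power2_eq_square)
      then show ?thesis by simp
    qed
    have split: "(a + b)\<^sup>2 \<le> 2 * a\<^sup>2 + 2 * b\<^sup>2" for a b :: real
      using zero_le_power2[of "a - b"] by (simp add: power2_eq_square algebra_simps)
    have "?n d \<le> 2 * ?n g + 2 * ?n r"
    proof -
      have "?n d = (\<Sum>i<m. (g i + r i)\<^sup>2)" by (simp add: dot_def r_def power2_eq_square)
      also have "\<dots> \<le> (\<Sum>i<m. 2 * (g i)\<^sup>2 + 2 * (r i)\<^sup>2)" by (intro sum_mono split)
      finally show ?thesis by (simp add: dot_def sum.distrib sum_distrib_left power2_eq_square)
    qed
    then have g4: "?n g \<ge> 1 / 4" using d rn fine(1) by linarith
    have "?Q g \<le> 2 * ?Q d + 2 * ?Q r"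
    proof -
      have "dot {..<m} g (z l) = dot {..<m} d (z l) + - dot {..<m} r (z l)" for l
        by (simp add: r_def[abs_def] dot_linear)
      then have "?Q g = (\<Sum>l\<in>L. (dot {..<m} d (z l) + - dot {..<m} r (z l))\<^sup>2)" by simp
      also have "\<dots> \<le> (\<Sum>l\<in>L. 2 * (dot {..<m} d (z l))\<^sup>2 + 2 * (- dot {..<m} r (z l))\<^sup>2)"
        by (intro sum_mono split)
      finally show ?thesis by (simp add: sum.distrib sum_distrib_left)
    qed
    moreover have "?Q r \<le> c / 16"
    proof -
      have "?Q r \<le> (\<Sum>l\<in>L. ?n r * ?n (z l))" by (intro sum_mono dot_cauchy_schwarz) auto
      also have "\<dots> = ?n r * (\<Sum>l\<in>L. ?n (z l))" by (simp add: sum_distrib_left)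
      also have "\<dots> \<le> real m / real N ^ 2 * T"
        using rn trace by (intro mult_mono sum_nonneg) (auto simp: dot_self_nonneg)
      also have "\<dots> \<le> c / 16" using fine(2) by (simp only: mult.commute)
      finally show ?thesis .
    qed
    moreover have "c * (1 / 4) \<le> c * ?n g" using g4 c by (intro mult_left_mono) auto
    moreover have "c * ?n g \<le> ?Q g" using grid[OF g_grid] g4 by simp
    ultimately show ?thesis by linarith
  qed
  show ?thesis
  proof (cases "?n d = 0")
    case True
    then show ?thesis by (simp add: sum_nonneg)
  next
    case False
    then have pos: "?n d > 0" using dot_self_nonneg[of "{..<m}" d] by linarith
    have "c / 16 \<le> ?Q (\<lambda>k. 1 / sqrt (?n d) * d k)" by (rule unit[OF dot_normalize[OF pos]])
    also have "\<dots> = (\<Sum>l\<in>L. (1 / ?n d) * (dot {..<m} d (z l))\<^sup>2)"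
      unfolding dot_scale_left using pos by (simp add: power_mult_distrib power_divide)
    also have "\<dots> = ?Q d / ?n d" by (simp add: sum_divide_distrib)
    finally show ?thesis using pos by (simp add: field_simps)
  qed
qed

lemma integrable_product_of_squares:
  fixes f g :: "'a \<Rightarrow> real"
  assumes [measurable]: "f \<in> borel_measurable M" "g \<in> borel_measurable M"
    and "integrable M (\<lambda>x. (f x)\<^sup>2)" "integrable M (\<lambda>x. (g x)\<^sup>2)"
  shows "integrable M (\<lambda>x. f x * g x)"
proof (rule Bochner_Integration.integrable_bound)
  show "integrable M (\<lambda>x. (f x)\<^sup>2 + (g x)\<^sup>2)" using assms by simp
  have "\<bar>a * b\<bar> \<le> a\<^sup>2 + b\<^sup>2" for a b :: real
    using zero_le_power2[of "a - b"] zero_le_power2[of "a + b"] zero_le_power2[of a] zero_le_power2[of b]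
    by (simp add: power2_eq_square algebra_simps abs_if)
  then show "AE x in M. norm (f x * g x) \<le> norm ((f x)\<^sup>2 + (g x)\<^sup>2)" by simp
qed simp

text \<open>Second moment of a sum of uncorrelated variables. It serves both for the noise level, with
  summands \<open>\<epsilon>\<^sub>l\<^sup>2 - \<sigma>\<^sup>2\<close>, and for the cross terms, with summands \<open>z\<^sub>l\<^sub>i \<epsilon>\<^sub>l\<close>.\<close>

lemma (in prob_space) expectation_square_orthogonal_sum:
  fixes f :: "'i \<Rightarrow> 'a \<Rightarrow> real" and v :: real
  assumes I: "finite I"
    and int: "\<And>i j. i \<in> I \<Longrightarrow> j \<in> I \<Longrightarrow> integrable M (\<lambda>\<omega>. f i \<omega> * f j \<omega>)"
    and ex: "\<And>i j. i \<in> I \<Longrightarrow> j \<in> I \<Longrightarrow> expectation (\<lambda>\<omega>. f i \<omega> * f j \<omega>) = (if i = j then v else 0)"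
  shows "integrable M (\<lambda>\<omega>. (\<Sum>i\<in>I. f i \<omega>)\<^sup>2)"
    and "expectation (\<lambda>\<omega>. (\<Sum>i\<in>I. f i \<omega>)\<^sup>2) = card I * v"
proof -
  have eq: "(\<Sum>i\<in>I. f i \<omega>)\<^sup>2 = (\<Sum>i\<in>I. \<Sum>j\<in>I. f i \<omega> * f j \<omega>)" for \<omega>
    by (simp add: power2_eq_square sum_product)
  show "integrable M (\<lambda>\<omega>. (\<Sum>i\<in>I. f i \<omega>)\<^sup>2)" unfolding eq using int by auto
  have "expectation (\<lambda>\<omega>. (\<Sum>i\<in>I. f i \<omega>)\<^sup>2) = (\<Sum>i\<in>I. \<Sum>j\<in>I. expectation (\<lambda>\<omega>. f i \<omega> * f j \<omega>))"
    unfolding eq using int by (simp add: Bochner_Integration.integral_sum)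
  also have "\<dots> = (\<Sum>i\<in>I. \<Sum>j\<in>I. if i = j then v else 0)" using ex by simp
  also have "\<dots> = card I * v" using I by simp
  finally show "expectation (\<lambda>\<omega>. (\<Sum>i\<in>I. f i \<omega>)\<^sup>2) = card I * v" .
qed

section \<open>Samples with identity second moment matrix\<close>

text \<open>Rows \<open>z l\<close> of dimension \<open>m\<close> whose coordinates are orthonormal in mean square and whose
  projections on unit vectors have fourth moments at most \<open>h\<close>, with Gaussian noise \<open>e\<close>. Independence of the
  rows and of the noise is assumed only in the form in which moments use it.\<close>

locale whitened_sample = prob_space M for M :: "'a measure" +
  fixes n m :: nat and z :: "nat \<Rightarrow> nat \<Rightarrow> 'a \<Rightarrow> real" and e :: "nat \<Rightarrow> 'a \<Rightarrow> real" and \<sigma> h :: real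
  assumes n_large: "32 \<le> n" and m_pos: "0 < m" and m_less: "m < n"
    and sigma: "\<sigma> > 0" and h: "h > 0"
    and z_meas: "\<And>l i. l \<in> {1..n} \<Longrightarrow> i < m \<Longrightarrow> z l i \<in> borel_measurable M"
    and z_indep: "\<And>d. indep_vars (\<lambda>_. borel) (\<lambda>l \<omega>. dot {..<m} d (\<lambda>i. z l i \<omega>)) {1..n}"
    and z_sq: "\<And>l i. l \<in> {1..n} \<Longrightarrow> i < m \<Longrightarrow> integrable M (\<lambda>\<omega>. (z l i \<omega>)\<^sup>2)"
    and z_white: "\<And>l i j. l \<in> {1..n} \<Longrightarrow> i < m \<Longrightarrow> j < m \<Longrightarrow>
      expectation (\<lambda>\<omega>. z l i \<omega> * z l j \<omega>) = (if i = j then 1 else 0)"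
    and z_fourth_int: "\<And>l d. l \<in> {1..n} \<Longrightarrow> dot {..<m} d d = 1 \<Longrightarrow>
      integrable M (\<lambda>\<omega>. (dot {..<m} d (\<lambda>i. z l i \<omega>)) ^ 4)"
    and z_fourth: "\<And>l d. l \<in> {1..n} \<Longrightarrow> dot {..<m} d d = 1 \<Longrightarrow>
      expectation (\<lambda>\<omega>. (dot {..<m} d (\<lambda>i. z l i \<omega>)) ^ 4) \<le> h"
    and e_indep: "indep_vars (\<lambda>_. borel) e {1..n}"
    and e_distr: "\<And>l. l \<in> {1..n} \<Longrightarrow> distr M borel (e l) = density lborel (\<lambda>u. ennreal (normal_density 0 \<sigma> u))"
    and ze_indep: "\<And>l k i. l \<in> {1..n} \<Longrightarrow> k \<in> {1..n} \<Longrightarrow> i < m \<Longrightarrow>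
      indep_var borel (\<lambda>\<omega>. z l i \<omega> * z k i \<omega>) borel (\<lambda>\<omega>. e l \<omega> * e k \<omega>)"
begin

lemma e_meas: "l \<in> {1..n} \<Longrightarrow> e l \<in> borel_measurable M"
  using e_indep by (auto simp: indep_vars_def)

lemma e_power_has_expectation:
  assumes "l \<in> {1..n}" "has_bochner_integral lborel (\<lambda>u. normal_density 0 \<sigma> u * u ^ k) v"
  shows "integrable M (\<lambda>\<omega>. e l \<omega> ^ k)" "expectation (\<lambda>\<omega>. e l \<omega> ^ k) = v"
proof -
  note [measurable] = e_meas[OF assms(1)]
  have "integrable (density lborel (\<lambda>u. ennreal (normal_density 0 \<sigma> u))) (\<lambda>u. u ^ k)"
    using assms(2) by (subst integrable_density) (auto simp: has_bochner_integral_iff)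
  then have "integrable (distr M borel (e l)) (\<lambda>u. u ^ k)" using e_distr[OF assms(1)] by simp
  then show "integrable M (\<lambda>\<omega>. e l \<omega> ^ k)" by (subst (asm) integrable_distr_eq) auto
  have "expectation (\<lambda>\<omega>. e l \<omega> ^ k) = integral\<^sup>L (distr M borel (e l)) (\<lambda>u. u ^ k)"
    by (subst integral_distr) auto
  also have "\<dots> = integral\<^sup>L (density lborel (\<lambda>u. ennreal (normal_density 0 \<sigma> u))) (\<lambda>u. u ^ k)"
    using e_distr[OF assms(1)] by simp
  also have "\<dots> = v" using assms(2)
    by (subst integral_density) (auto simp: has_bochner_integral_iff)
  finally show "expectation (\<lambda>\<omega>. e l \<omega> ^ k) = v" .
qed

lemma e_moments:
  assumes "l \<in> {1..n}"
  shows "integrable M (e l)" "expectation (e l) = 0"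
    "integrable M (\<lambda>\<omega>. (e l \<omega>)\<^sup>2)" "expectation (\<lambda>\<omega>. (e l \<omega>)\<^sup>2) = \<sigma>\<^sup>2"
    "integrable M (\<lambda>\<omega>. (e l \<omega>) ^ 4)" "expectation (\<lambda>\<omega>. (e l \<omega>) ^ 4) = 3 * \<sigma> ^ 4"
proof -
  have 1: "has_bochner_integral lborel (\<lambda>u. normal_density 0 \<sigma> u * u ^ 1) 0"
    using normal_moment_odd[OF sigma, of 0 0] by simp
  have 2: "has_bochner_integral lborel (\<lambda>u. normal_density 0 \<sigma> u * u ^ 2) (\<sigma>\<^sup>2)"
    using normal_moment_even[OF sigma, of 0 1] sigma by simp
  have 4: "has_bochner_integral lborel (\<lambda>u. normal_density 0 \<sigma> u * u ^ 4) (3 * \<sigma> ^ 4)"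
    using normal_moment_even[OF sigma, of 0 2] sigma by (simp add: fact_numeral power_divide)
  show "integrable M (e l)" "expectation (e l) = 0"
    using e_power_has_expectation[OF assms 1] by simp_all
  show "integrable M (\<lambda>\<omega>. (e l \<omega>)\<^sup>2)" "expectation (\<lambda>\<omega>. (e l \<omega>)\<^sup>2) = \<sigma>\<^sup>2"
    using e_power_has_expectation[OF assms 2] by simp_all
  show "integrable M (\<lambda>\<omega>. (e l \<omega>) ^ 4)" "expectation (\<lambda>\<omega>. (e l \<omega>) ^ 4) = 3 * \<sigma> ^ 4"
    using e_power_has_expectation[OF assms 4] by simp_all
qed

lemma expectation_indep_pair:
  fixes X :: "nat \<Rightarrow> 'a \<Rightarrow> real"
  assumes "indep_vars (\<lambda>_. borel) X {1..n}" "l \<in> {1..n}" "k \<in> {1..n}" "l \<noteq> k"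
    "integrable M (X l)" "integrable M (X k)"
  shows "integrable M (\<lambda>\<omega>. X l \<omega> * X k \<omega>)"
    "expectation (\<lambda>\<omega>. X l \<omega> * X k \<omega>) = expectation (X l) * expectation (X k)"
proof -
  have ind: "indep_vars (\<lambda>_. borel) X {l, k}" using assms by (intro indep_vars_subset[OF assms(1)]) auto
  have "integrable M (\<lambda>\<omega>. \<Prod>i\<in>{l, k}. X i \<omega>)" using assms by (intro indep_vars_integrable ind) auto
  then show "integrable M (\<lambda>\<omega>. X l \<omega> * X k \<omega>)" using assms(4) by simp
  have "expectation (\<lambda>\<omega>. \<Prod>i\<in>{l, k}. X i \<omega>) = (\<Prod>i\<in>{l, k}. expectation (X i))"
    using assms by (intro indep_vars_lebesgue_integral ind) auto
  then show "expectation (\<lambda>\<omega>. X l \<omega> * X k \<omega>) = expectation (X l) * expectation (X k)"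
    using assms(4) by simp
qed

lemma noise_deviation:
  "prob {\<omega> \<in> space M. n * \<sigma>\<^sup>2 / 2 \<le> \<bar>(\<Sum>l\<in>{1..n}. (e l \<omega>)\<^sup>2) - n * \<sigma>\<^sup>2\<bar>} \<le> 8 / n"
proof -
  let ?f = "\<lambda>l \<omega>. (e l \<omega>)\<^sup>2 - \<sigma>\<^sup>2"
  have ind: "indep_vars (\<lambda>_. borel) ?f {1..n}"
    by (rule indep_vars_compose2[OF e_indep, where Y = "\<lambda>_ u. u\<^sup>2 - \<sigma>\<^sup>2"]) measurable
  have f_int: "integrable M (?f l)" and f_exp: "expectation (?f l) = 0" if "l \<in> {1..n}" for l
    using e_moments[OF that] by (simp_all add: prob_space)
  have sq: "?f l \<omega> * ?f l \<omega> = (e l \<omega>) ^ 4 - 2 * \<sigma>\<^sup>2 * (e l \<omega>)\<^sup>2 + \<sigma> ^ 4" for l \<omega>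
    by (simp add: power2_eq_square power4_eq_xxxx algebra_simps)
  have f_sq: "integrable M (\<lambda>\<omega>. ?f l \<omega> * ?f l \<omega>)" "expectation (\<lambda>\<omega>. ?f l \<omega> * ?f l \<omega>) = 2 * \<sigma> ^ 4"
    if "l \<in> {1..n}" for l
  proof -
    show "integrable M (\<lambda>\<omega>. ?f l \<omega> * ?f l \<omega>)"
      unfolding sq using e_moments[OF that] by auto
    have "expectation (\<lambda>\<omega>. ?f l \<omega> * ?f l \<omega>) = 3 * \<sigma> ^ 4 - 2 * \<sigma>\<^sup>2 * \<sigma>\<^sup>2 + \<sigma> ^ 4"
      unfolding sq using e_moments[OF that] by (simp add: prob_space)
    then show "expectation (\<lambda>\<omega>. ?f l \<omega> * ?f l \<omega>) = 2 * \<sigma> ^ 4"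
      by (simp add: power2_eq_square power4_eq_xxxx)
  qed
  have f_int2: "integrable M (\<lambda>\<omega>. ?f l \<omega> * ?f k \<omega>)" if "l \<in> {1..n}" "k \<in> {1..n}" for l k
    using f_sq(1)[of l] expectation_indep_pair(1)[OF ind, of l k] f_int that by (cases "l = k") auto
  have f_exp2: "expectation (\<lambda>\<omega>. ?f l \<omega> * ?f k \<omega>) = (if l = k then 2 * \<sigma> ^ 4 else 0)"
    if "l \<in> {1..n}" "k \<in> {1..n}" for l k
    using f_sq(2)[of l] expectation_indep_pair(2)[OF ind, of l k] f_int f_exp that by (cases "l = k") auto
  let ?S = "\<lambda>\<omega>. \<Sum>l\<in>{1..n}. ?f l \<omega>"
  have S: "integrable M (\<lambda>\<omega>. (?S \<omega>)\<^sup>2)" "expectation (\<lambda>\<omega>. (?S \<omega>)\<^sup>2) = card {1..n} * (2 * \<sigma> ^ 4)"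
    by (rule expectation_square_orthogonal_sum[OF _ f_int2 f_exp2]; simp)+
  have "?S \<omega> = (\<Sum>l\<in>{1..n}. (e l \<omega>)\<^sup>2) - n * \<sigma>\<^sup>2" for \<omega> by (simp add: sum_subtractf)
  then have "{\<omega> \<in> space M. n * \<sigma>\<^sup>2 / 2 \<le> \<bar>(\<Sum>l\<in>{1..n}. (e l \<omega>)\<^sup>2) - n * \<sigma>\<^sup>2\<bar>}
     = {\<omega> \<in> space M. (n * \<sigma>\<^sup>2 / 2)\<^sup>2 \<le> (?S \<omega>)\<^sup>2}"
    using abs_le_square_iff[of "n * \<sigma>\<^sup>2 / 2" "?S _"] by (simp only:) simp
  then have "prob {\<omega> \<in> space M. n * \<sigma>\<^sup>2 / 2 \<le> \<bar>(\<Sum>l\<in>{1..n}. (e l \<omega>)\<^sup>2) - n * \<sigma>\<^sup>2\<bar>}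
     \<le> (n * (2 * \<sigma> ^ 4)) / (n * \<sigma>\<^sup>2 / 2)\<^sup>2"
    using integral_Markov_inequality_measure[OF S(1), of "{}" "(n * \<sigma>\<^sup>2 / 2)\<^sup>2"] S(2) sigma n_large by simp
  also have "\<dots> = 8 / n"
    using sigma n_large by (simp add: field_simps power2_eq_square power4_eq_xxxx)
  finally show ?thesis .
qed

text \<open>A bound, uniform in the direction \<open>d\<close>, for the squared cross term between noise and design relative to
  \<open>\<parallel>d\<parallel>\<^sup>2\<close>.\<close>

definition W :: "'a \<Rightarrow> real" where
  "W \<omega> = (\<Sum>i<m. (\<Sum>l\<in>{1..n}. z l i \<omega> * e l \<omega>)\<^sup>2)"

lemma W_markov:
  assumes "s > 0"
  shows "prob {\<omega> \<in> space M. real n * s \<le> W \<omega>} \<le> m * \<sigma>\<^sup>2 / s"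
proof -
  have zz: "integrable M (\<lambda>\<omega>. z l i \<omega> * z k i \<omega>)" if "l \<in> {1..n}" "k \<in> {1..n}" "i < m" for l k i
    using that by (intro integrable_product_of_squares z_meas z_sq)
  have ee: "integrable M (\<lambda>\<omega>. e l \<omega> * e k \<omega>)" if "l \<in> {1..n}" "k \<in> {1..n}" for l k
    using that by (intro integrable_product_of_squares e_meas e_moments)
  have ee0: "expectation (\<lambda>\<omega>. e l \<omega> * e k \<omega>) = (if l = k then \<sigma>\<^sup>2 else 0)" if "l \<in> {1..n}" "k \<in> {1..n}" for l k
    using e_moments(4)[of l] expectation_indep_pair(2)[OF e_indep, of l k] e_moments(1,2) that
    by (cases "l = k") (auto simp: power2_eq_square)
  have swap: "z l i \<omega> * e l \<omega> * (z k i \<omega> * e k \<omega>) = (z l i \<omega> * z k i \<omega>) * (e l \<omega> * e k \<omega>)" for l k i \<omega>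
    by simp
  have int: "integrable M (\<lambda>\<omega>. z l i \<omega> * e l \<omega> * (z k i \<omega> * e k \<omega>))"
    if "i < m" "l \<in> {1..n}" "k \<in> {1..n}" for l k i
    unfolding swap using that by (intro indep_var_integrable ze_indep zz ee)
  have exp: "expectation (\<lambda>\<omega>. z l i \<omega> * e l \<omega> * (z k i \<omega> * e k \<omega>)) = (if l = k then \<sigma>\<^sup>2 else 0)"
    if "i < m" "l \<in> {1..n}" "k \<in> {1..n}" for l k i
  proof -
    have "expectation (\<lambda>\<omega>. z l i \<omega> * e l \<omega> * (z k i \<omega> * e k \<omega>))
      = expectation (\<lambda>\<omega>. z l i \<omega> * z k i \<omega>) * expectation (\<lambda>\<omega>. e l \<omega> * e k \<omega>)"
      unfolding swap using that by (intro indep_var_lebesgue_integral ze_indep zz ee)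
    then show ?thesis using ee0[OF that(2,3)] z_white[OF that(2,1,1)] by (cases "l = k") auto
  qed
  have i: "integrable M (\<lambda>\<omega>. (\<Sum>l\<in>{1..n}. z l i \<omega> * e l \<omega>)\<^sup>2)"
    "expectation (\<lambda>\<omega>. (\<Sum>l\<in>{1..n}. z l i \<omega> * e l \<omega>)\<^sup>2) = card {1..n} * \<sigma>\<^sup>2" if "i < m" for i
    by (rule expectation_square_orthogonal_sum[OF _ int[OF that] exp[OF that]]; simp)+
  have W: "integrable M W" unfolding W_def[abs_def] using i(1) by auto
  have "expectation W = m * (n * \<sigma>\<^sup>2)"
    unfolding W_def[abs_def] using i by (simp add: Bochner_Integration.integral_sum)
  moreover have "W \<omega> \<ge> 0" for \<omega> by (simp add: W_def sum_nonneg)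
  ultimately have "prob {\<omega> \<in> space M. real n * s \<le> W \<omega>} \<le> m * (n * \<sigma>\<^sup>2) / (real n * s)"
    using integral_Markov_inequality_measure[OF W, of "{}" "real n * s"] assms n_large by simp
  then show ?thesis using n_large by simp
qed

lemma cross_term_le_W:
  "(\<Sum>l\<in>{1..n}. dot {..<m} d (\<lambda>i. z l i \<omega>) * e l \<omega>)\<^sup>2 \<le> W \<omega> * dot {..<m} d d"
proof -
  have "(\<Sum>l\<in>{1..n}. dot {..<m} d (\<lambda>i. z l i \<omega>) * e l \<omega>)
      = (\<Sum>l\<in>{1..n}. \<Sum>i<m. d i * z l i \<omega> * e l \<omega>)"
    by (simp add: dot_def sum_distrib_right)
  also have "\<dots> = (\<Sum>i<m. \<Sum>l\<in>{1..n}. d i * z l i \<omega> * e l \<omega>)" by (rule sum.swap)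
  also have "\<dots> = dot {..<m} d (\<lambda>i. \<Sum>l\<in>{1..n}. z l i \<omega> * e l \<omega>)"
    by (simp add: dot_def sum_distrib_left mult.assoc)
  finally show ?thesis
    using dot_cauchy_schwarz[of "{..<m}" d "\<lambda>i. \<Sum>l\<in>{1..n}. z l i \<omega> * e l \<omega>"]
    by (simp add: W_def dot_def power2_eq_square mult.commute)
qed

definition trace :: "'a \<Rightarrow> real" where
  "trace \<omega> = (\<Sum>l\<in>{1..n}. dot {..<m} (\<lambda>i. z l i \<omega>) (\<lambda>i. z l i \<omega>))"

lemma trace_markov: "prob {\<omega> \<in> space M. real n ^ 2 * m \<le> trace \<omega>} \<le> 1 / n"
proof -
  have tr: "integrable M trace" unfolding trace_def[abs_def] dot_def
    using z_sq by (intro Bochner_Integration.integrable_sum) (auto simp: power2_eq_square)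
  have "expectation trace = (\<Sum>l\<in>{1..n}. \<Sum>i<m. expectation (\<lambda>\<omega>. z l i \<omega> * z l i \<omega>))"
  proof -
    have zz: "integrable M (\<lambda>\<omega>. z l i \<omega> * z l i \<omega>)" if "l \<in> {1..n}" "i < m" for l i
      using z_sq[OF that] by (simp add: power2_eq_square)
    have "expectation trace = (\<Sum>l\<in>{1..n}. expectation (\<lambda>\<omega>. \<Sum>i<m. z l i \<omega> * z l i \<omega>))"
      unfolding trace_def[abs_def] dot_def
      by (intro Bochner_Integration.integral_sum Bochner_Integration.integrable_sum zz) auto
    then show ?thesis
      by (simp only:) (intro sum.cong refl Bochner_Integration.integral_sum zz, auto)
  qed
  also have "\<dots> = n * m" using z_white by simp
  finally have tr_exp: "expectation trace = n * m" .
  have "trace \<omega> \<ge> 0" for \<omega> by (simp add: trace_def dot_self_nonneg sum_nonneg)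
  then have "prob {\<omega> \<in> space M. real n ^ 2 * m \<le> trace \<omega>} \<le> n * m / (real n ^ 2 * m)"
    using integral_Markov_inequality_measure[OF tr, of "{}" "real n ^ 2 * m"] tr_exp n_large m_pos by simp
  then show ?thesis using n_large m_pos by (simp add: power2_eq_square)
qed

text \<open>After normalising \<open>g\<close>, the squared projections have mean 1 and second moment at most \<open>h\<close>.\<close>

lemma direction_lower_tail:
  assumes g: "dot {..<m} g g > 0"
  shows "prob {\<omega> \<in> space M. (\<Sum>l\<in>{1..n}. (dot {..<m} g (\<lambda>i. z l i \<omega>))\<^sup>2) \<le> n / 2 * dot {..<m} g g}
    \<le> exp (- real n / (8 * h))"
proof -
  define N where "N = dot {..<m} g g"
  define d where "d k = 1 / sqrt N * g k" for k
  have N: "N > 0" using g by (simp add: N_def)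
  have dn: "dot {..<m} d d = 1" unfolding d_def N_def by (rule dot_normalize[OF g])
  let ?X = "\<lambda>l \<omega>. (dot {..<m} d (\<lambda>i. z l i \<omega>))\<^sup>2"
  have X: "?X l \<omega> = (dot {..<m} g (\<lambda>i. z l i \<omega>))\<^sup>2 / N" for l \<omega>
  proof -
    have "d = (\<lambda>k. 1 / sqrt N * g k)" by (simp add: d_def fun_eq_iff)
    then show ?thesis using N by (simp only: dot_scale_left) (simp add: power_divide)
  qed
  have prod: "integrable M (\<lambda>\<omega>. z l i \<omega> * z l j \<omega>)" if "l \<in> {1..n}" "i < m" "j < m" for l i j
    using that by (intro integrable_product_of_squares z_meas z_sq)
  have X_eq: "?X l \<omega> = (\<Sum>i<m. \<Sum>j<m. d i * d j * (z l i \<omega> * z l j \<omega>))" for l \<omega>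
    by (simp add: dot_def power2_eq_square sum_product mult_ac)
  have "prob {\<omega> \<in> space M. (\<Sum>l\<in>{1..n}. ?X l \<omega>) \<le> card {1..n} / 2} \<le> exp (- real (card {1..n}) / (8 * h))"
  proof (rule chernoff_lower_tail)
    show "indep_vars (\<lambda>_. borel) ?X {1..n}"
      by (rule indep_vars_compose2[OF z_indep[of d], where Y = "\<lambda>_ u. u\<^sup>2"]) measurable
    fix l assume l: "l \<in> {1..n}"
    show "integrable M (?X l)" unfolding X_eq
      by (intro Bochner_Integration.integrable_sum integrable_mult_right prod l) auto
    have "expectation (?X l) = (\<Sum>i<m. \<Sum>j<m. d i * d j * expectation (\<lambda>\<omega>. z l i \<omega> * z l j \<omega>))"
    proof -
      have "expectation (?X l) = (\<Sum>i<m. expectation (\<lambda>\<omega>. \<Sum>j<m. d i * d j * (z l i \<omega> * z l j \<omega>)))"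
        unfolding X_eq
        by (intro Bochner_Integration.integral_sum Bochner_Integration.integrable_sum integrable_mult_right prod l) auto
      also have "\<dots> = (\<Sum>i<m. \<Sum>j<m. expectation (\<lambda>\<omega>. d i * d j * (z l i \<omega> * z l j \<omega>)))"
        by (intro sum.cong refl Bochner_Integration.integral_sum integrable_mult_right prod l) auto
      finally show ?thesis by simp
    qed
    also have "\<dots> = (\<Sum>i<m. \<Sum>j<m. if j = i then d i * d j else 0)"
      using z_white[OF l] by (intro sum.cong refl) auto
    also have "\<dots> = 1" using dn by (simp add: dot_def)
    finally show "expectation (?X l) = 1" .
    have four: "(?X l \<omega>)\<^sup>2 = (dot {..<m} d (\<lambda>i. z l i \<omega>)) ^ 4" for \<omega> by (simp flip: power_mult)
    show "integrable M (\<lambda>\<omega>. (?X l \<omega>)\<^sup>2)" unfolding four by (rule z_fourth_int[OF l dn])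
    show "expectation (\<lambda>\<omega>. (?X l \<omega>)\<^sup>2) \<le> h" unfolding four by (rule z_fourth[OF l dn])
  qed (simp_all add: h)
  moreover have "(\<Sum>l\<in>{1..n}. ?X l \<omega>) \<le> card {1..n} / 2
     \<longleftrightarrow> (\<Sum>l\<in>{1..n}. (dot {..<m} g (\<lambda>i. z l i \<omega>))\<^sup>2) \<le> n / 2 * N" for \<omega>
    unfolding X sum_divide_distrib[symmetric] using N by (simp add: field_simps)
  ultimately show ?thesis by (simp add: N_def)
qed

text \<open>The favourable event, cut out by finitely many inequalities so that it is measurable. The mesh
  \<open>1 / n\<^sup>2\<close> of the grid is fine enough for the bound \<open>n\<^sup>2 m\<close> on the trace, which exceeds its mean \<open>n m\<close> by the
  factor \<open>n\<close>.\<close>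

definition good :: "real \<Rightarrow> 'a set" where
  "good s = {\<omega> \<in> space M. trace \<omega> < real n ^ 2 * m \<and> W \<omega> < real n * s
     \<and> \<bar>(\<Sum>l\<in>{1..n}. (e l \<omega>)\<^sup>2) - n * \<sigma>\<^sup>2\<bar> < n * \<sigma>\<^sup>2 / 2
     \<and> (\<forall>g\<in>{g \<in> grid m (n\<^sup>2). dot {..<m} g g > 0}.
          n / 2 * dot {..<m} g g < (\<Sum>l\<in>{1..n}. (dot {..<m} g (\<lambda>i. z l i \<omega>))\<^sup>2))}"

lemma prob_good:
  assumes s: "s > 0"
  shows "good s \<in> events"
    and "1 - (1 / n + m * \<sigma>\<^sup>2 / s + 8 / n + (2 * real n ^ 2 + 1) ^ m * exp (- real n / (8 * h))) \<le> prob (good s)"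
proof -
  have zm [measurable]: "(\<lambda>\<omega>. dot {..<m} d (\<lambda>i. z l i \<omega>)) \<in> borel_measurable M" if "l \<in> {1..n}" for l d
    unfolding dot_def using that z_meas by (intro borel_measurable_sum borel_measurable_times) auto
  have em [measurable]: "e l \<in> borel_measurable M" if "l \<in> {1..n}" for l by (rule e_meas[OF that])
  have tm [measurable]: "trace \<in> borel_measurable M"
    unfolding trace_def[abs_def] dot_def using z_meas
    by (intro borel_measurable_sum borel_measurable_times) auto
  have Wm [measurable]: "W \<in> borel_measurable M"
    unfolding W_def[abs_def] using z_meas e_meas
    by (intro borel_measurable_sum borel_measurable_times borel_measurable_power) auto
  have Sm [measurable]: "(\<lambda>\<omega>. \<Sum>l\<in>{1..n}. (e l \<omega>)\<^sup>2) \<in> borel_measurable M"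
    using e_meas by (intro borel_measurable_sum borel_measurable_power) auto
  have Qm [measurable]: "(\<lambda>\<omega>. \<Sum>l\<in>{1..n}. (dot {..<m} g (\<lambda>i. z l i \<omega>))\<^sup>2) \<in> borel_measurable M" for g
    using zm by (intro borel_measurable_sum borel_measurable_power) auto
  let ?G = "{g \<in> grid m (n\<^sup>2). dot {..<m} g g > 0}"
  have fG [measurable]: "finite ?G" using finite_grid by simp
  define A1 where "A1 = {\<omega> \<in> space M. real n ^ 2 * m \<le> trace \<omega>}"
  define A2 where "A2 = {\<omega> \<in> space M. real n * s \<le> W \<omega>}"
  define A3 where "A3 = {\<omega> \<in> space M. n * \<sigma>\<^sup>2 / 2 \<le> \<bar>(\<Sum>l\<in>{1..n}. (e l \<omega>)\<^sup>2) - n * \<sigma>\<^sup>2\<bar>}"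
  define B where "B g = {\<omega> \<in> space M. (\<Sum>l\<in>{1..n}. (dot {..<m} g (\<lambda>i. z l i \<omega>))\<^sup>2) \<le> n / 2 * dot {..<m} g g}" for g
  have ev: "A1 \<in> events" "A2 \<in> events" "A3 \<in> events" "\<And>g. B g \<in> events"
    unfolding A1_def A2_def A3_def B_def by measurable
  have evB: "(\<Union>g\<in>?G. B g) \<in> events" using ev(4) fG by (intro sets.finite_UN) auto
  have good_eq: "good s = space M - (A1 \<union> A2 \<union> A3 \<union> (\<Union>g\<in>?G. B g))"
    unfolding good_def A1_def A2_def A3_def B_def by (auto simp: not_le)
  show "good s \<in> events" unfolding good_eq using ev evB by auto
  have "prob (\<Union>g\<in>?G. B g) \<le> (\<Sum>g\<in>?G. prob (B g))"
    using ev(4) by (intro finite_measure_subadditive_finite fG) auto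
  also have "\<dots> \<le> (\<Sum>g\<in>?G. exp (- real n / (8 * h)))"
    unfolding B_def by (intro sum_mono direction_lower_tail) auto
  also have "\<dots> = card ?G * exp (- real n / (8 * h))" by simp
  also have "\<dots> \<le> (2 * real n ^ 2 + 1) ^ m * exp (- real n / (8 * h))"
  proof (rule mult_right_mono)
    have "real (card ?G) \<le> real (card (grid m (n\<^sup>2)))" by (intro of_nat_mono card_mono finite_grid) auto
    also have "\<dots> \<le> (2 * real n ^ 2 + 1) ^ m" using card_grid_le[of m "n\<^sup>2"] by simp
    finally show "real (card ?G) \<le> (2 * real n ^ 2 + 1) ^ m" .
  qed simp
  finally have B: "prob (\<Union>g\<in>?G. B g) \<le> (2 * real n ^ 2 + 1) ^ m * exp (- real n / (8 * h))" .
  have "prob (A1 \<union> A2 \<union> A3 \<union> (\<Union>g\<in>?G. B g)) \<le> prob A1 + prob A2 + prob A3 + prob (\<Union>g\<in>?G. B g)"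
    using ev evB by (intro order.trans[OF measure_Un_le] add_right_mono) auto
  moreover have "prob A1 \<le> 1 / n" unfolding A1_def by (rule trace_markov)
  moreover have "prob A2 \<le> m * \<sigma>\<^sup>2 / s" unfolding A2_def by (rule W_markov[OF s])
  moreover have "prob A3 \<le> 8 / n" unfolding A3_def by (rule noise_deviation)
  moreover have "prob (good s) = 1 - prob (A1 \<union> A2 \<union> A3 \<union> (\<Union>g\<in>?G. B g))"
    unfolding good_eq using ev evB by (intro prob_compl) auto
  ultimately show "1 - (1 / n + m * \<sigma>\<^sup>2 / s + 8 / n + (2 * real n ^ 2 + 1) ^ m * exp (- real n / (8 * h))) \<le> prob (good s)"
    using B by linarith
qed

lemma goodD:
  assumes "\<omega> \<in> good s"
  shows "n / 32 * dot {..<m} d d \<le> (\<Sum>l\<in>{1..n}. (dot {..<m} d (\<lambda>i. z l i \<omega>))\<^sup>2)"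
    and "(\<Sum>l\<in>{1..n}. dot {..<m} d (\<lambda>i. z l i \<omega>) * e l \<omega>)\<^sup>2 \<le> (real n * s) * dot {..<m} d d"
    and "n * \<sigma>\<^sup>2 / 2 \<le> (\<Sum>l\<in>{1..n}. (e l \<omega>)\<^sup>2)" "(\<Sum>l\<in>{1..n}. (e l \<omega>)\<^sup>2) \<le> 2 * \<sigma>\<^sup>2 * n"
proof -
  have N: "real m / real (n\<^sup>2) ^ 2 \<le> 1 / real n ^ 3"
  proof -
    have "real m / real (n\<^sup>2) ^ 2 \<le> real n / real (n\<^sup>2) ^ 2" using m_less by (intro divide_right_mono) auto
    also have "\<dots> = 1 / real n ^ 3" using n_large by (simp add: field_simps power2_eq_square power3_eq_cube)
    finally show ?thesis .
  qed
  have "(n / 2) / 16 * dot {..<m} d d \<le> (\<Sum>l\<in>{1..n}. (dot {..<m} d (\<lambda>i. z l i \<omega>))\<^sup>2)"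
  proof (rule quadratic_form_lower_from_grid[where N = "n\<^sup>2" and T = "real n ^ 2 * m"])
    show "(\<Sum>l\<in>{1..n}. dot {..<m} (\<lambda>i. z l i \<omega>) (\<lambda>i. z l i \<omega>)) \<le> real n ^ 2 * m"
      using assms by (simp add: good_def trace_def)
    show "n / 2 * dot {..<m} g g \<le> (\<Sum>l\<in>{1..n}. (dot {..<m} g (\<lambda>i. z l i \<omega>))\<^sup>2)"
      if "g \<in> grid m (n\<^sup>2)" "dot {..<m} g g > 0" for g
      using assms that unfolding good_def by fastforce
    have n1: "(1 :: real) \<le> real n" "32 \<le> real n" using n_large by auto
    have "4 \<le> real n ^ 1" using n1 by simp
    also have "\<dots> \<le> real n ^ 3" using n1 by (intro power_increasing) auto
    finally have "1 / real n ^ 3 \<le> 1 / 4" using n_large by (intro divide_left_mono) auto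
    then show "real m / real (n\<^sup>2) ^ 2 \<le> 1 / 4" using N by linarith
    have "real n ^ 2 * m * (real m / real (n\<^sup>2) ^ 2) \<le> real n ^ 2 * n * (1 / real n ^ 3)"
      using m_less N by (intro mult_mono) auto
    also have "\<dots> = 1" using n_large by (simp add: power2_eq_square power3_eq_cube)
    finally show "real n ^ 2 * m * (real m / real (n\<^sup>2) ^ 2) \<le> n / 2 / 16" using n1 by linarith
  qed (use n_large in auto)
  then show "n / 32 * dot {..<m} d d \<le> (\<Sum>l\<in>{1..n}. (dot {..<m} d (\<lambda>i. z l i \<omega>))\<^sup>2)" by simp
  have "W \<omega> * dot {..<m} d d \<le> (real n * s) * dot {..<m} d d"
    using assms by (intro mult_right_mono) (auto simp: good_def dot_self_nonneg)
  then show "(\<Sum>l\<in>{1..n}. dot {..<m} d (\<lambda>i. z l i \<omega>) * e l \<omega>)\<^sup>2 \<le> (real n * s) * dot {..<m} d d"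
    using cross_term_le_W[of d \<omega>] by linarith
  have "\<bar>(\<Sum>l\<in>{1..n}. (e l \<omega>)\<^sup>2) - n * \<sigma>\<^sup>2\<bar> < n * \<sigma>\<^sup>2 / 2" using assms by (simp add: good_def)
  moreover have "n * \<sigma>\<^sup>2 \<ge> 0" "2 * \<sigma>\<^sup>2 * n = 2 * (n * \<sigma>\<^sup>2)" by simp_all
  ultimately show "n * \<sigma>\<^sup>2 / 2 \<le> (\<Sum>l\<in>{1..n}. (e l \<omega>)\<^sup>2)" "(\<Sum>l\<in>{1..n}. (e l \<omega>)\<^sup>2) \<le> 2 * \<sigma>\<^sup>2 * n"
    by linarith+
qed

end

section \<open>The random design in whitened coordinates\<close>

text \<open>Otherwise simplification rewrites the index sets \<open>{1..n}\<close> of the rows to \<open>{Suc 0..n}\<close>.\<close>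

declare One_nat_def [simp del]

lemma vec_index_subvec:
  "i < m \<Longrightarrow> vec_index (subvec {1..m} u) i = u (Suc i)"
  "dim_vec (subvec {1..m} u) = m"
proof -
  have "sorted_list_of_set {1..m} = [1..<Suc m]"
    by (simp add: atLeastLessThanSuc_atLeastAtMost[symmetric] del: upt_Suc)
  then show "i < m \<Longrightarrow> vec_index (subvec {1..m} u) i = u (Suc i)" "dim_vec (subvec {1..m} u) = m"
    by (simp_all add: subvec_def vec_of_list_index One_nat_def del: upt_Suc)
qed

lemma subvec_eq_vec: "subvec {1..m} u = Matrix.vec m (\<lambda>i. u (Suc i))"
  by (intro eq_vecI) (simp_all add: vec_index_subvec)

lemma gram_carrier: "gram Q {1..m} u \<in> carrier_mat m m"
  by (simp add: gram_def second_moment_mat_def)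

lemma gram_index:
  "i < m \<Longrightarrow> j < m \<Longrightarrow> gram Q {1..m} u $$ (i, j) = (\<integral>\<omega>. u (Suc i) \<omega> * u (Suc j) \<omega> \<partial>Q)"
  by (simp add: gram_def second_moment_mat_def vec_index_subvec)

context random_design_regression
begin

context
  fixes n :: nat
  assumes n1: "n \<ge> 1"
begin

interpretation prob_space "P n" by (rule prob_space[OF n1])

abbreviation "m \<equiv> M n"
abbreviation "rowspace \<equiv> PiM {1..m} (\<lambda>i. borel :: real measure)"

definition design_row :: "nat \<Rightarrow> 'a \<Rightarrow> nat \<Rightarrow> real" where
  "design_row l \<omega> = (\<lambda>i\<in>{1..m}. x n l i \<omega>)"

lemma design_row_measurable: "l \<in> {1..n} \<Longrightarrow> design_row l \<in> measurable (P n) rowspace"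
  using rows_indep[OF n1] unfolding design_row_def[abs_def] by (auto simp: indep_vars_def)

lemma x_measurable:
  assumes "l \<in> {1..n}" "i \<in> {1..m}"
  shows "x n l i \<in> borel_measurable (P n)"
proof -
  have "(\<lambda>\<omega>. design_row l \<omega> i) \<in> borel_measurable (P n)"
    by (rule measurable_compose[OF design_row_measurable[OF assms(1)] measurable_component_singleton[OF assms(2)]])
  then show ?thesis using assms(2) by (simp add: design_row_def)
qed

text \<open>All rows have the law of the first one, in terms of which the second moment matrix and the moment
  bound are stated.\<close>

lemma rows_transfer:
  fixes f :: "(nat \<Rightarrow> real) \<Rightarrow> real"
  assumes l: "l \<in> {1..n}" and f: "f \<in> borel_measurable rowspace"
  shows "integrable (P n) (\<lambda>\<omega>. f (design_row l \<omega>)) \<longleftrightarrow> integrable (P n) (\<lambda>\<omega>. f (design_row 1 \<omega>))"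
    and "expectation (\<lambda>\<omega>. f (design_row l \<omega>)) = expectation (\<lambda>\<omega>. f (design_row 1 \<omega>))"
proof -
  have eq: "distr (P n) rowspace (design_row l) = distr (P n) rowspace (design_row 1)"
    using rows_ident[OF n1 l] unfolding design_row_def[abs_def] .
  have l1: "1 \<in> {1..n}" using n1 by simp
  show "integrable (P n) (\<lambda>\<omega>. f (design_row l \<omega>)) \<longleftrightarrow> integrable (P n) (\<lambda>\<omega>. f (design_row 1 \<omega>))"
    using integrable_distr_eq[OF design_row_measurable[OF l] f] integrable_distr_eq[OF design_row_measurable[OF l1] f] eq by simp
  show "expectation (\<lambda>\<omega>. f (design_row l \<omega>)) = expectation (\<lambda>\<omega>. f (design_row 1 \<omega>))"
    using integral_distr[OF design_row_measurable[OF l] f] integral_distr[OF design_row_measurable[OF l1] f] eq by simp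
qed

text \<open>Independence of design and noise is given as independence of generated sigma-algebras; real
  functions of the two generate smaller ones.\<close>

lemma indep_product_noise:
  assumes g: "g \<in> borel_measurable (PiM {1..n} (\<lambda>l. rowspace))"
    and f: "f \<in> borel_measurable (PiM {1..n} (\<lambda>l. borel))"
  shows "indep_var borel (\<lambda>\<omega>. g (\<lambda>l\<in>{1..n}. design_row l \<omega>) :: real) borel (\<lambda>\<omega>. f (\<lambda>l\<in>{1..n}. eps n l \<omega>) :: real)"
proof -
  let ?X = "\<lambda>\<omega>. \<lambda>l\<in>{1..n}. design_row l \<omega>" and ?E = "\<lambda>\<omega>. \<lambda>l\<in>{1..n}. eps n l \<omega>"
  let ?VX = "vimage_algebra (space (P n)) ?X (PiM {1..n} (\<lambda>l. rowspace))"
  let ?VE = "vimage_algebra (space (P n)) ?E (PiM {1..n} (\<lambda>l. borel))"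
  have ind: "indep_set (sets ?VX) (sets ?VE)"
    using eps_indep_x[OF n1] unfolding design_row_def[abs_def] .
  have sub: "sets ?VX \<subseteq> events" "sets ?VE \<subseteq> events" using ind by (auto simp: indep_sets2_eq)
  have "?X \<in> measurable ?VX (PiM {1..n} (\<lambda>l. rowspace))"
    using design_row_measurable by (intro measurable_vimage_algebra1) (auto simp: space_PiM design_row_def)
  then have gX: "(\<lambda>\<omega>. g (?X \<omega>)) \<in> borel_measurable ?VX" by (rule measurable_compose[OF _ g])
  have "?E \<in> measurable ?VE (PiM {1..n} (\<lambda>l. borel))"
    by (intro measurable_vimage_algebra1) (auto simp: space_PiM)
  then have fE: "(\<lambda>\<omega>. f (?E \<omega>)) \<in> borel_measurable ?VE" by (rule measurable_compose[OF _ f])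
  have ms: "h \<in> borel_measurable (P n)" if "h \<in> borel_measurable V" "sets V \<subseteq> events" "space V = space (P n)"
    for V and h :: "'a \<Rightarrow> real"
    using that by (auto simp: measurable_def)
  have sg: "sigma_sets (space (P n)) {h -` A \<inter> space (P n) |A. A \<in> sets borel} \<subseteq> sets V"
    if "h \<in> borel_measurable V" "space V = space (P n)" for V and h :: "'a \<Rightarrow> real"
    using that by (subst that(2)[symmetric], intro sets.sigma_sets_subset) (auto simp: measurable_def)
  show ?thesis unfolding indep_var_eq
  proof (intro conjI)
    show "random_variable borel (\<lambda>\<omega>. g (?X \<omega>))" by (rule ms[OF gX sub(1)]) simp
    show "random_variable borel (\<lambda>\<omega>. f (?E \<omega>))" by (rule ms[OF fE sub(2)]) simp
    have "sigma_sets (space (P n)) {(\<lambda>\<omega>. g (?X \<omega>)) -` A \<inter> space (P n) |A. A \<in> sets borel} \<subseteq> sets ?VX"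
      using gX by (intro sg) auto
    moreover have "sigma_sets (space (P n)) {(\<lambda>\<omega>. f (?E \<omega>)) -` A \<inter> space (P n) |A. A \<in> sets borel} \<subseteq> sets ?VE"
      using fE by (intro sg) auto
    ultimately show "indep_set (sigma_sets (space (P n)) {(\<lambda>\<omega>. g (?X \<omega>)) -` A \<inter> space (P n) |A. A \<in> sets borel})
     (sigma_sets (space (P n)) {(\<lambda>\<omega>. f (?E \<omega>)) -` A \<inter> space (P n) |A. A \<in> sets borel})"
      using ind unfolding indep_sets2_eq by (meson order_trans subsetD)
  qed
qed

lemma eps_measurable:
  assumes "l \<in> {1..n}"
  shows "eps n l \<in> borel_measurable (P n)"
proof -
  have "indep_var borel (\<lambda>\<omega>. 0) borel (\<lambda>\<omega>. (\<lambda>l\<in>{1..n}. eps n l \<omega>) l)"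
    by (rule indep_product_noise[of "\<lambda>_. 0" "\<lambda>v. v l"]) (use assms in auto)
  then show ?thesis using assms by (simp add: indep_var_eq)
qed

abbreviation "noise_law \<equiv> density lborel (\<lambda>u. ennreal (normal_density 0 \<sigma> u))"

lemma eps_distr:
  assumes "l \<in> {1..n}"
  shows "distr (P n) borel (eps n l) = noise_law"
proof -
  let ?E = "\<lambda>\<omega>. \<lambda>l\<in>{1..n}. eps n l \<omega>"
  have E: "?E \<in> measurable (P n) (PiM {1..n} (\<lambda>l. borel))"
    using eps_measurable by (intro measurable_restrict) auto
  have nl: "prob_space noise_law" by (rule prob_space_normal_density[OF sigma_pos])
  have "distr (P n) borel (eps n l) = distr (P n) borel ((\<lambda>v. v l) \<circ> ?E)"
    using assms by (simp add: comp_def)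
  also have "\<dots> = distr (distr (P n) (PiM {1..n} (\<lambda>l. borel)) ?E) borel (\<lambda>v. v l)"
    using E assms by (intro distr_distr[symmetric]) auto
  also have "\<dots> = distr (PiM {1..n} (\<lambda>l. noise_law)) borel (\<lambda>v. v l)"
    using normal_eps[OF n1] by simp
  also have "\<dots> = distr (PiM {1..n} (\<lambda>l. noise_law)) noise_law (\<lambda>v. v l)"
    by (intro distr_cong) auto
  also have "\<dots> = noise_law" by (rule distr_PiM_component[OF nl assms])
  finally show ?thesis .
qed

lemma eps_indep: "indep_vars (\<lambda>_. borel) (eps n) {1..n}"
proof -
  have "distr (P n) (PiM {1..n} (\<lambda>l. borel)) (\<lambda>\<omega>. \<lambda>l\<in>{1..n}. eps n l \<omega>) = PiM {1..n} (\<lambda>l. distr (P n) borel (eps n l))"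
    unfolding normal_eps[OF n1] by (rule PiM_cong) (simp_all add: eps_distr)
  then show ?thesis using n1 eps_measurable by (subst indep_vars_iff_distr_eq_PiM') auto
qed

context
  fixes u :: "nat \<Rightarrow> nat \<Rightarrow> real" and lam :: "nat \<Rightarrow> real" and C :: real and r :: nat
  assumes on: "orthonormal m m u" and A: "gram (P n) {1..m} (x n 1) = spectral_mat m u lam"
    and lam: "\<And>i. i < m \<Longrightarrow> lam i > 0" and C: "C \<ge> 0" and r: "r \<ge> 1"
    and moment: "\<And>w. dot {..<m} w w = 1 \<Longrightarrow>
      (\<integral>\<^sup>+\<omega>. ennreal (\<bar>scalar_prod (Matrix.vec m w) (standardized_row (P n) m (x n 1) \<omega>)\<bar> ^ (4 * r)) \<partial>P n) \<le> ennreal C"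
    and size: "32 \<le> n" "0 < m" "m < n"
begin

text \<open>Coordinates of a row with respect to the eigenbasis \<open>u\<close>, rescaled to unit second moment. Rows are
  indexed from 1 and matrices from 0, hence the shift.\<close>

definition coords :: "(nat \<Rightarrow> real) \<Rightarrow> nat \<Rightarrow> real" where
  "coords v i = dot {..<m} (\<lambda>k. v (Suc k)) (u i) / sqrt (lam i)"

definition whitened :: "nat \<Rightarrow> nat \<Rightarrow> 'a \<Rightarrow> real" where
  "whitened l i \<omega> = coords (\<lambda>k. x n l k \<omega>) i"

lemma whitened_eq_coords: "whitened l i \<omega> = coords (design_row l \<omega>) i"
  unfolding whitened_def coords_def by (intro arg_cong2[where f = "(/)"] dot_cong) (auto simp: design_row_def)

lemma coords_measurable [measurable]: "(\<lambda>v. coords v i) \<in> borel_measurable rowspace"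
  unfolding coords_def dot_def by measurable

lemma whitened_measurable: "l \<in> {1..n} \<Longrightarrow> whitened l i \<in> borel_measurable (P n)"
  unfolding whitened_eq_coords[abs_def] by (rule measurable_compose[OF design_row_measurable coords_measurable])

lemma xx_integrable:
  assumes "l \<in> {1..n}" "i < m" "j < m"
  shows "integrable (P n) (\<lambda>\<omega>. x n l (Suc i) \<omega> * x n l (Suc j) \<omega>)"
  using assms by (intro integrable_product_of_squares x_measurable second_moments n1) auto

lemma gram_mat_app: "j < m \<Longrightarrow> k < m \<Longrightarrow> (\<Sum>l<m. expectation (\<lambda>\<omega>. x n 1 (Suc k) \<omega> * x n 1 (Suc l) \<omega>) * u j l) = lam j * u j k"
proof -
  assume jk: "j < m" "k < m"
  have "(\<Sum>l<m. expectation (\<lambda>\<omega>. x n 1 (Suc k) \<omega> * x n 1 (Suc l) \<omega>) * u j l)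
     = mat_app m (\<lambda>k l. spectral_mat m u lam $$ (k, l)) (u j) k"
    unfolding mat_app_def A[symmetric] using jk by (intro sum.cong) (auto simp: gram_index)
  also have "\<dots> = (\<Sum>i<m. lam i * dot {..<m} (u j) (u i) * u i k)" by (rule mat_app_spectral_mat[OF jk(2)])
  also have "\<dots> = (\<Sum>i<m. if i = j then lam i * u i k else 0)"
    using on jk by (intro sum.cong) (auto simp: orthonormal_def)
  finally show "(\<Sum>l<m. expectation (\<lambda>\<omega>. x n 1 (Suc k) \<omega> * x n 1 (Suc l) \<omega>) * u j l) = lam j * u j k"
    using jk by simp
qed

lemma whitened_product:
  "whitened l i \<omega> * whitened l j \<omega> = (\<Sum>k<m. \<Sum>k'<m. u i k * u j k' / (sqrt (lam i) * sqrt (lam j)) * (x n l (Suc k) \<omega> * x n l (Suc k') \<omega>))"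
  by (simp add: whitened_def coords_def dot_def sum_product sum_divide_distrib mult_ac)

lemma whitened_white1:
  assumes "i < m" "j < m"
  shows "integrable (P n) (\<lambda>\<omega>. whitened 1 i \<omega> * whitened 1 j \<omega>)"
    "expectation (\<lambda>\<omega>. whitened 1 i \<omega> * whitened 1 j \<omega>) = (if i = j then 1 else 0)"
proof -
  have l1: "1 \<in> {1..n}" using n1 by simp
  show "integrable (P n) (\<lambda>\<omega>. whitened 1 i \<omega> * whitened 1 j \<omega>)" unfolding whitened_product
    by (intro Bochner_Integration.integrable_sum integrable_mult_right xx_integrable l1) auto
  let ?E = "\<lambda>k k'. expectation (\<lambda>\<omega>. x n 1 (Suc k) \<omega> * x n 1 (Suc k') \<omega>)"
  have "expectation (\<lambda>\<omega>. whitened 1 i \<omega> * whitened 1 j \<omega>)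
    = (\<Sum>k<m. expectation (\<lambda>\<omega>. \<Sum>k'<m. u i k * u j k' / (sqrt (lam i) * sqrt (lam j)) * (x n 1 (Suc k) \<omega> * x n 1 (Suc k') \<omega>)))"
    unfolding whitened_product
    by (intro Bochner_Integration.integral_sum Bochner_Integration.integrable_sum integrable_mult_right xx_integrable l1) auto
  also have "\<dots> = (\<Sum>k<m. \<Sum>k'<m. expectation (\<lambda>\<omega>. u i k * u j k' / (sqrt (lam i) * sqrt (lam j)) * (x n 1 (Suc k) \<omega> * x n 1 (Suc k') \<omega>)))"
    by (intro sum.cong refl Bochner_Integration.integral_sum integrable_mult_right xx_integrable l1) auto
  also have "\<dots> = (\<Sum>k<m. u i k / (sqrt (lam i) * sqrt (lam j)) * (\<Sum>k'<m. ?E k k' * u j k'))"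
    by (simp add: sum_distrib_left mult_ac)
  also have "\<dots> = (\<Sum>k<m. u i k / (sqrt (lam i) * sqrt (lam j)) * (lam j * u j k))"
    using gram_mat_app assms by simp
  also have "\<dots> = lam j / (sqrt (lam i) * sqrt (lam j)) * dot {..<m} (u i) (u j)"
    by (simp add: dot_def sum_distrib_left mult_ac)
  also have "\<dots> = (if i = j then 1 else 0)"
    using on assms lam[OF assms(1)] by (auto simp: orthonormal_def)
  finally show "expectation (\<lambda>\<omega>. whitened 1 i \<omega> * whitened 1 j \<omega>) = (if i = j then 1 else 0)" .
qed

lemma whitened_white:
  assumes "l \<in> {1..n}" "i < m" "j < m"
  shows "integrable (P n) (\<lambda>\<omega>. whitened l i \<omega> * whitened l j \<omega>)"
    "expectation (\<lambda>\<omega>. whitened l i \<omega> * whitened l j \<omega>) = (if i = j then 1 else 0)"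
proof -
  have "(\<lambda>v. coords v i * coords v j) \<in> borel_measurable rowspace" by measurable
  note tr = rows_transfer[OF assms(1) this]
  show "integrable (P n) (\<lambda>\<omega>. whitened l i \<omega> * whitened l j \<omega>)"
    using tr(1) whitened_white1(1)[OF assms(2,3)] by (simp add: whitened_eq_coords)
  show "expectation (\<lambda>\<omega>. whitened l i \<omega> * whitened l j \<omega>) = (if i = j then 1 else 0)"
    using tr(2) whitened_white1(2)[OF assms(2,3)] by (simp add: whitened_eq_coords)
qed

text \<open>The standardised row \<open>A\<^sup>-\<^sup>1\<^sup>/\<^sup>2 x\<close> and the coordinates used here differ by the rotation \<open>d \<mapsto> \<Sum>\<^sub>i d\<^sub>i u\<^sub>i\<close>,
  so moment bounds that are uniform over unit vectors are the same for both.\<close>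

lemma dot_whitened_standardized:
  defines "w d \<equiv> \<lambda>k. \<Sum>i<m. d i * u i k"
  shows "dot {..<m} d (\<lambda>i. whitened 1 i \<omega>) = scalar_prod (Matrix.vec m (w d)) (standardized_row (P n) m (x n 1) \<omega>)"
    and "dot {..<m} (w d) (w d) = dot {..<m} d d"
proof -
  have wu: "dot {..<m} (w d) (u i) = d i" if "i < m" for i
  proof -
    have "dot {..<m} (w d) (u i) = (\<Sum>j<m. d j * dot {..<m} (u j) (u i))"
      unfolding w_def by (simp only: dot_sum_left dot_scale_left)
    also have "\<dots> = (\<Sum>j<m. if j = i then d j else 0)"
      using on that by (intro sum.cong) (auto simp: orthonormal_def)
    finally show ?thesis using that by simp
  qed
  show "dot {..<m} (w d) (w d) = dot {..<m} d d"
    using wu by (subst orthonormal_basis_parseval[OF on]) (simp add: dot_def)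
  let ?X = "\<lambda>k. x n 1 (Suc k) \<omega>"
  have "inv_sqrt_mat (gram (P n) {1..m} (x n 1)) = spectral_mat m u (\<lambda>i. 1 / sqrt (lam i))"
    unfolding A by (rule inv_sqrt_mat_spectral[OF on lam])
  then have "standardized_row (P n) m (x n 1) \<omega>
     = Matrix.vec m (mat_app m (\<lambda>k l. spectral_mat m u (\<lambda>i. 1 / sqrt (lam i)) $$ (k, l)) ?X)"
    by (simp add: standardized_row_def subvec_eq_vec mult_mat_vec_mat_app[OF spectral_mat_carrier])
  then have "scalar_prod (Matrix.vec m (w d)) (standardized_row (P n) m (x n 1) \<omega>)
     = dot {..<m} (w d) (mat_app m (\<lambda>k l. spectral_mat m u (\<lambda>i. 1 / sqrt (lam i)) $$ (k, l)) ?X)"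
    by (simp add: scalar_prod_vec_dot)
  also have "\<dots> = dot {..<m} (w d) (\<lambda>k. \<Sum>i<m. 1 / sqrt (lam i) * dot {..<m} ?X (u i) * u i k)"
    by (intro dot_cong) (simp_all add: mat_app_spectral_mat)
  also have "\<dots> = (\<Sum>i<m. 1 / sqrt (lam i) * dot {..<m} ?X (u i) * dot {..<m} (w d) (u i))"
    by (simp only: dot_sum_right dot_scale_right)
  also have "\<dots> = dot {..<m} d (\<lambda>i. whitened 1 i \<omega>)"
    unfolding dot_def[of _ d] by (intro sum.cong) (simp_all add: wu whitened_def coords_def)
  finally show "dot {..<m} d (\<lambda>i. whitened 1 i \<omega>) = scalar_prod (Matrix.vec m (w d)) (standardized_row (P n) m (x n 1) \<omega>)" ..
qed

text \<open>On a probability space the moment of order \<open>4 r\<close> controls the fourth moment, as \<open>y\<^sup>4 \<le> 1 + |y| ^ (4 r)\<close>.\<close>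

lemma whitened_fourth:
  assumes l: "l \<in> {1..n}" and d: "dot {..<m} d d = 1"
  shows "integrable (P n) (\<lambda>\<omega>. (dot {..<m} d (\<lambda>i. whitened l i \<omega>)) ^ 4)"
    "expectation (\<lambda>\<omega>. (dot {..<m} d (\<lambda>i. whitened l i \<omega>)) ^ 4) \<le> 1 + C"
proof -
  have l1: "1 \<in> {1..n}" using n1 by simp
  let ?f = "\<lambda>\<omega>. (dot {..<m} d (\<lambda>i. whitened 1 i \<omega>)) ^ 4"
  have meas: "?f \<in> borel_measurable (P n)"
    unfolding dot_def using whitened_measurable[OF l1]
    by (intro borel_measurable_power borel_measurable_sum borel_measurable_times) auto
  let ?g = "\<lambda>\<omega>. \<bar>dot {..<m} d (\<lambda>i. whitened 1 i \<omega>)\<bar> ^ (4 * r)"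
  have meas': "?g \<in> borel_measurable (P n)"
    unfolding dot_def using whitened_measurable[OF l1]
    by (intro borel_measurable_power borel_measurable_abs borel_measurable_sum borel_measurable_times) auto
  have power_le: "y ^ 4 \<le> 1 + \<bar>y\<bar> ^ (4 * r)" for y :: real
  proof (cases "\<bar>y\<bar> \<le> 1")
    case True
    then have "\<bar>y\<bar> ^ 4 \<le> 1" by (intro power_le_one) auto
    moreover have "0 \<le> \<bar>y\<bar> ^ (4 * r)" by simp
    ultimately show ?thesis by (simp add: power_even_abs)
  next
    case False
    then have "\<bar>y\<bar> ^ 4 \<le> \<bar>y\<bar> ^ (4 * r)" using r by (intro power_increasing) auto
    then show ?thesis by (simp add: power_even_abs)
  qed
  have "(\<integral>\<^sup>+\<omega>. ennreal (?f \<omega>) \<partial>P n) \<le> (\<integral>\<^sup>+\<omega>. 1 + ennreal (?g \<omega>) \<partial>P n)"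
    using power_le by (intro nn_integral_mono) (auto simp: ennreal_plus[symmetric] simp flip: ennreal_1 simp del: ennreal_plus)
  also have "\<dots> = 1 + (\<integral>\<^sup>+\<omega>. ennreal (?g \<omega>) \<partial>P n)"
    using meas' by (subst nn_integral_add) (auto simp: emeasure_space_1)
  also have "(\<integral>\<^sup>+\<omega>. ennreal (?g \<omega>) \<partial>P n) \<le> ennreal C"
    unfolding dot_whitened_standardized(1) by (rule moment) (use dot_whitened_standardized(2) d in simp)
  also have "1 + ennreal C = ennreal (1 + C)" using C by (simp add: ennreal_plus)
  finally have bound: "(\<integral>\<^sup>+\<omega>. ennreal (?f \<omega>) \<partial>P n) \<le> ennreal (1 + C)" by simp
  have i: "integrable (P n) ?f"
  proof (rule integrableI_nonneg[OF meas])
    show "(\<integral>\<^sup>+\<omega>. ennreal (?f \<omega>) \<partial>P n) < \<infinity>" by (rule le_less_trans[OF bound]) simp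
  qed simp
  have "ennreal (expectation ?f) \<le> ennreal (1 + C)"
    using bound i by (subst nn_integral_eq_integral[symmetric]) auto
  then have e: "expectation ?f \<le> 1 + C" using C by (subst (asm) ennreal_le_iff) auto
  have "(\<lambda>v. (dot {..<m} d (\<lambda>i. coords v i)) ^ 4) \<in> borel_measurable rowspace"
    unfolding dot_def by measurable
  note tr = rows_transfer[OF l this]
  show "integrable (P n) (\<lambda>\<omega>. (dot {..<m} d (\<lambda>i. whitened l i \<omega>)) ^ 4)" using tr(1) i by (simp add: whitened_eq_coords)
  show "expectation (\<lambda>\<omega>. (dot {..<m} d (\<lambda>i. whitened l i \<omega>)) ^ 4) \<le> 1 + C" using tr(2) e by (simp add: whitened_eq_coords)
qed

lemma whitened_sample_rows: "whitened_sample (P n) n m whitened (eps n) \<sigma> (1 + C)"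
proof unfold_locales
  show "indep_vars (\<lambda>_. borel) (\<lambda>l \<omega>. dot {..<m} d (\<lambda>i. whitened l i \<omega>)) {1..n}" for d
    unfolding whitened_eq_coords
  proof (rule indep_vars_compose2[where X = design_row and M' = "\<lambda>_. rowspace" and Y = "\<lambda>_ v. dot {..<m} d (\<lambda>i. coords v i)"])
    show "indep_vars (\<lambda>_. rowspace) design_row {1..n}"
      using rows_indep[OF n1] unfolding design_row_def[abs_def] .
    show "(\<lambda>v. dot {..<m} d (\<lambda>i. coords v i)) \<in> borel_measurable rowspace"
      unfolding dot_def by measurable
  qed
  show "integrable (P n) (\<lambda>\<omega>. (whitened l i \<omega>)\<^sup>2)" if "l \<in> {1..n}" "i < m" for l i
    using whitened_white(1)[OF that(1,2,2)] by (simp add: power2_eq_square)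
  show "indep_var borel (\<lambda>\<omega>. whitened l i \<omega> * whitened k i \<omega>) borel (\<lambda>\<omega>. eps n l \<omega> * eps n k \<omega>)"
    if "l \<in> {1..n}" "k \<in> {1..n}" "i < m" for l k i
  proof -
    have [measurable]: "l \<in> {1..n}" "k \<in> {1..n}" by (rule that)+
    have "indep_var borel (\<lambda>\<omega>. (\<lambda>r. coords (r l) i * coords (r k) i) (\<lambda>l\<in>{1..n}. design_row l \<omega>))
       borel (\<lambda>\<omega>. (\<lambda>v. v l * v k) (\<lambda>l\<in>{1..n}. eps n l \<omega>))"
    proof (rule indep_product_noise)
      show "(\<lambda>r. coords (r l) i * coords (r k) i) \<in> borel_measurable (PiM {1..n} (\<lambda>l. rowspace))"
        by (intro borel_measurable_times
          measurable_compose[OF measurable_component_singleton[OF that(1)] coords_measurable]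
          measurable_compose[OF measurable_component_singleton[OF that(2)] coords_measurable])
      show "(\<lambda>v. v l * v k :: real) \<in> borel_measurable (PiM {1..n} (\<lambda>l. borel))"
        using measurable_component_singleton[OF that(1), of "\<lambda>_. borel :: real measure"]
          measurable_component_singleton[OF that(2), of "\<lambda>_. borel :: real measure"]
        by (rule borel_measurable_times)
    qed
    then show ?thesis using that by (simp add: whitened_eq_coords)
  qed
qed (use size sigma_pos C whitened_measurable whitened_white whitened_fourth eps_indep eps_distr in auto)

text \<open>The form \<open>b \<mapsto> E (b'x)\<^sup>2\<close>, written in the eigenbasis.\<close>

definition qform :: "(nat \<Rightarrow> real) \<Rightarrow> real" where
  "qform b = (\<Sum>i<m. lam i * (dot {..<m} (\<lambda>k. b (Suc k)) (u i))\<^sup>2)"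

lemma fitted_coords:
  defines "d b \<equiv> \<lambda>i. sqrt (lam i) * dot {..<m} (\<lambda>k. b (Suc k)) (u i)"
  shows "fitted m (\<lambda>l i. x n l i \<omega>) b l = dot {..<m} (d b) (\<lambda>i. whitened l i \<omega>)"
    and "dot {..<m} (d b) (d b) = qform b"
proof -
  have "fitted m (\<lambda>l i. x n l i \<omega>) b l = dot {..<m} (\<lambda>k. b (Suc k)) (\<lambda>k. x n l (Suc k) \<omega>)"
    unfolding fitted_def dot_def by (simp only: One_nat_def sum.atLeast1_atMost_eq)
  also have "\<dots> = (\<Sum>i<m. dot {..<m} (\<lambda>k. b (Suc k)) (u i) * dot {..<m} (\<lambda>k. x n l (Suc k) \<omega>) (u i))"
    by (rule orthonormal_basis_parseval[OF on])
  also have "\<dots> = dot {..<m} (d b) (\<lambda>i. whitened l i \<omega>)"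
    unfolding dot_def[of _ "d b"]
  proof (intro sum.cong refl)
    fix i assume "i \<in> {..<m}"
    then have "sqrt (lam i) > 0" using lam by simp
    then show "dot {..<m} (\<lambda>k. b (Suc k)) (u i) * dot {..<m} (\<lambda>k. x n l (Suc k) \<omega>) (u i) = d b i * whitened l i \<omega>"
      by (simp add: d_def whitened_def coords_def)
  qed
  finally show "fitted m (\<lambda>l i. x n l i \<omega>) b l = dot {..<m} (d b) (\<lambda>i. whitened l i \<omega>)" .
  show "dot {..<m} (d b) (d b) = qform b"
    unfolding dot_def[of _ "d b"] qform_def
  proof (intro sum.cong refl)
    fix i assume "i \<in> {..<m}"
    then have "sqrt (lam i) * sqrt (lam i) = lam i" using lam by (simp add: less_imp_le)
    then show "d b i * d b i = lam i * (dot {..<m} (\<lambda>k. b (Suc k)) (u i))\<^sup>2"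
      by (simp add: d_def power2_eq_square mult_ac)
  qed
qed

lemma qform_lower:
  assumes "\<And>i. i < m \<Longrightarrow> \<kappa> \<le> lam i" "\<kappa> > 0" "i0 \<in> {1..m}"
  shows "\<kappa> * (b i0)\<^sup>2 \<le> qform b"
proof -
  let ?b = "\<lambda>k. b (Suc k)"
  obtain k where k: "i0 = Suc k" "k < m" using assms(3) by (cases i0) auto
  have "(b i0)\<^sup>2 \<le> dot {..<m} ?b ?b"
    unfolding dot_def using k member_le_sum[of k "{..<m}" "\<lambda>k. b (Suc k) * b (Suc k)"]
    by (simp add: power2_eq_square)
  then have "\<kappa> * (b i0)\<^sup>2 \<le> \<kappa> * dot {..<m} ?b ?b" using assms(2) by simp
  also have "\<dots> = (\<Sum>i<m. \<kappa> * (dot {..<m} ?b (u i))\<^sup>2)"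
    by (subst orthonormal_basis_parseval[OF on]) (simp add: sum_distrib_left power2_eq_square)
  also have "\<dots> \<le> qform b" unfolding qform_def using assms(1) by (intro sum_mono mult_right_mono) auto
  finally show ?thesis .
qed

lemma regression_good_event_on_good:
  fixes s :: real
  assumes t: "true_model \<beta> \<subseteq> {1..m}" and s: "s > 0"
    and \<omega>: "\<omega> \<in> whitened_sample.good (P n) n m whitened (eps n) \<sigma> s"
  shows "regression_good_event n m (\<lambda>l i. x n l i \<omega>) (\<lambda>l. eps n l \<omega>) \<beta> qform (1 / 32) (real n * s)"
    and "n * \<sigma>\<^sup>2 / 2 \<le> dot {1..n} (\<lambda>l. eps n l \<omega>) (\<lambda>l. eps n l \<omega>)"
    and "dot {1..n} (\<lambda>l. eps n l \<omega>) (\<lambda>l. eps n l \<omega>) \<le> 2 * \<sigma>\<^sup>2 * n"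
proof -
  interpret S: whitened_sample "P n" n m whitened "eps n" \<sigma> "1 + C" by (rule whitened_sample_rows)
  note good = S.goodD[OF \<omega>]
  show "n * \<sigma>\<^sup>2 / 2 \<le> dot {1..n} (\<lambda>l. eps n l \<omega>) (\<lambda>l. eps n l \<omega>)"
    "dot {1..n} (\<lambda>l. eps n l \<omega>) (\<lambda>l. eps n l \<omega>) \<le> 2 * \<sigma>\<^sup>2 * n"
    using good(3,4) by (simp_all add: dot_def power2_eq_square)
  show "regression_good_event n m (\<lambda>l i. x n l i \<omega>) (\<lambda>l. eps n l \<omega>) \<beta> qform (1 / 32) (real n * s)"
  proof
    show "1 / 32 * n * qform b \<le> dot {1..n} (fitted m (\<lambda>l i. x n l i \<omega>) b) (fitted m (\<lambda>l i. x n l i \<omega>) b)" for b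
      using good(1)[of "\<lambda>i. sqrt (lam i) * dot {..<m} (\<lambda>k. b (Suc k)) (u i)"]
      unfolding fitted_coords(2) dot_def[of "{1..n}"] fitted_coords(1)[symmetric] by (simp add: power2_eq_square)
    show "(dot {1..n} (fitted m (\<lambda>l i. x n l i \<omega>) b) (\<lambda>l. eps n l \<omega>))\<^sup>2 \<le> real n * s * qform b" for b
      using good(2)[of "\<lambda>i. sqrt (lam i) * dot {..<m} (\<lambda>k. b (Suc k)) (u i)"]
      unfolding fitted_coords(2) dot_def[of "{1..n}"] fitted_coords(1)[symmetric] .
    show "0 \<le> qform b" for b unfolding qform_def using lam by (intro sum_nonneg mult_nonneg_nonneg) (auto simp: less_imp_le)
  qed (use t s n1 in auto)
qed

end

end

end

section \<open>Consistency\<close>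

context random_design_regression
begin

text \<open>The bound for a single sample size. Here \<open>s\<close> is free; the loss in the residual sums of squares is
  \<open>32 s\<close>, and the numerical hypotheses are those of \<open>mpvc_choice_is_true_model\<close> with the noise level between
  \<open>\<sigma>\<^sup>2 / 2\<close> and \<open>2 \<sigma>\<^sup>2\<close>.\<close>

lemma mpvc_consistency_bound:
  fixes C \<kappa> qmin s an r :: real and R :: nat and sel :: "'a \<Rightarrow> nat set"
  defines "r \<equiv> qmin / 32 / (8 * \<sigma>\<^sup>2 + qmin / 32)"
  assumes n: "32 \<le> n" "0 < M n" "M n + 2 \<le> n" and t: "true_model \<beta> \<subseteq> {1..M n}"
    and a: "an > 0"
    and eig: "\<kappa> > 0" "min_eigenvalue (gram (P n) {1..M n} (x n 1)) > \<kappa>"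
    and C: "C \<ge> 0" and R: "R \<ge> 1"
    and moment: "\<And>d. d \<in> carrier_vec (M n) \<Longrightarrow> sqrt (scalar_prod d d) = 1 \<Longrightarrow>
      (\<integral>\<^sup>+\<omega>. ennreal (\<bar>scalar_prod d (standardized_row (P n) (M n) (x n 1) \<omega>)\<bar> ^ (4 * R)) \<partial>P n) \<le> ennreal C"
    and qmin: "qmin > 0" "\<And>i. i \<in> true_model \<beta> \<Longrightarrow> qmin \<le> \<kappa> * (\<beta> i)\<^sup>2"
    and s: "s > 0" "256 * s \<le> \<sigma>\<^sup>2 / 2 * n" "256 * s \<le> qmin / 32 * n"
    and small: "256 * s / \<sigma>\<^sup>2 + ln 4 < an"
    and large: "M n / (2 * r) + M n / 2 * ln (2 / r) + (real (card (true_model \<beta>)) + 1) * an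
       \<le> ln ((1 - r / 2) / (1 - r)) * ((real n - real (M n)) / 2 - 1)"
    and sel: "sel \<in> measurable (P n) (count_space (Pow {1..M n}))"
    and choice: "\<And>\<omega>. \<omega> \<in> space (P n) \<Longrightarrow> is_mpvc_choice n (M n) an (\<lambda>l i. x n l i \<omega>)
        (response (M n) \<beta> (\<lambda>l i. x n l i \<omega>) (\<lambda>l. eps n l \<omega>)) (sel \<omega>)"
  shows "1 - (1 / n + M n * \<sigma>\<^sup>2 / s + 8 / n + (2 * real n ^ 2 + 1) ^ M n * exp (- n / (8 * (1 + C))))
    \<le> measure (P n) {\<omega> \<in> space (P n). sel \<omega> = true_model \<beta>}"
proof -
  have n1: "n \<ge> 1" using n by simp
  interpret prob_space "P n" by (rule prob_space[OF n1])
  let ?A = "gram (P n) {1..M n} (x n 1)"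
  have sym: "?A $$ (k, l) = ?A $$ (l, k)" if "k < M n" "l < M n" for k l
    using that by (simp add: gram_index mult.commute)
  obtain u lam where on: "orthonormal (M n) (M n) u" and A: "?A = spectral_mat (M n) u lam"
    and lam0: "\<forall>i<M n. min_eigenvalue ?A \<le> lam i"
    using symmetric_mat_spectral[OF gram_carrier[of "P n" "M n" "x n 1"] sym] by blast
  have lam: "\<kappa> \<le> lam i" "0 < lam i" if "i < M n" for i using lam0 that eig by force+
  have mom: "(\<integral>\<^sup>+\<omega>. ennreal (\<bar>scalar_prod (Matrix.vec (M n) w) (standardized_row (P n) (M n) (x n 1) \<omega>)\<bar> ^ (4 * R)) \<partial>P n) \<le> ennreal C"
    if "dot {..<M n} w w = 1" for w
    using that by (intro moment) (simp_all add: scalar_prod_vec_dot)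
  have mn: "M n < n" using n by simp
  note ctx = n1 on A lam(2) C R mom n(1,2) mn
  interpret S: whitened_sample "P n" n "M n" "whitened n u lam" "eps n" \<sigma> "1 + C"
    by (rule whitened_sample_rows[OF ctx])
  let ?E = "{\<omega> \<in> space (P n). sel \<omega> = true_model \<beta>}"
  have "?E = sel -` {true_model \<beta>} \<inter> space (P n)" by auto
  then have E: "?E \<in> events" using measurable_sets[OF sel, of "{true_model \<beta>}"] t by simp
  have "S.good s \<subseteq> ?E"
  proof
    fix \<omega> assume \<omega>: "\<omega> \<in> S.good s"
    then have sp: "\<omega> \<in> space (P n)" by (simp add: S.good_def)
    interpret G: regression_good_event n "M n" "\<lambda>l i. x n l i \<omega>" "\<lambda>l. eps n l \<omega>" \<beta> "qform n u lam" "1 / 32" "real n * s"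
      by (rule regression_good_event_on_good(1)[OF ctx t s(1) \<omega>])
    note noise = regression_good_event_on_good(2,3)[OF ctx t s(1) \<omega>]
    have n0: "real n > 0" using n by simp
    have loss: "real n * s / (1 / 32 * real n) = 32 * s" using n0 by simp
    have r_eq: "r = 1 / 32 * qmin / (4 * (2 * \<sigma>\<^sup>2) + 1 / 32 * qmin)" by (simp add: r_def)
    have "sel \<omega> = true_model \<beta>"
    proof (rule G.mpvc_choice_is_true_model[OF choice[OF sp] n(3) a _ qmin(1), where v = "\<sigma>\<^sup>2 / 2" and V = "2 * \<sigma>\<^sup>2"])
      show "qmin \<le> qform n u lam b" if "i \<in> true_model \<beta>" "b i = \<beta> i" for i b
      proof -
        have "i \<in> {1..M n}" using that t by blast
        from qform_lower[OF ctx lam(1) eig(1) this, of b] show ?thesis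
          using qmin(2)[OF that(1)] that(2) by simp
      qed
      show "\<sigma>\<^sup>2 / 2 * n \<le> dot {1..n} (\<lambda>l. eps n l \<omega>) (\<lambda>l. eps n l \<omega>)"
        "dot {1..n} (\<lambda>l. eps n l \<omega>) (\<lambda>l. eps n l \<omega>) \<le> 2 * \<sigma>\<^sup>2 * n"
        using noise by (simp_all add: mult.commute)
      show "0 < \<sigma>\<^sup>2 / 2" "0 < real n * s" using sigma_pos s n0 by simp_all
      show "2 * (real n * s / (1 / 32 * real n)) \<le> \<sigma>\<^sup>2 / 2 * n"
        "8 * (real n * s / (1 / 32 * real n)) \<le> \<sigma>\<^sup>2 / 2 * n"
        "8 * (real n * s / (1 / 32 * real n)) \<le> 1 / 32 * n * qmin"
        unfolding loss using s by (auto simp: mult.commute)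
      show "4 * (real n * s / (1 / 32 * real n)) / (\<sigma>\<^sup>2 / 2) + ln 4 < an"
        unfolding loss using small by simp
      show "M n / (2 * (1 / 32 * qmin / (4 * (2 * \<sigma>\<^sup>2) + 1 / 32 * qmin)))
          + M n / 2 * ln (2 / (1 / 32 * qmin / (4 * (2 * \<sigma>\<^sup>2) + 1 / 32 * qmin)))
          + (real (card (true_model \<beta>)) + 1) * an
        \<le> ln ((1 - 1 / 32 * qmin / (4 * (2 * \<sigma>\<^sup>2) + 1 / 32 * qmin) / 2) / (1 - 1 / 32 * qmin / (4 * (2 * \<sigma>\<^sup>2) + 1 / 32 * qmin)))
          * ((real n - real (M n)) / 2 - 1)"
        using large unfolding r_eq .
    qed
    then show "\<omega> \<in> ?E" using sp by simp
  qed
  then have "prob (S.good s) \<le> prob ?E" by (intro finite_measure_mono E)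
  then show ?thesis using S.prob_good(2)[OF s(1)] by linarith
qed

end

lemma eventually_upper_bounded_ratio:
  fixes f g :: "nat \<Rightarrow> real"
  assumes "(\<lambda>n. f n / g n) \<longlonglongrightarrow> L" "L < c" "eventually (\<lambda>n. g n > 0) sequentially"
  shows "eventually (\<lambda>n. f n < c * g n) sequentially"
  using order_tendstoD(2)[OF assms(1,2)] assms(3)
  by eventually_elim (simp add: pos_divide_less_eq)

text \<open>If every dimension were below the largest element \<open>K\<close> of \<open>t\<close>, then the limit, a supremum of
  integers, would be at most \<open>K - 1\<close>.\<close>

lemma mono_dimension_eventually_covers:
  fixes M :: "nat \<Rightarrow> nat"
  assumes mono: "mono_on {1..} M" and fin: "finite t" and t: "\<And>i. i \<in> t \<Longrightarrow> 1 \<le> i"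
    and lim: "lim (\<lambda>n. ereal (real (M n))) \<ge> ereal (real (Max (insert 0 t)))"
  shows "eventually (\<lambda>n. t \<subseteq> {1..M n}) sequentially"
proof -
  define K where "K = Max (insert 0 t)"
  have "\<exists>n0\<ge>1. K \<le> M n0"
  proof (rule ccontr)
    assume "\<not> ?thesis"
    then have less: "M (Suc n) < K" for n by (metis not_le le_add1 plus_1_eq_Suc)
    let ?f = "\<lambda>n. ereal (real (M (Suc n)))"
    have "incseq ?f" using mono by (auto simp: incseq_def mono_on_def)
    then have "?f \<longlonglongrightarrow> (SUP n. ?f n)" by (rule LIMSEQ_SUP)
    then have "(\<lambda>n. ereal (real (M n))) \<longlonglongrightarrow> (SUP n. ?f n)" by (rule LIMSEQ_imp_Suc)
    then have "lim (\<lambda>n. ereal (real (M n))) = (SUP n. ?f n)" by (rule limI)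
    also have "\<dots> \<le> ereal (real K - 1)"
    proof (rule SUP_least)
      show "?f n \<le> ereal (real K - 1)" for n using less[of n] by simp
    qed
    also have "\<dots> < ereal (real K)" by simp
    finally show False using lim by (simp add: K_def)
  qed
  then obtain n0 where n0: "n0 \<ge> 1" "K \<le> M n0" by blast
  have "t \<subseteq> {1..M n}" if "n \<ge> n0" for n
  proof
    fix i assume i: "i \<in> t"
    have "i \<le> K" unfolding K_def using i fin by (intro Max_ge) auto
    also have "K \<le> M n" using n0 that monotone_onD[OF mono, of n0 n] by auto
    finally show "i \<in> {1..M n}" using t[OF i] by simp
  qed
  then show ?thesis by (auto simp: eventually_sequentially)
qed

text \<open>The assumption gives \<open>M n \<le> n powr p\<close> with \<open>p = 1 / (1 + \<eta>) < 1\<close>, so \<open>M n * ln (2 n\<^sup>2 + 1) = o(n)\<close> and the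
  exponential decay wins.\<close>

lemma net_cardinality_negligible:
  fixes M :: "nat \<Rightarrow> nat" and \<eta> h :: real
  assumes \<eta>: "\<eta> > 0" and h: "h > 0" and lim: "(\<lambda>n. real (M n) powr (1 + \<eta>) / real n) \<longlonglongrightarrow> 0"
  shows "(\<lambda>n. (2 * real n ^ 2 + 1) ^ M n * exp (- real n / h)) \<longlonglongrightarrow> 0"
proof -
  define p where "p = 1 / (1 + \<eta>)"
  have p: "p < 1" "p > 0" using \<eta> by (auto simp: p_def)
  have "eventually (\<lambda>n. real (M n) powr (1 + \<eta>) < 1 * real n) sequentially"
    by (rule eventually_upper_bounded_ratio[OF lim]) (auto simp: eventually_gt_at_top)
  then have Mp: "eventually (\<lambda>n. real (M n) \<le> real n powr p) sequentially"
  proof eventually_elim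
    case (elim n)
    have "real (M n) = (real (M n) powr (1 + \<eta>)) powr p" using \<eta> by (simp add: powr_powr p_def)
    also have "\<dots> \<le> real n powr p" using elim p by (intro powr_mono2) auto
    finally show ?case .
  qed
  have lg: "(\<lambda>n. real n powr p * ln (2 * real n ^ 2 + 1) / real n) \<longlonglongrightarrow> 0"
    using p by real_asymp
  have "eventually (\<lambda>n. real n powr p * ln (2 * real n ^ 2 + 1) < 1 / (2 * h) * real n) sequentially"
    by (rule eventually_upper_bounded_ratio[OF lg]) (use h in \<open>auto simp: eventually_gt_at_top\<close>)
  with Mp have bound: "eventually (\<lambda>n. (2 * real n ^ 2 + 1) ^ M n * exp (- real n / h) \<le> exp (- real n / (2 * h))) sequentially"
  proof eventually_elim
    case (elim n)
    have "(2 * real n ^ 2 + 1) ^ M n = exp (real (M n) * ln (2 * real n ^ 2 + 1))"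
      by (simp add: exp_of_nat_mult add_nonneg_pos)
    also have "\<dots> \<le> exp (1 / (2 * h) * real n)"
    proof -
      have "real (M n) * ln (2 * real n ^ 2 + 1) \<le> real n powr p * ln (2 * real n ^ 2 + 1)"
        using elim(1) by (intro mult_right_mono) auto
      then show ?thesis using elim(2) by simp
    qed
    finally have "(2 * real n ^ 2 + 1) ^ M n * exp (- real n / h) \<le> exp (1 / (2 * h) * real n) * exp (- real n / h)"
      by (intro mult_right_mono) auto
    also have "\<dots> = exp (- real n / (2 * h))" using h by (simp add: exp_add[symmetric] field_simps)
    finally show ?case .
  qed
  have "(\<lambda>n. exp (- real n / (2 * h))) \<longlonglongrightarrow> 0" using h by real_asymp
  then show ?thesis
    by (rule tendsto_sandwich[OF _ bound tendsto_const, rotated]) auto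
qed

theorem theorem2:
  fixes P :: "nat \<Rightarrow> 'a measure"
    and M :: "nat \<Rightarrow> nat"
    and x :: "nat \<Rightarrow> nat \<Rightarrow> nat \<Rightarrow> 'a \<Rightarrow> real"
    and eps :: "nat \<Rightarrow> nat \<Rightarrow> 'a \<Rightarrow> real"
    and \<beta> a :: "nat \<Rightarrow> real"
    and \<sigma> \<kappa> \<eta> :: real
    and sel :: "nat \<Rightarrow> 'a \<Rightarrow> nat set"
  assumes setting: "random_design_regression P M x eps \<beta> \<sigma>"
    and a_nonneg: "\<And>n. n \<ge> 1 \<Longrightarrow> a n \<ge> 0"
    and a_lim: "filterlim a at_top sequentially"
    and sel_measurable: "\<And>n. n \<ge> 1 \<Longrightarrow> M n < n \<Longrightarrow>
      sel n \<in> measurable (P n) (count_space (Pow {1..M n}))"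
    and sel_mpvc: "\<And>n \<omega>. n \<ge> 1 \<Longrightarrow> M n < n \<Longrightarrow> \<omega> \<in> space (P n) \<Longrightarrow>
      is_mpvc_choice n (M n) (a n) (\<lambda>l i. x n l i \<omega>)
        (response (M n) \<beta> (\<lambda>l i. x n l i \<omega>) (\<lambda>l. eps n l \<omega>)) (sel n \<omega>)"
    and cond1: "\<And>n. n \<ge> 1 \<Longrightarrow> true_model \<beta> \<subseteq> {1..M n} \<Longrightarrow>
      pos_def_mat (gram (P n) (true_model \<beta>) (x n 1))"
    and cond2: "(\<lambda>n. real (M n) / a n) \<longlonglongrightarrow> 0"
    and cond3: "lim (\<lambda>n. ereal (real (M n))) \<ge> ereal (real (Max (insert 0 (true_model \<beta>))))"
    and cond4: "\<kappa> > 0"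
      "\<And>n. n \<ge> 1 \<Longrightarrow> M n \<ge> 1 \<Longrightarrow> min_eigenvalue (gram (P n) {1..M n} (x n 1)) > \<kappa>"
    and cond5: "\<eta> > 0"
      "(\<lambda>n. real (M n) powr (1 + \<eta>) / real n) \<longlonglongrightarrow> 0"
      "(SUP n\<in>{1..}. SUP d\<in>{d \<in> carrier_vec (M n). sqrt (scalar_prod d d) = 1}.
          \<integral>\<^sup>+\<omega>. ennreal (\<bar>scalar_prod d (standardized_row (P n) (M n) (x n 1) \<omega>)\<bar>
            ^ (4 * nat \<lceil>2 / \<eta>\<rceil>)) \<partial>(P n)) < \<infinity>"
    and cond6: "(\<lambda>n. a n / real n) \<longlonglongrightarrow> 0"
  shows "(\<lambda>n. measure (P n) {\<omega> \<in> space (P n). sel n \<omega> = true_model \<beta>}) \<longlonglongrightarrow> 1"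
proof -
  interpret random_design_regression P M x eps \<beta> \<sigma> by (rule setting)
  let ?t = "true_model \<beta>" and ?R = "nat \<lceil>2 / \<eta>\<rceil>"
  let ?moment = "\<lambda>n d. \<integral>\<^sup>+\<omega>. ennreal (\<bar>scalar_prod d (standardized_row (P n) (M n) (x n 1) \<omega>)\<bar> ^ (4 * ?R)) \<partial>(P n)"
  have R: "?R \<ge> 1" using cond5(1) by (simp add: Suc_le_eq One_nat_def)
  define S where "S = (SUP n\<in>{1..}. SUP d\<in>{d \<in> carrier_vec (M n). sqrt (scalar_prod d d) = 1}. ?moment n d)"
  define C where "C = enn2real S"
  have C: "C \<ge> 0" "S = ennreal C"
    using cond5(3) unfolding S_def[symmetric] by (simp_all add: C_def ennreal_enn2real_if)
  have moment: "?moment n d \<le> ennreal C" if "n \<ge> 1" "d \<in> carrier_vec (M n)" "sqrt (scalar_prod d d) = 1" for n d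
    unfolding C(2)[symmetric] S_def using that by (intro SUP_upper2[where i = n] SUP_upper2[where i = d]) auto
  (* The element 1 keeps the minimum meaningful and positive when the true model is empty. *)
  define qmin where "qmin = Min (insert 1 ((\<lambda>i. \<kappa> * (\<beta> i)\<^sup>2) ` ?t))"
  have qmin: "qmin > 0" "\<And>i. i \<in> ?t \<Longrightarrow> qmin \<le> \<kappa> * (\<beta> i)\<^sup>2"
    unfolding qmin_def using finite_true_model cond4(1) by (auto simp: true_model_def)
  define r where "r = qmin / 32 / (8 * \<sigma>\<^sup>2 + qmin / 32)"
  define L where "L = ln ((1 - r / 2) / (1 - r))"
  have r: "0 < r" "r < 1" using qmin(1) sigma_pos by (auto simp: r_def add_pos_pos)
  have L: "L > 0" unfolding L_def using r by (intro ln_gt_zero) (simp add: field_simps)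
  (* The geometric mean of a n and M n: large compared with M n * \<sigma>^2, the mean of the cross
        terms divided by n, and small compared with a n. *)
  define s where "s n = sqrt (a n * M n)" for n

  have a_pos: "eventually (\<lambda>n. a n > 0) sequentially"
    using a_lim by (auto simp: filterlim_at_top_dense)
  have n_pos: "eventually (\<lambda>n. real n > 0) sequentially" by (auto simp: eventually_gt_at_top)
  have Mn: "(\<lambda>n. real (M n) / real n) \<longlonglongrightarrow> 0"
  proof (rule Lim_transform_eventually)
    show "(\<lambda>n. real (M n) / a n * (a n / real n)) \<longlonglongrightarrow> 0"
      using tendsto_mult[OF cond2 cond6] by simp
    show "eventually (\<lambda>n. real (M n) / a n * (a n / real n) = real (M n) / real n) sequentially"
      using a_pos by eventually_elim simp
  qed
  have sqrt_Ma: "(\<lambda>n. sqrt (real (M n) / a n)) \<longlonglongrightarrow> 0" using tendsto_real_sqrt[OF cond2] by simp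
  have sa: "(\<lambda>n. s n / a n) \<longlonglongrightarrow> 0"
  proof (rule Lim_transform_eventually[OF sqrt_Ma])
    show "eventually (\<lambda>n. sqrt (real (M n) / a n) = s n / a n) sequentially"
      using a_pos
    proof eventually_elim
      case (elim n)
      have "s n / a n = sqrt (a n) * sqrt (M n) / (sqrt (a n) * sqrt (a n))"
        using elim by (simp add: s_def real_sqrt_mult)
      also have "\<dots> = sqrt (real (M n) / a n)" using elim by (simp add: real_sqrt_divide del: real_sqrt_mult_self)
      finally show ?case by simp
    qed
  qed
  have Ms: "(\<lambda>n. real (M n) * \<sigma>\<^sup>2 / s n) \<longlonglongrightarrow> 0"
  proof (rule Lim_transform_eventually)
    show "(\<lambda>n. \<sigma>\<^sup>2 * sqrt (real (M n) / a n)) \<longlonglongrightarrow> 0"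
      using tendsto_mult_left[OF sqrt_Ma, of "\<sigma>\<^sup>2"] by simp
    show "eventually (\<lambda>n. \<sigma>\<^sup>2 * sqrt (real (M n) / a n) = real (M n) * \<sigma>\<^sup>2 / s n) sequentially"
      using a_pos
    proof eventually_elim
      case (elim n)
      have "\<sigma>\<^sup>2 * sqrt (real (M n) / a n) = \<sigma>\<^sup>2 * (sqrt (M n) / sqrt (a n))" by (simp add: real_sqrt_divide)
      also have "\<dots> = sqrt (M n) * sqrt (M n) * \<sigma>\<^sup>2 / (sqrt (a n) * sqrt (M n))"
        by (cases "sqrt (M n) = 0") (simp_all del: real_sqrt_eq_0_iff real_sqrt_mult_self)
      also have "\<dots> = real (M n) * \<sigma>\<^sup>2 / s n" by (simp add: s_def real_sqrt_mult)
      finally show ?case .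
    qed
  qed
  have sn: "(\<lambda>n. s n / real n) \<longlonglongrightarrow> 0"
  proof (rule Lim_transform_eventually)
    show "(\<lambda>n. s n / a n * (a n / real n)) \<longlonglongrightarrow> 0"
      using tendsto_mult[OF sa cond6] by simp
    show "eventually (\<lambda>n. s n / a n * (a n / real n) = s n / real n) sequentially"
      using a_pos by eventually_elim simp
  qed
  have sub: "eventually (\<lambda>n. ?t \<subseteq> {1..M n}) sequentially"
    by (rule mono_dimension_eventually_covers[OF mono_M finite_true_model _ cond3]) (simp add: true_model_def)
  (* The numerical hypotheses at a single sample size, each with room to spare. *)
  have ev1: "eventually (\<lambda>n. s n < \<sigma>\<^sup>2 / 512 * real n) sequentially"
    by (rule eventually_upper_bounded_ratio[OF sn _ n_pos]) (use sigma_pos in simp)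
  have ev2: "eventually (\<lambda>n. s n < qmin / 8192 * real n) sequentially"
    by (rule eventually_upper_bounded_ratio[OF sn _ n_pos]) (use qmin in simp)
  have ev3: "eventually (\<lambda>n. s n < \<sigma>\<^sup>2 / 512 * a n) sequentially"
    by (rule eventually_upper_bounded_ratio[OF sa _ a_pos]) (use sigma_pos in simp)
  have ev4: "eventually (\<lambda>n. a n > 2 * ln 4) sequentially" using a_lim by (auto simp: filterlim_at_top_dense)
  have ev5: "eventually (\<lambda>n. real (M n) < 1 / 2 * real n) sequentially"
    by (rule eventually_upper_bounded_ratio[OF Mn _ n_pos]) simp
  (* The condition under which every model missing a true coefficient loses, with all terms except
        L * n / 2 collected on one side. *)
  let ?lhs = "\<lambda>n. M n / (2 * r) + M n / 2 * ln (2 / r) + (real (card ?t) + 1) * a n + L * (real (M n) / 2 + 1)"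
  have "(\<lambda>n. (1 / (2 * r) + ln (2 / r) / 2 + L / 2) * (real (M n) / real n) + (real (card ?t) + 1) * (a n / real n) + L * (1 / real n)) \<longlonglongrightarrow>
      (1 / (2 * r) + ln (2 / r) / 2 + L / 2) * 0 + (real (card ?t) + 1) * 0 + L * 0"
    by (intro tendsto_intros Mn cond6 lim_1_over_n)
  then have "(\<lambda>n. (1 / (2 * r) + ln (2 / r) / 2 + L / 2) * (real (M n) / real n) + (real (card ?t) + 1) * (a n / real n) + L * (1 / real n)) \<longlonglongrightarrow> 0"
    by simp
  then have "(\<lambda>n. ?lhs n / real n) \<longlonglongrightarrow> 0"
    by (rule Lim_transform_eventually) (auto intro!: always_eventually simp: add_divide_distrib algebra_simps)
  then have ev6: "eventually (\<lambda>n. ?lhs n < L / 2 * real n) sequentially"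
    by (rule eventually_upper_bounded_ratio[OF _ _ n_pos]) (use L in simp)

  let ?err = "\<lambda>n. 1 / real n + M n * \<sigma>\<^sup>2 / s n + 8 / real n + (2 * real n ^ 2 + 1) ^ M n * exp (- real n / (8 * (1 + C)))"
  have lim8: "(\<lambda>n. 8 / real n) \<longlonglongrightarrow> 0" by real_asymp
  have "?err \<longlonglongrightarrow> 0 + 0 + 0 + 0"
    by (intro tendsto_add Ms net_cardinality_negligible[OF cond5(1) _ cond5(2)] lim_1_over_n lim8) (use C in simp_all)
  then have "(\<lambda>n. 1 - ?err n) \<longlonglongrightarrow> 1 - (0 + 0 + 0 + 0)" by (intro tendsto_diff tendsto_const)
  then have low: "(\<lambda>n. 1 - ?err n) \<longlonglongrightarrow> 1" by simp
  have "eventually (\<lambda>n. 1 - ?err n \<le> measure (P n) {\<omega> \<in> space (P n). sel n \<omega> = ?t}) sequentially"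
    using sub ev1 ev2 ev3 ev4 ev5 ev6 a_pos eventually_ge_at_top[of 32]
  proof eventually_elim
    case (elim n)
    have n1: "n \<ge> 1" and Mless: "M n < n" "M n + 2 \<le> n" using elim(6,9) by linarith+
    interpret prob_space "P n" by (rule prob_space[OF n1])
    show ?case
    proof (cases "M n = 0")
      case True
      then have "?t = {}" using elim(1) by simp
      moreover have "sel n \<omega> = {}" if "\<omega> \<in> space (P n)" for \<omega>
        using measurable_space[OF sel_measurable[OF n1 Mless(1)] that] True by simp
      ultimately have "{\<omega> \<in> space (P n). sel n \<omega> = ?t} = space (P n)" by auto
      then have "measure (P n) {\<omega> \<in> space (P n). sel n \<omega> = ?t} = 1" by (simp add: prob_space)
      moreover have "0 \<le> ?err n" using True by (intro add_nonneg_nonneg) simp_all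
      ultimately show ?thesis by linarith
    next
      case False
      show ?thesis
      proof (rule mpvc_consistency_bound[where an = "a n" and s = "s n" and C = C and \<kappa> = \<kappa> and qmin = qmin and R = ?R])
        show "min_eigenvalue (gram (P n) {1..M n} (x n 1)) > \<kappa>" using False by (intro cond4 n1) simp
        show "s n > 0" using False elim(8) by (simp add: s_def)
        show "256 * s n \<le> \<sigma>\<^sup>2 / 2 * n" "256 * s n \<le> qmin / 32 * n" using elim(2,3) by linarith+
        have "256 * s n / \<sigma>\<^sup>2 < a n / 2" using elim(4) sigma_pos by (simp add: field_simps)
        then show "256 * s n / \<sigma>\<^sup>2 + ln 4 < a n" using elim(5) by linarith
        have "?lhs n \<le> L * (real n / 2)" using elim(7) by simp
        then show "M n / (2 * (qmin / 32 / (8 * \<sigma>\<^sup>2 + qmin / 32))) + M n / 2 * ln (2 / (qmin / 32 / (8 * \<sigma>\<^sup>2 + qmin / 32)))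
            + (real (card ?t) + 1) * a n
          \<le> ln ((1 - qmin / 32 / (8 * \<sigma>\<^sup>2 + qmin / 32) / 2) / (1 - qmin / 32 / (8 * \<sigma>\<^sup>2 + qmin / 32))) * ((real n - real (M n)) / 2 - 1)"
          unfolding r_def[symmetric] L_def[symmetric] by (simp add: algebra_simps diff_divide_distrib)
      qed (use False elim Mless cond4 C R qmin moment[OF n1] sel_measurable[OF n1 Mless(1)] sel_mpvc[OF n1 Mless(1)] in auto)
    qed
  qed
  moreover have "eventually (\<lambda>n. measure (P n) {\<omega> \<in> space (P n). sel n \<omega> = ?t} \<le> 1) sequentially"
    using eventually_ge_at_top[of 1] by eventually_elim (rule prob_space.prob_le_1[OF prob_space])
  ultimately show ?thesis by (rule tendsto_sandwich[OF _ _ low tendsto_const])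
qed

end
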